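(* Let $C$ be a commutative ring with identity, $\lambda\in C$, and let $A$ be a $C$-algebra not necessarily having an identity. Then the shuffle Baxter algebra $(\mathrm{Sh}_C(A)^0,P_A)$, together with the natural embedding $j_A:A\to \mathrm{Sh}_C(A)^0$, is a free Baxter $C$-algebra on $A$ (of weight $\lambda$) in the category $\mathbf{Bax}_C^0$ of Baxter $C$-algebras not necessarily having an identity. That is, for any $(R,P)\in\mathbf{Bax}^0_C$ and any homomorphism $\varphi:A\to R$ of (not necessarily unital) $C$-algebras, there is a unique morphism $\tilde\varphi:(\mathrm{Sh}_C(A)^0,P_A)\to(R,P)$ in $\mathbf{Bax}_C^0$ such that $\tilde\varphi\circ j_A=\varphi$.
   Context: All rings and algebras are associative and commutative; $\otimes=\otimes_C$; $\mathbb N=\{0,1,2,\dots\}$. A Baxter $C$-algebra (of weight $\lambda$) is a pair $(R,P)$ with $R$ a $C$-algebra and $P:R\to R$ a $C$-linear map satisfying $P(x)P(y)=P(xP(y))+P(yP(x))+\lambda P(xy)$ for all $x,y\in R$. A homomorphism $f:(R,P)\to(S,Q)$ of Baxter algebras is a $C$-algebra homomorphism with $f\circ P=Q\circ f$. In $\mathbf{Bax}_C^0$ algebras need not have an identity (of weight $\lambda$), and homomorphisms are not required to preserve identities. Shuffle Baxter algebra with identity. For $m,n\ge1$ let $S(m,n)$ be the set of permutations $\sigma\in S_{m+n}$ with $\sigma^{-1}(1)<\dots<\sigma^{-1}(m)$ and $\sigma^{-1}(m+1)<\dots<\sigma^{-1}(m+n)$. A pair $(k,k+1)$, $1\le k<m+n$,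 is admissible for $\sigma$ if $\sigma(k)\le m<\sigma(k+1)$; $\mathcal T^\sigma$ is the set of admissible pairs; $\bar S(m,n)=\{(\sigma,T):\sigma\in S(m,n),\,T\subseteq\mathcal T^\sigma\}$. For a unital $C$-algebra $B$ and $x=x_1\otimes\dots\otimes x_m\in B^{\otimes m}$, $y=y_1\otimes\dots\otimes y_n\in B^{\otimes n}$, put $u_k=x_k$ for $k\le m$, $u_k=y_{k-m}$ for $k>m$, and let $\sigma(x\otimes y;T)$ be obtained from $u_{\sigma(1)}\otimes\dots\otimes u_{\sigma(m+n)}$ by replacing, for each $(k,k+1)\in T$, the tensor symbol between $u_{\sigma(k)}$ and $u_{\sigma(k+1)}$ by the product in $B$. Let $\mathrm{Sh}_C(B)=\bigoplus_{k\in\mathbb N}B^{\otimes(k+1)}$ with the $C$-bilinear product determined by $$(x_0\otimes x)\diamond(y_0\otimes y)=\sum_{(\sigma,T)\in\bar S(m,n)}\lambda^{|T|}\,x_0y_0\otimes\sigma(x\otimes y;T)$$ for $m,n\ge1$, and by $x_0\diamond(y_0\otimes y_1\otimes\dots\otimes y_n)=(y_0\otimes y_1\otimes\dots\otimes y_n)\diamond x_0=x_0y_0\otimes y_1\otimes\dots\otimes y_n$ for $x_0\in B$. With $P_B(x_0\otimes\dots\otimes x_n)=1_B\otimes x_0\otimes\dots\otimes x_n$, $(\mathrm{Sh}_C(B),P_B)$ is a (commutative, unital) Baxter $C$-algebra of weight $\lambda$. Non-unital version. Let $A^+=C\oplus A$ with componentwise addition and multiplication $(c,a)(d,b)=(cd,\,cb+da+ab)$;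 it is a unital $C$-algebra with identity $(1_C,0)$, containing $A$ via $a\mapsto(0,a)$. Define $$\mathrm{Sh}_C(A)^0=\bigoplus_{n\in\mathbb N}\big((A^+)^{\otimes n}\otimes A\big)\subseteq\mathrm{Sh}_C(A^+),\qquad (A^+)^{\otimes0}=C,$$ i.e. the $C$-submodule generated by tensors $x_0\otimes\dots\otimes x_n$ with $x_i\in A^+$ for $i<n$ and $x_n\in A$. It is closed under $\diamond$ and under $P_{A^+}$; $P_A$ denotes the restriction of $P_{A^+}$. The map $j_A$ is the inclusion of $A$ as the $n=0$ summand. *)

theory Defs
  imports "HOL-Algebra.Module" "HOL-Algebra.QuotRing" "HOL-Combinatorics.Permutations" "HOL.Hull"
begin

section \<open>Commutative algebras and Baxter algebras not necessarily having an identity\<close>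

text \<open>The field \<^const>\<open>one\<close> of the record \<open>A\<close> is not constrained.\<close>

locale comm_algebra0 = module C A for C (structure) and A (structure) +
  assumes mult_closed:
      "\<lbrakk>x \<in> carrier A; y \<in> carrier A\<rbrakk> \<Longrightarrow> x \<otimes>\<^bsub>A\<^esub> y \<in> carrier A"
    and mult_assoc:
      "\<lbrakk>x \<in> carrier A; y \<in> carrier A; z \<in> carrier A\<rbrakk>
        \<Longrightarrow> (x \<otimes>\<^bsub>A\<^esub> y) \<otimes>\<^bsub>A\<^esub> z = x \<otimes>\<^bsub>A\<^esub> (y \<otimes>\<^bsub>A\<^esub> z)"
    and mult_comm:
      "\<lbrakk>x \<in> carrier A; y \<in> carrier A\<rbrakk> \<Longrightarrow> x \<otimes>\<^bsub>A\<^esub> y = y \<otimes>\<^bsub>A\<^esub> x"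
    and mult_distr:
      "\<lbrakk>x \<in> carrier A; y \<in> carrier A; z \<in> carrier A\<rbrakk>
        \<Longrightarrow> (x \<oplus>\<^bsub>A\<^esub> y) \<otimes>\<^bsub>A\<^esub> z = x \<otimes>\<^bsub>A\<^esub> z \<oplus>\<^bsub>A\<^esub> y \<otimes>\<^bsub>A\<^esub> z"
    and smult_mult:
      "\<lbrakk>c \<in> carrier C; x \<in> carrier A; y \<in> carrier A\<rbrakk>
        \<Longrightarrow> (c \<odot>\<^bsub>A\<^esub> x) \<otimes>\<^bsub>A\<^esub> y = c \<odot>\<^bsub>A\<^esub> (x \<otimes>\<^bsub>A\<^esub> y)"

definition linear_maps ::
    "('c, 'm) ring_scheme \<Rightarrow> ('c, 'a, 'n) module_scheme \<Rightarrow> ('c, 'b, 'k) module_scheme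
      \<Rightarrow> ('a \<Rightarrow> 'b) set" where
  "linear_maps C M N =
    {f \<in> hom (add_monoid M) (add_monoid N).
      \<forall>c\<in>carrier C. \<forall>x\<in>carrier M. f (c \<odot>\<^bsub>M\<^esub> x) = c \<odot>\<^bsub>N\<^esub> f x}"

definition algebra0_hom ::
    "('c, 'm) ring_scheme \<Rightarrow> ('c, 'a, 'n) module_scheme \<Rightarrow> ('c, 'b, 'k) module_scheme
      \<Rightarrow> ('a \<Rightarrow> 'b) set" where
  "algebra0_hom C A B = linear_maps C A B \<inter> hom A B"

locale baxter_algebra0 = comm_algebra0 C R for C (structure) and lam and R (structure) and P +
  assumes weight_closed: "lam \<in> carrier C"
    and operator_linear: "P \<in> linear_maps C R R"
    and baxter:
      "\<lbrakk>x \<in> carrier R; y \<in> carrier R\<rbrakk>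
        \<Longrightarrow> P x \<otimes>\<^bsub>R\<^esub> P y
            = P (x \<otimes>\<^bsub>R\<^esub> P y) \<oplus>\<^bsub>R\<^esub> P (y \<otimes>\<^bsub>R\<^esub> P x) \<oplus>\<^bsub>R\<^esub> lam \<odot>\<^bsub>R\<^esub> P (x \<otimes>\<^bsub>R\<^esub> y)"

definition baxter0_hom ::
    "('c, 'm) ring_scheme \<Rightarrow> ('c, 'a, 'n) module_scheme \<Rightarrow> ('a \<Rightarrow> 'a)
      \<Rightarrow> ('c, 'b, 'k) module_scheme \<Rightarrow> ('b \<Rightarrow> 'b) \<Rightarrow> ('a \<Rightarrow> 'b) set" where
  "baxter0_hom C R P S Q =
    {f \<in> algebra0_hom C R S. \<forall>x\<in>carrier R. f (P x) = Q (f x)}"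


section \<open>Mixable shuffles\<close>

definition shuffles_perm :: "nat \<Rightarrow> nat \<Rightarrow> (nat \<Rightarrow> nat) set" where
  "shuffles_perm m n =
    {\<sigma>. \<sigma> permutes {1..m+n} \<and>
        strict_mono_on {1..m} (inv_into UNIV \<sigma>) \<and>
        strict_mono_on {m+1..m+n} (inv_into UNIV \<sigma>)}"

definition admissible_pairs :: "nat \<Rightarrow> nat \<Rightarrow> (nat \<Rightarrow> nat) \<Rightarrow> (nat \<times> nat) set" where
  "admissible_pairs m n \<sigma> = {(k, k+1) | k. 1 \<le> k \<and> k < m + n \<and> \<sigma> k \<le> m \<and> m < \<sigma> (k+1)}"

definition mixable_shuffles :: "nat \<Rightarrow> nat \<Rightarrow> ((nat \<Rightarrow> nat) \<times> (nat \<times> nat) set) set" where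
  "mixable_shuffles m n = {(\<sigma>, T). \<sigma> \<in> shuffles_perm m n \<and> T \<subseteq> admissible_pairs m n \<sigma>}"

text \<open>
  \<open>contract B T k [u\<^sub>k, u\<^sub>k\<^sub>+\<^sub>1, \<dots>]\<close> multiplies together the neighbours in positions \<open>i\<close> and \<open>i+1\<close>
  for every \<open>(i, i+1) \<in> T\<close>.  In a recursive call after a merge, \<open>k\<close> is the position of the
  last letter that has been absorbed into the head of the list.
\<close>

fun contract :: "('b, 'm) monoid_scheme \<Rightarrow> (nat \<times> nat) set \<Rightarrow> nat \<Rightarrow> 'b list \<Rightarrow> 'b list" where
  "contract B T k [] = []"
| "contract B T k [u] = [u]"
| "contract B T k (u # v # us) =
    (if (k, k+1) \<in> T then contract B T (k+1) ((u \<otimes>\<^bsub>B\<^esub> v) # us)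
     else u # contract B T (k+1) (v # us))"

definition shuffle_word ::
    "('b, 'm) monoid_scheme \<Rightarrow> 'b list \<Rightarrow> 'b list \<Rightarrow> (nat \<Rightarrow> nat) \<Rightarrow> (nat \<times> nat) set \<Rightarrow> 'b list" where
  "shuffle_word B x y \<sigma> T =
    contract B T 1 (map (\<lambda>k. (x @ y) ! (\<sigma> k - 1)) [1..<length x + length y + 1])"


section \<open>Free modules\<close>

text \<open>The fields \<open>mult\<close> and \<open>one\<close> are placeholders, overwritten in \<open>word_algebra\<close> below.\<close>

definition free_module :: "('c, 'm) ring_scheme \<Rightarrow> 'x set \<Rightarrow> ('c, 'x \<Rightarrow> 'c) module" where
  "free_module C X =
    \<lparr>carrier = {f. (\<forall>x. f x \<in> carrier C) \<and> finite {x. f x \<noteq> \<zero>\<^bsub>C\<^esub>} \<and> {x. f x \<noteq> \<zero>\<^bsub>C\<^esub>} \<subseteq> X},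
     monoid.mult = undefined, one = undefined,
     zero = (\<lambda>x. \<zero>\<^bsub>C\<^esub>), add = (\<lambda>f g x. f x \<oplus>\<^bsub>C\<^esub> g x),
     smult = (\<lambda>c f x. c \<otimes>\<^bsub>C\<^esub> f x)\<rparr>"

definition basis_vec :: "('c, 'm) ring_scheme \<Rightarrow> 'x \<Rightarrow> 'x \<Rightarrow> 'c" where
  "basis_vec C w = (\<lambda>x. if x = w then \<one>\<^bsub>C\<^esub> else \<zero>\<^bsub>C\<^esub>)"

definition supp :: "('c, 'm) ring_scheme \<Rightarrow> ('x \<Rightarrow> 'c) \<Rightarrow> 'x set" where
  "supp C f = {x. f x \<noteq> \<zero>\<^bsub>C\<^esub>}"

definition submodule_gen ::
    "('c, 'm) ring_scheme \<Rightarrow> ('c, 'a, 'n) module_scheme \<Rightarrow> 'a set \<Rightarrow> 'a set" where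
  "submodule_gen C M S = (\<lambda>H. submodule H C M) hull S"


section \<open>The shuffle Baxter algebra of a unital algebra\<close>

text \<open>
  The module underlying \<open>Sh\<^sub>C(B)\<close>, the direct sum of the tensor powers \<open>B\<^sup>\<otimes>\<^sup>(\<^sup>k\<^sup>+\<^sup>1\<^sup>)\<close>, is constructed as the
  free \<open>C\<close>-module on the nonempty words over \<open>B\<close> modulo multilinearity in each letter.  Every
  relation involves words of a single length \<open>k+1\<close>, so the quotient is the direct sum
  over \<open>k\<close> of the usual presentations of the tensor powers \<open>B\<^sup>\<otimes>\<^sup>(\<^sup>k\<^sup>+\<^sup>1\<^sup>)\<close>; the class of the word
  \<open>[x\<^sub>0, \<dots>, x\<^sub>k]\<close> is the pure tensor \<open>x\<^sub>0 \<otimes> \<dots> \<otimes> x\<^sub>k\<close>.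
\<close>

definition words :: "('b, 'm) monoid_scheme \<Rightarrow> 'b list set" where
  "words B = {w. w \<noteq> [] \<and> set w \<subseteq> carrier B}"

definition word_module ::
    "('c, 'm) ring_scheme \<Rightarrow> ('c, 'b, 'n) module_scheme \<Rightarrow> ('c, 'b list \<Rightarrow> 'c) module" where
  "word_module C B = free_module C (words B)"

fun diamond ::
    "('c, 'm) ring_scheme \<Rightarrow> 'c \<Rightarrow> ('c, 'b, 'n) module_scheme
      \<Rightarrow> 'b list \<Rightarrow> 'b list \<Rightarrow> 'b list \<Rightarrow> 'c" where
  "diamond C lam B (x\<^sub>0 # x) (y\<^sub>0 # y) =
    (if x = [] then basis_vec C ((x\<^sub>0 \<otimes>\<^bsub>B\<^esub> y\<^sub>0) # y)
     else if y = [] then basis_vec C ((x\<^sub>0 \<otimes>\<^bsub>B\<^esub> y\<^sub>0) # x)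
     else finsum (word_module C B)
            (\<lambda>(\<sigma>, T). (lam [^]\<^bsub>C\<^esub> card T) \<odot>\<^bsub>word_module C B\<^esub>
              basis_vec C ((x\<^sub>0 \<otimes>\<^bsub>B\<^esub> y\<^sub>0) # shuffle_word B x y \<sigma> T))
            (mixable_shuffles (length x) (length y)))"
| "diamond C lam B [] y = undefined"
| "diamond C lam B x [] = undefined"

definition word_algebra ::
    "('c, 'm) ring_scheme \<Rightarrow> 'c \<Rightarrow> ('c, 'b, 'n) module_scheme \<Rightarrow> ('c, 'b list \<Rightarrow> 'c) module" where
  "word_algebra C lam B = (word_module C B)
    \<lparr>monoid.mult := (\<lambda>f g. \<Oplus>\<^bsub>word_module C B\<^esub>v\<in>supp C f. \<Oplus>\<^bsub>word_module C B\<^esub>w\<in>supp C g.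
        (f v \<otimes>\<^bsub>C\<^esub> g w) \<odot>\<^bsub>word_module C B\<^esub> diamond C lam B v w),
     one := basis_vec C [\<one>\<^bsub>B\<^esub>]\<rparr>"

definition multilinear_relations ::
    "('c, 'm) ring_scheme \<Rightarrow> ('c, 'b, 'n) module_scheme \<Rightarrow> ('b list \<Rightarrow> 'c) set" where
  "multilinear_relations C B =
    {basis_vec C (us @ [a \<oplus>\<^bsub>B\<^esub> b] @ vs) \<ominus>\<^bsub>word_module C B\<^esub>
       (basis_vec C (us @ [a] @ vs) \<oplus>\<^bsub>word_module C B\<^esub> basis_vec C (us @ [b] @ vs))
     | us vs a b. set us \<subseteq> carrier B \<and> set vs \<subseteq> carrier B \<and> a \<in> carrier B \<and> b \<in> carrier B} \<union>
    {basis_vec C (us @ [c \<odot>\<^bsub>B\<^esub> a] @ vs) \<ominus>\<^bsub>word_module C B\<^esub>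
       c \<odot>\<^bsub>word_module C B\<^esub> basis_vec C (us @ [a] @ vs)
     | us vs c a. set us \<subseteq> carrier B \<and> set vs \<subseteq> carrier B \<and> c \<in> carrier C \<and> a \<in> carrier B}"

definition tensor_ideal ::
    "('c, 'm) ring_scheme \<Rightarrow> ('c, 'b, 'n) module_scheme \<Rightarrow> ('b list \<Rightarrow> 'c) set" where
  "tensor_ideal C B = submodule_gen C (word_module C B) (multilinear_relations C B)"

definition pure_tensor ::
    "('c, 'm) ring_scheme \<Rightarrow> ('c, 'b, 'n) module_scheme \<Rightarrow> 'b list \<Rightarrow> ('b list \<Rightarrow> 'c) set" where
  "pure_tensor C B w = tensor_ideal C B +>\<^bsub>word_module C B\<^esub> basis_vec C w"

text \<open>The operations on cosets are formed as in \<^const>\<open>FactRing\<close>.\<close>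

definition Sh ::
    "('c, 'm) ring_scheme \<Rightarrow> 'c \<Rightarrow> ('c, 'b, 'n) module_scheme
      \<Rightarrow> ('c, ('b list \<Rightarrow> 'c) set) module" where
  "Sh C lam B =
    (let F = word_algebra C lam B; I = tensor_ideal C B in
     \<lparr>carrier = a_rcosets\<^bsub>F\<^esub> I, monoid.mult = rcoset_mult F I,
      one = I +>\<^bsub>F\<^esub> \<one>\<^bsub>F\<^esub>, zero = I, add = set_add F,
      smult = (\<lambda>c X. \<Union>f\<in>X. I +>\<^bsub>F\<^esub> (c \<odot>\<^bsub>F\<^esub> f))\<rparr>)"

definition Sh_P ::
    "('c, 'm) ring_scheme \<Rightarrow> ('c, 'b, 'n) module_scheme
      \<Rightarrow> ('b list \<Rightarrow> 'c) set \<Rightarrow> ('b list \<Rightarrow> 'c) set" where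
  "Sh_P C B X =
    (let F = word_module C B; I = tensor_ideal C B in
     \<Union>f\<in>X. I +>\<^bsub>F\<^esub> (\<Oplus>\<^bsub>F\<^esub>w\<in>supp C f. f w \<odot>\<^bsub>F\<^esub> basis_vec C (\<one>\<^bsub>B\<^esub> # w)))"


section \<open>The shuffle Baxter algebra of an algebra not necessarily having an identity\<close>

definition unitization ::
    "('c, 'm) ring_scheme \<Rightarrow> ('c, 'a, 'n) module_scheme \<Rightarrow> ('c, 'c \<times> 'a) module" where
  "unitization C A =
    \<lparr>carrier = carrier C \<times> carrier A,
     monoid.mult = (\<lambda>(c, a) (d, b). (c \<otimes>\<^bsub>C\<^esub> d, c \<odot>\<^bsub>A\<^esub> b \<oplus>\<^bsub>A\<^esub> d \<odot>\<^bsub>A\<^esub> a \<oplus>\<^bsub>A\<^esub> a \<otimes>\<^bsub>A\<^esub> b)),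
     one = (\<one>\<^bsub>C\<^esub>, \<zero>\<^bsub>A\<^esub>),
     zero = (\<zero>\<^bsub>C\<^esub>, \<zero>\<^bsub>A\<^esub>),
     add = (\<lambda>(c, a) (d, b). (c \<oplus>\<^bsub>C\<^esub> d, a \<oplus>\<^bsub>A\<^esub> b)),
     smult = (\<lambda>r (c, a). (r \<otimes>\<^bsub>C\<^esub> c, r \<odot>\<^bsub>A\<^esub> a))\<rparr>"

text \<open>
  The record field \<^const>\<open>one\<close> of \<open>Sh0\<close> is inherited from \<^const>\<open>Sh\<close>; in general it is not an
  element of the carrier, and \<^locale>\<open>comm_algebra0\<close> does not refer to it.
\<close>

definition Sh0 ::
    "('c, 'm) ring_scheme \<Rightarrow> 'c \<Rightarrow> ('c, 'a, 'n) module_scheme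
      \<Rightarrow> ('c, (('c \<times> 'a) list \<Rightarrow> 'c) set) module" where
  "Sh0 C lam A = (Sh C lam (unitization C A))
    \<lparr>carrier := submodule_gen C (Sh C lam (unitization C A))
       {pure_tensor C (unitization C A) w
        | w. w \<in> words (unitization C A) \<and> last w \<in> {\<zero>\<^bsub>C\<^esub>} \<times> carrier A}\<rparr>"

definition Sh0_P ::
    "('c, 'm) ring_scheme \<Rightarrow> 'c \<Rightarrow> ('c, 'a, 'n) module_scheme
      \<Rightarrow> (('c \<times> 'a) list \<Rightarrow> 'c) set \<Rightarrow> (('c \<times> 'a) list \<Rightarrow> 'c) set" where
  "Sh0_P C lam A = restrict (Sh_P C (unitization C A)) (carrier (Sh0 C lam A))"

definition Sh0_j ::
    "('c, 'm) ring_scheme \<Rightarrow> ('c, 'a, 'n) module_scheme \<Rightarrow> 'a \<Rightarrow> (('c \<times> 'a) list \<Rightarrow> 'c) set" where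
  "Sh0_j C A a = pure_tensor C (unitization C A) [(\<zero>\<^bsub>C\<^esub>, a)]"

end

theory Submission
  imports Defs
begin

text \<open>
  Everything rests on a recursive form of the mixable shuffle product.  Write \<open>x * y\<close> for the sum of all
  mixable shuffles of two words, a merger being weighted by \<open>lam\<close>.  The first letter of a
  mixable shuffle of \<open>a x\<close> and \<open>b y\<close> is \<open>a\<close>, or \<open>b\<close>, or the merged letter \<open>a b\<close>, and therefore
  \<open>a x * b y = a (x * b y) + b (a x * y) + lam (a b) (x * y)\<close>.
  The function \<open>mixsum\<close> is this recursion.  It does not build a formal sum of words: for a
  function \<open>g\<close> from words to an arbitrary module it returns the value of the linear extension of \<open>g\<close> at
  \<open>x * y\<close>.  In this form linear maps pass through the product, and commutativity and associativity
  (\<open>mixsum_commute\<close>, \<open>mixsum_assoc\<close>) are inductions on the lengths of the words.  That the recursion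
  agrees with the sum over the pairs \<open>(\<sigma>, T)\<close> is \<open>mixsum_eq_mixable_shuffles\<close>.

  These inductions use no relation between words.  So the free module on the words over a unital algebra is
  already a Baxter algebra, before multilinearity is imposed (\<open>word_algebra_baxter\<close>): for the operator
  that puts \<open>1\<close> in front of a word, the Baxter identity is the recursion itself.  If \<open>g\<close> is
  multilinear, then so is the value of \<open>g\<close> at \<open>x * y\<close> as a function of \<open>x\<close>; hence the multilinear
  relations generate an ideal that is stable under the operator, and the shuffle algebra is a quotient Baxter
  algebra (\<open>Sh_baxter\<close>).  In it, the tensors whose last letter lies in the ideal \<open>A\<close> of
  \<open>A\<^sup>+\<close> span a Baxter subalgebra (\<open>Sh0_baxter\<close>).

  A tensor \<open>(c, a) \<otimes> w\<close> equals \<open>c P(w) + a P(w)\<close>.  So a Baxter morphism is determined on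
  tensors by its values on \<open>A\<close> (\<open>hom_determined\<close>), and it has to send \<open>x\<^sub>0 \<otimes> \<dots> \<otimes> x\<^sub>n\<close> to
  \<open>x\<^sub>0 P(x\<^sub>1 P(\<dots> P(x\<^sub>n)))\<close>, where \<open>A\<^sup>+\<close> acts on the target \<open>R\<close> through \<open>\<phi>\<close>.  That this formula
  is multiplicative is proved inside \<open>R\<^sup>+\<close>, where the empty word has a value, namely \<open>1\<close>.  With
  \<open>p [] = 1\<close> and \<open>p (b w) = P (b p(w))\<close> the claim becomes \<open>p(x) p(y) = p(x * y)\<close>
  (\<open>nest_mult\<close>), and the recursion for \<open>x * y\<close> matches the Baxter identity of \<open>R\<close> term by term.

  Finally \<open>A\<close> embeds into the shuffle algebra: \<open>A\<close> with the zero operator is a Baxter algebra, and the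
  universal property applied to the identity of \<open>A\<close> gives a left inverse of the embedding.
\<close>

section \<open>Linear maps, generated submodules, free modules\<close>

lemma linear_mapsI:
  assumes "\<And>x. x \<in> carrier M \<Longrightarrow> f x \<in> carrier N"
    and "\<And>x y. \<lbrakk>x \<in> carrier M; y \<in> carrier M\<rbrakk> \<Longrightarrow> f (x \<oplus>\<^bsub>M\<^esub> y) = f x \<oplus>\<^bsub>N\<^esub> f y"
    and "\<And>c x. \<lbrakk>c \<in> carrier C; x \<in> carrier M\<rbrakk> \<Longrightarrow> f (c \<odot>\<^bsub>M\<^esub> x) = c \<odot>\<^bsub>N\<^esub> f x"
  shows "f \<in> linear_maps C M N"
  using assms by (auto simp: linear_maps_def hom_def)

lemma
  assumes "f \<in> linear_maps C M N"
  shows linear_closed: "x \<in> carrier M \<Longrightarrow> f x \<in> carrier N"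
    and linear_add: "\<lbrakk>x \<in> carrier M; y \<in> carrier M\<rbrakk> \<Longrightarrow> f (x \<oplus>\<^bsub>M\<^esub> y) = f x \<oplus>\<^bsub>N\<^esub> f y"
    and linear_smult: "\<lbrakk>c \<in> carrier C; x \<in> carrier M\<rbrakk> \<Longrightarrow> f (c \<odot>\<^bsub>M\<^esub> x) = c \<odot>\<^bsub>N\<^esub> f x"
  using assms by (auto simp: linear_maps_def hom_def)

lemma linear_zero:
  assumes "module C M" "module C N" and f: "f \<in> linear_maps C M N"
  shows "f \<zero>\<^bsub>M\<^esub> = \<zero>\<^bsub>N\<^esub>"
proof -
  interpret M: module C M by fact
  interpret N: module C N by fact
  have "f \<zero>\<^bsub>M\<^esub> = f (\<zero>\<^bsub>C\<^esub> \<odot>\<^bsub>M\<^esub> \<zero>\<^bsub>M\<^esub>)" by simp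
  also have "\<dots> = \<zero>\<^bsub>C\<^esub> \<odot>\<^bsub>N\<^esub> f \<zero>\<^bsub>M\<^esub>" by (rule linear_smult[OF f]) simp_all
  also have "\<dots> = \<zero>\<^bsub>N\<^esub>" using linear_closed[OF f] by simp
  finally show ?thesis .
qed

lemma linear_minus:
  assumes "module C M" "module C N" and f: "f \<in> linear_maps C M N"
    and x: "x \<in> carrier M" "y \<in> carrier M"
  shows "f (x \<ominus>\<^bsub>M\<^esub> y) = f x \<ominus>\<^bsub>N\<^esub> f y"
proof -
  interpret M: module C M by fact
  interpret N: module C N by fact
  have [simp]: "f y \<in> carrier N" by (rule linear_closed[OF f]) fact
  have "f (\<ominus>\<^bsub>M\<^esub> y) = f ((\<ominus>\<^bsub>C\<^esub> \<one>\<^bsub>C\<^esub>) \<odot>\<^bsub>M\<^esub> y)" using x by (simp add: M.smult_l_minus)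
  also have "\<dots> = \<ominus>\<^bsub>N\<^esub> f y"
    using x by (subst linear_smult[OF f]) (simp_all add: N.smult_l_minus)
  finally show ?thesis using x by (simp add: a_minus_def linear_add[OF f])
qed

lemma linear_compose:
  assumes "f \<in> linear_maps C M N" "g \<in> linear_maps C N K"
  shows "g \<circ> f \<in> linear_maps C M K"
  by (rule linear_mapsI)
    (simp_all add: linear_closed[OF assms(1)] linear_closed[OF assms(2)] linear_add[OF assms(1)]
       linear_add[OF assms(2)] linear_smult[OF assms(1)] linear_smult[OF assms(2)])

lemma (in module) submodule_lincombI:
  assumes sub: "H \<subseteq> carrier M" and z: "\<zero>\<^bsub>M\<^esub> \<in> H"
    and lc: "\<And>c x y. \<lbrakk>c \<in> carrier R; x \<in> H; y \<in> H\<rbrakk> \<Longrightarrow> c \<odot>\<^bsub>M\<^esub> x \<oplus>\<^bsub>M\<^esub> y \<in> H"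
  shows "submodule H R M"
proof -
  have sm: "c \<odot>\<^bsub>M\<^esub> x \<in> H" if "c \<in> carrier R" "x \<in> H" for c x
    using lc[OF that z] that sub by (simp add: subset_iff)
  show ?thesis
  proof (rule submoduleI)
    show "\<ominus>\<^bsub>M\<^esub> a \<in> H" if "a \<in> H" for a
      using sm[of "\<ominus> \<one>" a] that sub smult_l_minus[of \<one> a] by auto
    show "a \<oplus>\<^bsub>M\<^esub> b \<in> H" if "a \<in> H" "b \<in> H" for a b
      using lc[of \<one> a b] that sub by auto
  qed (use sub z sm in auto)
qed

lemma (in module) submodule_gen_submodule:
  assumes "S \<subseteq> carrier M"
  shows "submodule (submodule_gen R M S) R M"
proof (rule submodule_lincombI)
  show "submodule_gen R M S \<subseteq> carrier M"
    unfolding submodule_gen_def using assms carrier_is_submodule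
    by (rule hull_minimal[where S = "\<lambda>H. submodule H R M"])
  show "\<zero>\<^bsub>M\<^esub> \<in> submodule_gen R M S"
    unfolding submodule_gen_def hull_def
    by (auto dest!: submodule.axioms(1) dest: subgroup.one_closed)
  show "c \<odot>\<^bsub>M\<^esub> x \<oplus>\<^bsub>M\<^esub> y \<in> submodule_gen R M S"
    if "c \<in> carrier R" "x \<in> submodule_gen R M S" "y \<in> submodule_gen R M S" for c x y
    using that unfolding submodule_gen_def hull_def
    by (auto intro!: submoduleE(4,5))
qed

lemma submodule_gen_incl: "x \<in> S \<Longrightarrow> x \<in> submodule_gen C M S"
  unfolding submodule_gen_def by (rule hull_inc)

text \<open>The two closure properties of a submodule are combined into one step \<open>c x + y\<close>, so that a proof that
  two linear expressions agree on a generated submodule has a single inductive case.\<close>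
lemma (in module) submodule_gen_induct [consumes 2, case_names gen zero lincomb]:
  assumes x: "x \<in> submodule_gen R M S" and S: "S \<subseteq> carrier M"
    and gen: "\<And>x. x \<in> S \<Longrightarrow> Q x" and zero: "Q \<zero>\<^bsub>M\<^esub>"
    and lincomb: "\<And>c x y. \<lbrakk>c \<in> carrier R; x \<in> carrier M; y \<in> carrier M;
       x \<in> submodule_gen R M S; y \<in> submodule_gen R M S; Q x; Q y\<rbrakk> \<Longrightarrow> Q (c \<odot>\<^bsub>M\<^esub> x \<oplus>\<^bsub>M\<^esub> y)"
  shows "Q x"
proof -
  let ?G = "submodule_gen R M S"
  have G: "submodule ?G R M" by (rule submodule_gen_submodule[OF S])
  have "submodule {x \<in> ?G. Q x} R M"
  proof (rule submodule_lincombI)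
    show "{x \<in> ?G. Q x} \<subseteq> carrier M" using submoduleE(1)[OF G] by auto
    show "\<zero>\<^bsub>M\<^esub> \<in> {x \<in> ?G. Q x}"
      using zero subgroup.one_closed[OF submodule.axioms(1)[OF G]] by simp
    show "c \<odot>\<^bsub>M\<^esub> x \<oplus>\<^bsub>M\<^esub> y \<in> {x \<in> ?G. Q x}"
      if "c \<in> carrier R" "x \<in> {x \<in> ?G. Q x}" "y \<in> {x \<in> ?G. Q x}" for c x y
      using that submoduleE(1)[OF G] by (auto intro!: submoduleE(4,5)[OF G] lincomb)
  qed
  moreover have "S \<subseteq> {x \<in> ?G. Q x}" using gen submodule_gen_incl by fastforce
  ultimately have "?G \<subseteq> {x \<in> ?G. Q x}" unfolding submodule_gen_def by (intro hull_minimal)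
  with x show ?thesis by blast
qed

text \<open>The linear extension to the free module of a function \<open>g\<close> on its basis.\<close>
definition lin_ext ::
    "('c, 'm) ring_scheme \<Rightarrow> ('c, 'a, 'n) module_scheme \<Rightarrow> ('x \<Rightarrow> 'a) \<Rightarrow> ('x \<Rightarrow> 'c) \<Rightarrow> 'a" where
  "lin_ext C M g f = (\<Oplus>\<^bsub>M\<^esub>w\<in>supp C f. f w \<odot>\<^bsub>M\<^esub> g w)"

lemma free_module_simps [simp]:
  "zero (free_module C X) = (\<lambda>x. \<zero>\<^bsub>C\<^esub>)"
  "add (free_module C X) = (\<lambda>f g x. f x \<oplus>\<^bsub>C\<^esub> g x)"
  "smult (free_module C X) = (\<lambda>c f x. c \<otimes>\<^bsub>C\<^esub> f x)"
  by (simp_all add: free_module_def)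

lemma free_module_carrier:
  "f \<in> carrier (free_module C X) \<longleftrightarrow> (\<forall>x. f x \<in> carrier C) \<and> finite (supp C f) \<and> supp C f \<subseteq> X"
  by (simp add: free_module_def supp_def)

lemma (in cring) free_module_module: "module R (free_module R X)"
proof (rule moduleI)
  let ?F = "free_module R X"
  have add: "f \<oplus>\<^bsub>?F\<^esub> g \<in> carrier ?F" if "f \<in> carrier ?F" "g \<in> carrier ?F" for f g
  proof -
    have "supp R (f \<oplus>\<^bsub>?F\<^esub> g) \<subseteq> supp R f \<union> supp R g" by (auto simp: supp_def)
    then show ?thesis using that
      by (auto simp: free_module_carrier intro: finite_subset)
  qed
  have sm: "c \<odot>\<^bsub>?F\<^esub> f \<in> carrier ?F" if "c \<in> carrier R" "f \<in> carrier ?F" for c f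
  proof -
    have "supp R (c \<odot>\<^bsub>?F\<^esub> f) \<subseteq> supp R f" using that by (auto simp: supp_def)
    then show ?thesis using that
      by (auto simp: free_module_carrier intro: finite_subset)
  qed
  show "abelian_group ?F"
  proof (rule abelian_groupI)
    fix f assume f: "f \<in> carrier ?F"
    show "\<exists>g\<in>carrier ?F. g \<oplus>\<^bsub>?F\<^esub> f = \<zero>\<^bsub>?F\<^esub>"
      using f sm[of "\<ominus> \<one>" f]
      by (intro bexI[of _ "(\<ominus> \<one>) \<odot>\<^bsub>?F\<^esub> f"]) (auto simp: free_module_carrier l_minus l_neg fun_eq_iff)
  qed (use add in \<open>auto simp: free_module_carrier supp_def a_ac fun_eq_iff\<close>)
  show "cring R" by (rule is_cring)
  fix c f assume "c \<in> carrier R" "f \<in> carrier ?F"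
  then show "c \<odot>\<^bsub>?F\<^esub> f \<in> carrier ?F" by (rule sm)
qed (auto simp: free_module_carrier l_distr r_distr m_assoc)

lemma (in cring) basis_vec_closed: "w \<in> X \<Longrightarrow> basis_vec R w \<in> carrier (free_module R X)"
  by (auto simp: free_module_carrier basis_vec_def supp_def)

lemma (in cring) free_module_span:
  assumes "f \<in> carrier (free_module R X)"
  shows "f \<in> submodule_gen R (free_module R X) (basis_vec R ` X)"
proof -
  let ?F = "free_module R X"
  let ?G = "submodule_gen R ?F (basis_vec R ` X)"
  interpret F: module R ?F by (rule free_module_module)
  have sub: "basis_vec R ` X \<subseteq> carrier ?F" by (auto intro: basis_vec_closed)
  note G = F.submodule_gen_submodule[OF sub]
  have "f \<in> carrier ?F \<Longrightarrow> supp R f \<subseteq> S \<Longrightarrow> f \<in> ?G" if "finite S" for S f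
    using that
  proof (induction S arbitrary: f)
    case empty
    then have "f = \<zero>\<^bsub>?F\<^esub>" by (auto simp: supp_def fun_eq_iff)
    then show ?case using subgroup.one_closed[OF submodule.axioms(1)[OF G]] by simp
  next
    case (insert w S)
    show ?case
    proof (cases "f w = \<zero>")
      case True
      then have "supp R f \<subseteq> S" using insert by (auto simp: supp_def)
      then show ?thesis using insert by blast
    next
      case False
      define g where "g = f(w := \<zero>)"
      have fw: "f w \<in> carrier R" "w \<in> X"
        using insert.prems(1) False by (auto simp: free_module_carrier supp_def)
      have "supp R g \<subseteq> supp R f" by (auto simp: g_def supp_def)
      then have g: "g \<in> carrier ?F" using insert.prems(1)
        by (auto simp: free_module_carrier g_def intro: finite_subset)
      moreover have "supp R g \<subseteq> S" using insert.prems by (auto simp: g_def supp_def)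
      ultimately have "g \<in> ?G" by (rule insert.IH)
      moreover have "basis_vec R w \<in> ?G" using fw by (intro submodule_gen_incl) auto
      moreover have "f = f w \<odot>\<^bsub>?F\<^esub> basis_vec R w \<oplus>\<^bsub>?F\<^esub> g"
        using insert.prems(1) by (auto simp: g_def basis_vec_def fun_eq_iff free_module_carrier)
      ultimately show ?thesis using F.submoduleE(4,5)[OF G] fw by metis
    qed
  qed
  then show ?thesis using assms by (auto simp: free_module_carrier)
qed

lemma (in cring) free_module_induct [consumes 1, case_names basis zero lincomb]:
  assumes f: "f \<in> carrier (free_module R X)"
    and "\<And>w. w \<in> X \<Longrightarrow> Q (basis_vec R w)" and "Q \<zero>\<^bsub>free_module R X\<^esub>"
    and "\<And>c f g. \<lbrakk>c \<in> carrier R; f \<in> carrier (free_module R X); g \<in> carrier (free_module R X);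
       Q f; Q g\<rbrakk> \<Longrightarrow> Q (c \<odot>\<^bsub>free_module R X\<^esub> f \<oplus>\<^bsub>free_module R X\<^esub> g)"
  shows "Q f"
proof -
  interpret F: module R "free_module R X" by (rule free_module_module)
  have sub: "basis_vec R ` X \<subseteq> carrier (free_module R X)" by (auto intro: basis_vec_closed)
  show ?thesis using free_module_span[OF f] sub
    by (induct rule: F.submodule_gen_induct) (use assms in auto)
qed

text \<open>Sums of vectors have smaller supports than expected when coefficients cancel; linearity of
  \<open>lin_ext\<close> is therefore checked over a common finite set that contains all supports involved.\<close>
lemma (in module) lin_ext_superset:
  assumes f: "f \<in> carrier (free_module R X)" and g: "g \<in> X \<rightarrow> carrier M"
    and S: "finite S" "supp R f \<subseteq> S" "S \<subseteq> X"
  shows "lin_ext R M g f = (\<Oplus>\<^bsub>M\<^esub>w\<in>S. f w \<odot>\<^bsub>M\<^esub> g w)"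
  unfolding lin_ext_def
proof (rule M.add.finprod_mono_neutral_cong_left)
  have gc: "w \<in> X \<Longrightarrow> g w \<in> carrier M" for w using g by auto
  have fc: "f w \<in> carrier R" for w using f by (simp add: free_module_carrier)
  show "f w \<odot>\<^bsub>M\<^esub> g w = \<zero>\<^bsub>M\<^esub>" if "w \<in> S - supp R f" for w
    using that S gc by (auto simp: supp_def)
  show "(\<lambda>w. f w \<odot>\<^bsub>M\<^esub> g w) \<in> S \<rightarrow> carrier M" using S(3) gc fc by auto
qed (use S in auto)

lemma (in module) lin_ext_linear:
  assumes g: "g \<in> X \<rightarrow> carrier M"
  shows "lin_ext R M g \<in> linear_maps R (free_module R X) M"
proof -
  let ?F = "free_module R X"
  interpret F: module R ?F by (rule R.free_module_module)
  have gc: "w \<in> X \<Longrightarrow> g w \<in> carrier M" for w using g by auto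
  show ?thesis
  proof (rule linear_mapsI)
    fix f assume f: "f \<in> carrier ?F"
    show "lin_ext R M g f \<in> carrier M" unfolding lin_ext_def
      using f by (intro M.finsum_closed) (auto simp: free_module_carrier gc subset_iff)
    fix c assume c: "c \<in> carrier R"
    have cf: "c \<odot>\<^bsub>?F\<^esub> f \<in> carrier ?F" using c f by (rule F.smult_closed)
    have "supp R (c \<odot>\<^bsub>?F\<^esub> f) \<subseteq> supp R f" using c by (auto simp: supp_def)
    then have "lin_ext R M g (c \<odot>\<^bsub>?F\<^esub> f) = (\<Oplus>\<^bsub>M\<^esub>w\<in>supp R f. (c \<odot>\<^bsub>?F\<^esub> f) w \<odot>\<^bsub>M\<^esub> g w)"
      using f by (intro lin_ext_superset[OF cf g]) (auto simp: free_module_carrier)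
    also have "\<dots> = (\<Oplus>\<^bsub>M\<^esub>w\<in>supp R f. c \<odot>\<^bsub>M\<^esub> (f w \<odot>\<^bsub>M\<^esub> g w))"
      using f c by (intro M.finsum_cong') (auto simp: free_module_carrier smult_assoc1 gc subset_iff)
    also have "\<dots> = c \<odot>\<^bsub>M\<^esub> lin_ext R M g f" unfolding lin_ext_def
      using f c by (intro finsum_smult_ldistr[symmetric]) (auto simp: free_module_carrier gc subset_iff)
    finally show "lin_ext R M g (c \<odot>\<^bsub>?F\<^esub> f) = c \<odot>\<^bsub>M\<^esub> lin_ext R M g f" .
  next
    fix f h assume f: "f \<in> carrier ?F" and h: "h \<in> carrier ?F"
    let ?S = "supp R f \<union> supp R h"
    have S: "finite ?S" "?S \<subseteq> X" using f h by (auto simp: free_module_carrier)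
    have fh: "f \<oplus>\<^bsub>?F\<^esub> h \<in> carrier ?F" using f h by (rule F.M.a_closed)
    have "supp R (f \<oplus>\<^bsub>?F\<^esub> h) \<subseteq> ?S" by (auto simp: supp_def)
    then have "lin_ext R M g (f \<oplus>\<^bsub>?F\<^esub> h) = (\<Oplus>\<^bsub>M\<^esub>w\<in>?S. (f \<oplus>\<^bsub>?F\<^esub> h) w \<odot>\<^bsub>M\<^esub> g w)"
      using S by (intro lin_ext_superset[OF fh g]) auto
    also have "\<dots> = (\<Oplus>\<^bsub>M\<^esub>w\<in>?S. f w \<odot>\<^bsub>M\<^esub> g w \<oplus>\<^bsub>M\<^esub> h w \<odot>\<^bsub>M\<^esub> g w)"
      using f h S(2) by (intro M.finsum_cong') (auto simp: free_module_carrier smult_l_distr gc subset_iff)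
    also have "\<dots> = (\<Oplus>\<^bsub>M\<^esub>w\<in>?S. f w \<odot>\<^bsub>M\<^esub> g w) \<oplus>\<^bsub>M\<^esub> (\<Oplus>\<^bsub>M\<^esub>w\<in>?S. h w \<odot>\<^bsub>M\<^esub> g w)"
      using f h S(2) by (intro M.finsum_addf) (auto simp: free_module_carrier gc subset_iff)
    also have "\<dots> = lin_ext R M g f \<oplus>\<^bsub>M\<^esub> lin_ext R M g h"
      using f h g S by (simp add: lin_ext_superset[of _ X _ ?S])
    finally show "lin_ext R M g (f \<oplus>\<^bsub>?F\<^esub> h) = lin_ext R M g f \<oplus>\<^bsub>M\<^esub> lin_ext R M g h" .
  qed
qed

lemma (in module) lin_ext_basis:
  assumes g: "g w \<in> carrier M"
  shows "lin_ext R M g (basis_vec R w) = g w"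
proof -
  have "lin_ext R M g (basis_vec R w) = (\<Oplus>\<^bsub>M\<^esub>v\<in>{w}. basis_vec R w v \<odot>\<^bsub>M\<^esub> g v)"
    by (rule lin_ext_superset[of _ "{w}"])
      (use g R.basis_vec_closed[of w "{w}"] in \<open>auto simp: supp_def basis_vec_def\<close>)
  also have "\<dots> = g w" using g by (simp add: basis_vec_def)
  finally show ?thesis .
qed

declare free_module_simps [simp del]

lemma (in module) smult_lcomm:
  assumes "a \<in> carrier R" "b \<in> carrier R" "x \<in> carrier M"
  shows "a \<odot>\<^bsub>M\<^esub> (b \<odot>\<^bsub>M\<^esub> x) = b \<odot>\<^bsub>M\<^esub> (a \<odot>\<^bsub>M\<^esub> x)"
  using assms by (simp flip: smult_assoc1 add: R.m_comm)

lemma linear_cong: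
  assumes "module C M" "f \<in> linear_maps C M N" "\<And>x. x \<in> carrier M \<Longrightarrow> g x = f x"
  shows "g \<in> linear_maps C M N"
proof -
  interpret M: module C M by fact
  show ?thesis
    by (rule linear_mapsI)
      (simp_all add: assms(3) linear_closed[OF assms(2)] linear_add[OF assms(2)] linear_smult[OF assms(2)])
qed

lemma linear_lincomb:
  assumes "module C M" "module C N" "f \<in> linear_maps C M N" "g \<in> linear_maps C M N" "c \<in> carrier C"
  shows "(\<lambda>x. c \<odot>\<^bsub>N\<^esub> f x \<oplus>\<^bsub>N\<^esub> g x) \<in> linear_maps C M N"
proof -
  interpret M: module C M by fact
  interpret N: module C N by fact
  note f = linear_closed[OF assms(3)] linear_add[OF assms(3)] linear_smult[OF assms(3)]
  note g = linear_closed[OF assms(4)] linear_add[OF assms(4)] linear_smult[OF assms(4)]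
  show ?thesis
    by (rule linear_mapsI)
      (use assms(5) in \<open>simp_all add: f g N.smult_r_distr N.smult_lcomm[of c] N.M.a_ac\<close>)
qed

lemma linear_sum:
  assumes "module C M" "module C N" "f \<in> linear_maps C M N" "g \<in> linear_maps C M N"
  shows "(\<lambda>x. f x \<oplus>\<^bsub>N\<^esub> g x) \<in> linear_maps C M N"
proof -
  interpret N: module C N by fact
  show ?thesis
    by (rule linear_cong[OF assms(1) linear_lincomb[OF assms N.R.one_closed]])
      (simp add: linear_closed[OF assms(3)])
qed

lemma linear_scaled:
  assumes "module C M" "module C N" "f \<in> linear_maps C M N" "c \<in> carrier C"
  shows "(\<lambda>x. c \<odot>\<^bsub>N\<^esub> f x) \<in> linear_maps C M N"
proof -
  interpret N: module C N by fact
  note f = linear_closed[OF assms(3)] linear_add[OF assms(3)] linear_smult[OF assms(3)]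
  show ?thesis
    by (rule linear_mapsI) (use assms(4) in \<open>simp_all add: f N.smult_r_distr N.smult_lcomm[of c]\<close>)
qed

lemma (in module) linear_eq_on_basis:
  assumes h: "h \<in> linear_maps R (free_module R X) M" and k: "k \<in> linear_maps R (free_module R X) M"
    and eq: "\<And>w. w \<in> X \<Longrightarrow> h (basis_vec R w) = k (basis_vec R w)"
    and f: "f \<in> carrier (free_module R X)"
  shows "h f = k f"
proof -
  interpret F: module R "free_module R X" by (rule R.free_module_module)
  show ?thesis using f
  proof (induction rule: R.free_module_induct)
    case zero
    show ?case
      unfolding linear_zero[OF F.module_axioms module_axioms h]
        linear_zero[OF F.module_axioms module_axioms k] ..
  next
    case (lincomb c f g)
    then show ?case
      by (simp add: linear_add[OF h] linear_add[OF k] linear_smult[OF h] linear_smult[OF k])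
  qed (rule eq)
qed

section \<open>The recursive form of the mixable shuffle product\<close>

text \<open>The value at the mixable shuffle product \<open>x * y\<close> of the linear extension of \<open>g\<close>, with values in the
  module \<open>N\<close>.  Passing to a first letter of the product means precomposing \<open>g\<close> with that letter.\<close>
fun mixsum ::
    "'c \<Rightarrow> ('b, 'k) monoid_scheme \<Rightarrow> ('c, 'a, 'n) module_scheme
      \<Rightarrow> ('b list \<Rightarrow> 'a) \<Rightarrow> 'b list \<Rightarrow> 'b list \<Rightarrow> 'a" where
  "mixsum lam B N g [] y = g y"
| "mixsum lam B N g (a # x) [] = g (a # x)"
| "mixsum lam B N g (a # x) (b # y) =
     mixsum lam B N (\<lambda>w. g (a # w)) x (b # y) \<oplus>\<^bsub>N\<^esub> mixsum lam B N (\<lambda>w. g (b # w)) (a # x) y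
       \<oplus>\<^bsub>N\<^esub> lam \<odot>\<^bsub>N\<^esub> mixsum lam B N (\<lambda>w. g ((a \<otimes>\<^bsub>B\<^esub> b) # w)) x y"

lemma mixsum_Nil_right [simp]: "mixsum lam B N g x [] = g x"
  by (cases x) simp_all

lemma mixsum_Nil_left [simp]: "mixsum lam B N g [] = g"
  by (rule ext) simp

text \<open>The third summand of \<open>mixsum\<close> shortens both words at once, so the induction hypothesis must also cover
  the pair of tails.\<close>
lemma list_pair_induct_raw:
  assumes "\<And>y. Q [] y" "\<And>a x. Q (a # x) []"
    and "\<And>a x b y. \<lbrakk>Q x (b # y); Q (a # x) y; Q x y\<rbrakk> \<Longrightarrow> Q (a # x) (b # y)"
  shows "Q x y"
  using assms
proof (induction "length x + length y" arbitrary: x y rule: less_induct)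
  case less
  show ?case
  proof (cases x)
    case x: (Cons a x')
    show ?thesis
    proof (cases y)
      case (Cons b y')
      with x less show ?thesis by simp
    qed (use x less in simp)
  qed (use less in simp)
qed

lemma list_pair_induct [consumes 2, case_names Nil1 Nil2 Cons]:
  assumes "x \<in> lists S" "y \<in> lists S"
    and "\<And>y. y \<in> lists S \<Longrightarrow> Q [] y" "\<And>x. x \<in> lists S \<Longrightarrow> Q x []"
    and "\<And>a x b y. \<lbrakk>a \<in> S; x \<in> lists S; b \<in> S; y \<in> lists S; Q x (b # y); Q (a # x) y; Q x y\<rbrakk>
      \<Longrightarrow> Q (a # x) (b # y)"
  shows "Q x y"
proof -
  have "x \<in> lists S \<longrightarrow> y \<in> lists S \<longrightarrow> Q x y"
    by (rule list_pair_induct_raw) (use assms in auto)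
  then show ?thesis using assms by blast
qed

lemma (in module) smult_add_rearrange:
  assumes "c \<in> carrier R" "d \<in> carrier R"
    and "x1 \<in> carrier M" "x2 \<in> carrier M" "y1 \<in> carrier M" "y2 \<in> carrier M"
      "z1 \<in> carrier M" "z2 \<in> carrier M"
  shows "(c \<odot>\<^bsub>M\<^esub> x1 \<oplus>\<^bsub>M\<^esub> x2) \<oplus>\<^bsub>M\<^esub> (c \<odot>\<^bsub>M\<^esub> y1 \<oplus>\<^bsub>M\<^esub> y2) \<oplus>\<^bsub>M\<^esub> d \<odot>\<^bsub>M\<^esub> (c \<odot>\<^bsub>M\<^esub> z1 \<oplus>\<^bsub>M\<^esub> z2)
    = c \<odot>\<^bsub>M\<^esub> (x1 \<oplus>\<^bsub>M\<^esub> y1 \<oplus>\<^bsub>M\<^esub> d \<odot>\<^bsub>M\<^esub> z1) \<oplus>\<^bsub>M\<^esub> (x2 \<oplus>\<^bsub>M\<^esub> y2 \<oplus>\<^bsub>M\<^esub> d \<odot>\<^bsub>M\<^esub> z2)"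
  using assms by (simp add: smult_r_distr smult_lcomm[of d c] M.a_ac)

locale weighted_algebra = comm_algebra0 C B for C (structure) and lam and B (structure) +
  assumes weight_closed: "lam \<in> carrier C"
begin

abbreviation "letters \<equiv> lists (carrier B)"
abbreviation mult_B (infixl "\<cdot>" 70) where "a \<cdot> b \<equiv> a \<otimes>\<^bsub>B\<^esub> b"

lemma Cons_fun: "g \<in> letters \<rightarrow> X \<Longrightarrow> a \<in> carrier B \<Longrightarrow> (\<lambda>w. g (a # w)) \<in> letters \<rightarrow> X"
  by (simp add: Pi_def)

context
  fixes N :: "('a, 'x, 'y) module_scheme"
  assumes N: "module C N"
begin

interpretation N: module C N by (rule N)

lemma mixsum_closed:
  assumes "x \<in> letters" "y \<in> letters" and "g \<in> letters \<rightarrow> carrier N"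
  shows "mixsum lam B N g x y \<in> carrier N"
  using assms
proof (induction x y arbitrary: g rule: list_pair_induct)
  case (Cons a x b y)
  then show ?case using weight_closed mult_closed by (simp add: Cons_fun[OF Cons.prems])
qed (auto)

lemma mixsum_cong:
  assumes "x \<in> letters" "y \<in> letters" and "\<And>w. w \<in> letters \<Longrightarrow> g w = h w"
  shows "mixsum lam B N g x y = mixsum lam B N h x y"
  using assms
proof (induction x y arbitrary: g h rule: list_pair_induct)
  case (Cons a x b y)
  have eq: "g (e # w) = h (e # w)" if "e \<in> carrier B" "w \<in> letters" for e w
    by (rule Cons.prems) (use that in simp)
  have [simp]: "a \<cdot> b \<in> carrier B" using Cons.hyps by (simp add: mult_closed)
  show ?case unfolding mixsum.simps
    by (intro arg_cong2[of _ _ _ _ "add N"] arg_cong[of _ _ "smult N lam"] Cons.IH eq)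
      (use Cons.hyps in simp_all)
qed auto

lemma mixsum_lincomb:
  assumes "x \<in> letters" "y \<in> letters" and c: "c \<in> carrier C"
    and "g \<in> letters \<rightarrow> carrier N" "h \<in> letters \<rightarrow> carrier N"
  shows "mixsum lam B N (\<lambda>w. c \<odot>\<^bsub>N\<^esub> g w \<oplus>\<^bsub>N\<^esub> h w) x y
    = c \<odot>\<^bsub>N\<^esub> mixsum lam B N g x y \<oplus>\<^bsub>N\<^esub> mixsum lam B N h x y"
  using assms(1,2,4,5)
proof (induction x y arbitrary: g h rule: list_pair_induct)
  case (Cons a x b y)
  have [simp]: "a \<cdot> b \<in> carrier B" using Cons by (simp add: mult_closed)
  have closedg: "mixsum lam B N (\<lambda>w. g (e # w)) u v \<in> carrier N"
    if "e \<in> carrier B" "u \<in> letters" "v \<in> letters" for e u v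
    using that Cons_fun[OF Cons.prems(1)] by (intro mixsum_closed) auto
  have closedh: "mixsum lam B N (\<lambda>w. h (e # w)) u v \<in> carrier N"
    if "e \<in> carrier B" "u \<in> letters" "v \<in> letters" for e u v
    using that Cons_fun[OF Cons.prems(2)] by (intro mixsum_closed) auto
  show ?case using Cons c weight_closed
    by (simp add: Cons_fun[OF Cons.prems(1)] Cons_fun[OF Cons.prems(2)] closedg closedh N.smult_add_rearrange)
qed auto

lemma mixsum_add:
  assumes "x \<in> letters" "y \<in> letters"
    and "g \<in> letters \<rightarrow> carrier N" "h \<in> letters \<rightarrow> carrier N"
  shows "mixsum lam B N (\<lambda>w. g w \<oplus>\<^bsub>N\<^esub> h w) x y
    = mixsum lam B N g x y \<oplus>\<^bsub>N\<^esub> mixsum lam B N h x y"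
proof -
  have "mixsum lam B N (\<lambda>w. g w \<oplus>\<^bsub>N\<^esub> h w) x y
      = mixsum lam B N (\<lambda>w. \<one>\<^bsub>C\<^esub> \<odot>\<^bsub>N\<^esub> g w \<oplus>\<^bsub>N\<^esub> h w) x y"
    by (rule mixsum_cong) (use assms funcset_mem[OF assms(3)] in simp_all)
  also have "\<dots> = mixsum lam B N g x y \<oplus>\<^bsub>N\<^esub> mixsum lam B N h x y"
    using assms by (subst mixsum_lincomb) (simp_all add: mixsum_closed)
  finally show ?thesis .
qed

lemma mixsum_linear:
  assumes K: "module C K" and h: "h \<in> linear_maps C N K"
    and "x \<in> letters" "y \<in> letters" and "g \<in> letters \<rightarrow> carrier N"
  shows "h (mixsum lam B N g x y) = mixsum lam B K (\<lambda>w. h (g w)) x y"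
  using assms(3-5)
proof (induction x y arbitrary: g rule: list_pair_induct)
  case (Cons a x b y)
  have [simp]: "a \<cdot> b \<in> carrier B" using Cons by (simp add: mult_closed)
  have closedg: "mixsum lam B N (\<lambda>w. g (e # w)) u v \<in> carrier N"
    if "e \<in> carrier B" "u \<in> letters" "v \<in> letters" for e u v
    using that Cons_fun[OF Cons.prems] by (intro mixsum_closed) auto
  show ?case using Cons weight_closed
    by (simp add: Cons_fun[OF Cons.prems] closedg linear_add[OF h] linear_smult[OF h])
qed auto

lemma mixsum_smult:
  assumes "x \<in> letters" "y \<in> letters" "c \<in> carrier C" and "g \<in> letters \<rightarrow> carrier N"
  shows "mixsum lam B N (\<lambda>w. c \<odot>\<^bsub>N\<^esub> g w) x y = c \<odot>\<^bsub>N\<^esub> mixsum lam B N g x y"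
proof -
  have "(\<lambda>x. c \<odot>\<^bsub>N\<^esub> x) \<in> linear_maps C N N"
    by (rule linear_mapsI) (use assms(3) in \<open>simp_all add: N.smult_r_distr N.smult_lcomm[of c]\<close>)
  from mixsum_linear[OF N this assms(1,2,4)] show ?thesis by simp
qed

lemma mixsum_add3:
  assumes "x \<in> letters" "y \<in> letters"
    and "g \<in> letters \<rightarrow> carrier N" "h \<in> letters \<rightarrow> carrier N" "k \<in> letters \<rightarrow> carrier N"
  shows "mixsum lam B N (\<lambda>w. g w \<oplus>\<^bsub>N\<^esub> h w \<oplus>\<^bsub>N\<^esub> lam \<odot>\<^bsub>N\<^esub> k w) x y
    = mixsum lam B N g x y \<oplus>\<^bsub>N\<^esub> mixsum lam B N h x y \<oplus>\<^bsub>N\<^esub> lam \<odot>\<^bsub>N\<^esub> mixsum lam B N k x y"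
proof -
  have "(\<lambda>w. lam \<odot>\<^bsub>N\<^esub> k w) \<in> letters \<rightarrow> carrier N" "(\<lambda>w. g w \<oplus>\<^bsub>N\<^esub> h w) \<in> letters \<rightarrow> carrier N"
    using assms weight_closed by (auto simp: Pi_iff)
  then show ?thesis using assms weight_closed
    by (simp only: mixsum_add mixsum_smult)
qed

lemma mixsum_commute:
  assumes "x \<in> letters" "y \<in> letters" "g \<in> letters \<rightarrow> carrier N"
  shows "mixsum lam B N g x y = mixsum lam B N g y x"
  using assms
proof (induction x y arbitrary: g rule: list_pair_induct)
  case (Cons a x b y)
  have [simp]: "a \<cdot> b \<in> carrier B" using Cons by (simp add: mult_closed)
  have closedg: "mixsum lam B N (\<lambda>w. g (e # w)) u v \<in> carrier N"
    if "e \<in> carrier B" "u \<in> letters" "v \<in> letters" for e u v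
    using that Cons_fun[OF Cons.prems] by (intro mixsum_closed) auto
  show ?case using Cons weight_closed
    by (simp add: Cons_fun[OF Cons.prems] closedg mult_comm[of b a] N.M.a_comm)
qed auto

text \<open>Expanding \<open>(a x * b y) * c z\<close> twice by the recursion gives seven summands, one for each nonempty
  subset of \<open>{a, b, c}\<close>, namely the letters merged into the first letter of the result.  The
  expansion of \<open>a x * (b y * c z)\<close> gives the same seven with the inner products bracketed the other way,
  and the induction hypothesis applies to each of them.\<close>
lemma mixsum_assoc:
  assumes "x \<in> letters" "y \<in> letters" "z \<in> letters" "g \<in> letters \<rightarrow> carrier N"
  shows "mixsum lam B N (\<lambda>w. mixsum lam B N g w z) x y
    = mixsum lam B N (\<lambda>w. mixsum lam B N g x w) y z"
  using assms
proof (induction "length x + length y + length z" arbitrary: x y z g rule: less_induct)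
  case less
  note IH = less.hyps
  show ?case
  proof (cases "x = [] \<or> y = [] \<or> z = []")
    case True
    then show ?thesis by (elim disjE) simp_all
  next
    case False
    then obtain a x' b y' c z' where xyz: "x = a # x'" "y = b # y'" "z = c # z'"
      by (auto simp: neq_Nil_conv)
    have mem [simp]: "a \<in> carrier B" "b \<in> carrier B" "c \<in> carrier B"
        "x' \<in> letters" "y' \<in> letters" "z' \<in> letters"
      using less.prems xyz by auto
    have mem2 [simp]: "a \<cdot> b \<in> carrier B" "a \<cdot> c \<in> carrier B" "b \<cdot> c \<in> carrier B"
        "(a \<cdot> b) \<cdot> c \<in> carrier B"
      by (simp_all add: mult_closed)
    have g [simp]: "(\<lambda>w. g (e # w)) \<in> letters \<rightarrow> carrier N" if "e \<in> carrier B" for e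
      using less.prems(4) that by (rule Cons_fun)
    let ?Q = "mixsum lam B N"
    have F [simp]: "(\<lambda>w. ?Q (\<lambda>s. g (e # s)) w t) \<in> letters \<rightarrow> carrier N"
        "(\<lambda>w. ?Q (\<lambda>s. g (e # s)) t w) \<in> letters \<rightarrow> carrier N"
        "(\<lambda>w. ?Q (\<lambda>s. g (e # s)) (d # w) t) \<in> letters \<rightarrow> carrier N"
        "(\<lambda>w. ?Q (\<lambda>s. g (e # s)) t (d # w)) \<in> letters \<rightarrow> carrier N"
      if "e \<in> carrier B" "d \<in> carrier B" "t \<in> letters" for e d t
      by (intro funcsetI mixsum_closed g; use that in simp)+
    \<comment> \<open>\<open>L e u v t\<close> is the part of the expansion in which the result starts with \<open>e\<close> and \<open>(u * v) * t\<close> follows.\<close>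
    define L where "L e u v t = ?Q (\<lambda>w. ?Q (\<lambda>s. g (e # s)) w t) u v" for e u v t
    have L_closed [simp]: "L e u v t \<in> carrier N"
      if "e \<in> carrier B" "u \<in> letters" "v \<in> letters" "t \<in> letters" for e u v t
      unfolding L_def using that by (intro mixsum_closed F) simp_all
    have L_assoc: "L e u v t = ?Q (\<lambda>w. ?Q (\<lambda>s. g (e # s)) u w) v t"
      if "e \<in> carrier B" "u \<in> letters" "v \<in> letters" "t \<in> letters"
        "length u + length v + length t < length x + length y + length z" for e u v t
      unfolding L_def using that by (intro IH) auto
    have left: "?Q (\<lambda>w. ?Q g (e # w) (c # z')) u v
        = L e u v (c # z') \<oplus>\<^bsub>N\<^esub> ?Q (\<lambda>w. ?Q (\<lambda>s. g (c # s)) (e # w) z') u v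
          \<oplus>\<^bsub>N\<^esub> lam \<odot>\<^bsub>N\<^esub> L (e \<cdot> c) u v z'"
      if "e \<in> carrier B" "u \<in> letters" "v \<in> letters" for e u v
      unfolding L_def mixsum.simps
      using that mult_closed[of e c]
      by (intro mixsum_add3 F) simp_all
    have right: "?Q (\<lambda>w. ?Q g (a # x') (e # w)) u v
        = ?Q (\<lambda>w. ?Q (\<lambda>s. g (a # s)) x' (e # w)) u v
          \<oplus>\<^bsub>N\<^esub> ?Q (\<lambda>w. ?Q (\<lambda>s. g (e # s)) (a # x') w) u v
          \<oplus>\<^bsub>N\<^esub> lam \<odot>\<^bsub>N\<^esub> ?Q (\<lambda>w. ?Q (\<lambda>s. g ((a \<cdot> e) # s)) x' w) u v"
      if "e \<in> carrier B" "u \<in> letters" "v \<in> letters" for e u v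
      unfolding mixsum.simps
      using that mult_closed[of a e]
      by (intro mixsum_add3 F) simp_all
    let ?Lc = "L c x y z'" let ?La = "L a x' y z" let ?Lb = "L b x y' z"
    let ?Lac = "L (a \<cdot> c) x' y z'" let ?Lbc = "L (b \<cdot> c) x y' z'"
    let ?Lab = "L (a \<cdot> b) x' y' z" let ?Labc = "L (a \<cdot> b \<cdot> c) x' y' z'"
    let ?sum = "?La \<oplus>\<^bsub>N\<^esub> ?Lb \<oplus>\<^bsub>N\<^esub> ?Lc \<oplus>\<^bsub>N\<^esub> lam \<odot>\<^bsub>N\<^esub> ?Lab \<oplus>\<^bsub>N\<^esub> lam \<odot>\<^bsub>N\<^esub> ?Lac \<oplus>\<^bsub>N\<^esub> lam \<odot>\<^bsub>N\<^esub> ?Lbc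
        \<oplus>\<^bsub>N\<^esub> lam \<odot>\<^bsub>N\<^esub> (lam \<odot>\<^bsub>N\<^esub> ?Labc)"
    have abc: "a \<cdot> b \<cdot> c = a \<cdot> (b \<cdot> c)"
      by (simp add: mult_assoc)
    have [simp]: "a \<cdot> (b \<cdot> c) \<in> carrier B"
      by (simp flip: abc)
    have L_assoc_inst: "?Lb = ?Q (\<lambda>w. ?Q (\<lambda>s. g (b # s)) x w) y' z"
        "?Lc = ?Q (\<lambda>w. ?Q (\<lambda>s. g (c # s)) x w) y z'"
        "?Lac = ?Q (\<lambda>w. ?Q (\<lambda>s. g ((a \<cdot> c) # s)) x' w) y z'"
        "?Lbc = ?Q (\<lambda>w. ?Q (\<lambda>s. g ((b \<cdot> c) # s)) x w) y' z'"
        "?Lab = ?Q (\<lambda>w. ?Q (\<lambda>s. g ((a \<cdot> b) # s)) x' w) y' z"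
        "?Labc = ?Q (\<lambda>w. ?Q (\<lambda>s. g ((a \<cdot> b \<cdot> c) # s)) x' w) y' z'"
      by (rule L_assoc; use less.prems in \<open>simp add: xyz\<close>)+
    have closed [simp]: "?Q (\<lambda>w. ?Q (\<lambda>s. g (e # s)) (d # w) t) u v \<in> carrier N"
        "?Q (\<lambda>w. ?Q (\<lambda>s. g (e # s)) t (d # w)) u v \<in> carrier N"
      if "e \<in> carrier B" "d \<in> carrier B" "t \<in> letters" "u \<in> letters" "v \<in> letters" for e d t u v
      using that by (intro mixsum_closed g; simp)+
    \<comment> \<open>The three summands in which only the third word gives the first letter recombine to one, as do those of the first word in the other bracketing.\<close>
    have Lc: "?Lc = ?Q (\<lambda>w. ?Q (\<lambda>s. g (c # s)) (a # w) z') x' y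
        \<oplus>\<^bsub>N\<^esub> ?Q (\<lambda>w. ?Q (\<lambda>s. g (c # s)) (b # w) z') x y'
        \<oplus>\<^bsub>N\<^esub> lam \<odot>\<^bsub>N\<^esub> ?Q (\<lambda>w. ?Q (\<lambda>s. g (c # s)) ((a \<cdot> b) # w) z') x' y'"
      by (simp add: L_def xyz)
    have La: "?La = ?Q (\<lambda>w. ?Q (\<lambda>s. g (a # s)) x' (b # w)) y' z
        \<oplus>\<^bsub>N\<^esub> ?Q (\<lambda>w. ?Q (\<lambda>s. g (a # s)) x' (c # w)) y z'
        \<oplus>\<^bsub>N\<^esub> lam \<odot>\<^bsub>N\<^esub> ?Q (\<lambda>w. ?Q (\<lambda>s. g (a # s)) x' ((b \<cdot> c) # w)) y' z'"
      by (subst L_assoc) (simp_all add: xyz)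
    have "?Q (\<lambda>w. ?Q g w z) x y = ?Q (\<lambda>w. ?Q g (a # w) (c # z')) x' y
        \<oplus>\<^bsub>N\<^esub> ?Q (\<lambda>w. ?Q g (b # w) (c # z')) x y'
        \<oplus>\<^bsub>N\<^esub> lam \<odot>\<^bsub>N\<^esub> ?Q (\<lambda>w. ?Q g ((a \<cdot> b) # w) (c # z')) x' y'"
      unfolding xyz by (rule mixsum.simps(3))
    also have "\<dots> = ?sum"
      unfolding Lc using weight_closed less.prems
      by (simp add: xyz(3) left N.smult_r_distr N.M.a_ac del: mixsum.simps)
    also have "\<dots> = ?Q (\<lambda>w. ?Q g (a # x') (b # w)) y' z
        \<oplus>\<^bsub>N\<^esub> ?Q (\<lambda>w. ?Q g (a # x') (c # w)) y z'
        \<oplus>\<^bsub>N\<^esub> lam \<odot>\<^bsub>N\<^esub> ?Q (\<lambda>w. ?Q g (a # x') ((b \<cdot> c) # w)) y' z'"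
      unfolding La using weight_closed less.prems
      by (simp add: xyz(1) right abc L_assoc_inst[symmetric, unfolded xyz(1) abc]
          N.smult_r_distr N.M.a_ac del: mixsum.simps)
    also have "\<dots> = ?Q (\<lambda>w. ?Q g x w) y z"
      unfolding xyz by (rule mixsum.simps(3)[symmetric])
    finally show ?thesis .
  qed
qed

end

end

text \<open>One law for linear combinations \<open>c a + b\<close> in a letter covers additivity and homogeneity.\<close>
definition multilinear ::
    "('c, 'm) ring_scheme \<Rightarrow> ('c, 'b, 'n) module_scheme \<Rightarrow> ('c, 'a, 'k) module_scheme
      \<Rightarrow> ('b list \<Rightarrow> 'a) \<Rightarrow> bool" where
  "multilinear C B N g \<longleftrightarrow>
    (\<forall>us\<in>lists (carrier B). \<forall>vs\<in>lists (carrier B). \<forall>a\<in>carrier B. \<forall>b\<in>carrier B. \<forall>c\<in>carrier C.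
      g (us @ (c \<odot>\<^bsub>B\<^esub> a \<oplus>\<^bsub>B\<^esub> b) # vs) = c \<odot>\<^bsub>N\<^esub> g (us @ a # vs) \<oplus>\<^bsub>N\<^esub> g (us @ b # vs))"

lemma multilinearD:
  assumes "multilinear C B N g" "us \<in> lists (carrier B)" "vs \<in> lists (carrier B)"
    "a \<in> carrier B" "b \<in> carrier B" "c \<in> carrier C"
  shows "g (us @ (c \<odot>\<^bsub>B\<^esub> a \<oplus>\<^bsub>B\<^esub> b) # vs) = c \<odot>\<^bsub>N\<^esub> g (us @ a # vs) \<oplus>\<^bsub>N\<^esub> g (us @ b # vs)"
  using assms by (auto simp: multilinear_def)

lemma multilinear_Cons:
  assumes "multilinear C B N g" "e \<in> carrier B"
  shows "multilinear C B N (\<lambda>w. g (e # w))"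
  unfolding multilinear_def
  using assms multilinearD[OF assms(1), of "e # _"] by simp

context weighted_algebra
begin

lemma mult_lincomb_left:
  assumes "c \<in> carrier C" "a \<in> carrier B" "b \<in> carrier B" "d \<in> carrier B"
  shows "(c \<odot>\<^bsub>B\<^esub> a \<oplus>\<^bsub>B\<^esub> b) \<cdot> d = c \<odot>\<^bsub>B\<^esub> (a \<cdot> d) \<oplus>\<^bsub>B\<^esub> b \<cdot> d"
  using assms by (simp add: mult_distr smult_mult)

lemma mult_lincomb_right:
  assumes "c \<in> carrier C" "a \<in> carrier B" "b \<in> carrier B" "d \<in> carrier B"
  shows "d \<cdot> (c \<odot>\<^bsub>B\<^esub> a \<oplus>\<^bsub>B\<^esub> b) = c \<odot>\<^bsub>B\<^esub> (d \<cdot> a) \<oplus>\<^bsub>B\<^esub> d \<cdot> b"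
  using assms by (simp add: mult_comm[of d] mult_lincomb_left)

text \<open>In each summand of the recursion the varying letter of \<open>x\<close> stays in the tail, becomes the first letter of the
  result, or is multiplied by the first letter of \<open>y\<close>; all three dependencies are linear.\<close>
lemma mixsum_multilinear:
  assumes N: "module C N" and y: "y \<in> letters"
    and g: "g \<in> letters \<rightarrow> carrier N" "multilinear C B N g"
  shows "multilinear C B N (\<lambda>x. mixsum lam B N g x y)"
proof -
  interpret N: module C N by fact
  let ?Q = "mixsum lam B N"
  have "?Q g (us @ (c \<odot>\<^bsub>B\<^esub> a \<oplus>\<^bsub>B\<^esub> b) # vs) y
      = c \<odot>\<^bsub>N\<^esub> ?Q g (us @ a # vs) y \<oplus>\<^bsub>N\<^esub> ?Q g (us @ b # vs) y"
    if us: "us \<in> letters" and vs: "vs \<in> letters" and ab: "a \<in> carrier B" "b \<in> carrier B"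
      and c: "c \<in> carrier C" for us vs a b c
    using us y g
  proof (induction us y arbitrary: g rule: list_pair_induct)
    case (Nil1 y)
    then show ?case
    proof (induction y arbitrary: g)
      case Nil
      then show ?case
        using multilinearD[OF Nil(2), of "[]" vs a b c] vs ab c by simp
    next
      case (Cons d y)
      have [simp]: "a \<cdot> d \<in> carrier B" "b \<cdot> d \<in> carrier B"
        using ab Cons.prems Cons.hyps by (auto simp: mult_closed)
      note gc = Cons_fun[OF Cons.prems(1)]
      have split: "?Q (\<lambda>w. g ((c \<odot>\<^bsub>B\<^esub> e \<oplus>\<^bsub>B\<^esub> f) # w)) u v
          = c \<odot>\<^bsub>N\<^esub> ?Q (\<lambda>w. g (e # w)) u v \<oplus>\<^bsub>N\<^esub> ?Q (\<lambda>w. g (f # w)) u v"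
        if "e \<in> carrier B" "f \<in> carrier B" "u \<in> letters" "v \<in> letters" for e f u v
      proof -
        have "?Q (\<lambda>w. g ((c \<odot>\<^bsub>B\<^esub> e \<oplus>\<^bsub>B\<^esub> f) # w)) u v
            = ?Q (\<lambda>w. c \<odot>\<^bsub>N\<^esub> g (e # w) \<oplus>\<^bsub>N\<^esub> g (f # w)) u v"
          using that c multilinearD[OF Cons.prems(2), of "[]" _ e f c]
          by (intro mixsum_cong[OF N]) simp_all
        then show ?thesis using that c gc by (simp only: mixsum_lincomb[OF N])
      qed
      have closed: "?Q (\<lambda>w. g (e # w)) u v \<in> carrier N"
        if "e \<in> carrier B" "u \<in> letters" "v \<in> letters" for e u v
        using that gc by (intro mixsum_closed[OF N]) auto
      have IH: "?Q (\<lambda>w. g (d # w)) ((c \<odot>\<^bsub>B\<^esub> a \<oplus>\<^bsub>B\<^esub> b) # vs) y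
         = c \<odot>\<^bsub>N\<^esub> ?Q (\<lambda>w. g (d # w)) (a # vs) y \<oplus>\<^bsub>N\<^esub> ?Q (\<lambda>w. g (d # w)) (b # vs) y"
        using Cons.IH[of "\<lambda>w. g (d # w)"] Cons.hyps gc multilinear_Cons[OF Cons.prems(2)] by simp
      show ?case using Cons.hyps ab c vs weight_closed
        by (simp add: IH mult_lincomb_left split closed N.smult_add_rearrange)
    qed
  next
    case (Nil2 us)
    then show ?case using multilinearD[OF Nil2(3), of us vs a b c] vs ab c by simp
  next
    case (Cons e us d y)
    have [simp]: "e \<cdot> d \<in> carrier B" using Cons.hyps by (auto simp: mult_closed)
    note gc = Cons_fun[OF Cons.prems(1)] and gm = multilinear_Cons[OF Cons.prems(2)]
    have closed: "?Q (\<lambda>w. g (e # w)) u v \<in> carrier N"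
      if "e \<in> carrier B" "u \<in> letters" "v \<in> letters" for e u v
      using that gc by (intro mixsum_closed[OF N]) auto
    show ?case using Cons.hyps ab c vs weight_closed Cons.IH(2)[of "\<lambda>w. g (d # w)"]
      by (simp add: Cons.IH(1,3) gc gm closed N.smult_add_rearrange)
  qed
  then show ?thesis by (simp add: multilinear_def)
qed

end

section \<open>The sum over mixable shuffles satisfies the recursion\<close>

lemma (in abelian_monoid) finsum_Sigma:
  assumes "finite A" "\<And>a. a \<in> A \<Longrightarrow> finite (X a)"
    and f: "\<And>a b. a \<in> A \<Longrightarrow> b \<in> X a \<Longrightarrow> f a b \<in> carrier G"
  shows "(\<Oplus>p\<in>Sigma A X. f (fst p) (snd p)) = (\<Oplus>a\<in>A. \<Oplus>b\<in>X a. f a b)"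
proof -
  have "Sigma A X = (\<Union>a\<in>A. Pair a ` X a)" by auto
  then have "(\<Oplus>p\<in>Sigma A X. f (fst p) (snd p)) = (\<Oplus>p\<in>(\<Union>a\<in>A. Pair a ` X a). f (fst p) (snd p))"
    by simp
  also have "\<dots> = (\<Oplus>a\<in>A. \<Oplus>p\<in>Pair a ` X a. f (fst p) (snd p))"
    by (rule add.finprod_UN_disjoint)
      (use assms in \<open>auto simp: pairwise_def disjnt_def\<close>)
  also have "\<dots> = (\<Oplus>a\<in>A. \<Oplus>b\<in>X a. f a b)"
  proof (rule finsum_cong'[OF refl])
    show "(\<Oplus>p\<in>Pair a ` X a. f (fst p) (snd p)) = (\<Oplus>b\<in>X a. f a b)" if "a \<in> A" for a
      using finsum_reindex[of "\<lambda>p. f (fst p) (snd p)" "Pair a" "X a"] f that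
      by (auto simp: inj_on_def Pi_def)
  qed (use f in auto)
  finally show ?thesis .
qed

text \<open>The admissible pairs read off from the list \<open>[\<sigma> k, \<sigma> (k + 1), \<dots>]\<close> of values of a shuffle, the first of
  which stands at position \<open>k\<close>.\<close>
fun admissible_from :: "nat \<Rightarrow> nat \<Rightarrow> nat list \<Rightarrow> (nat \<times> nat) set" where
  "admissible_from m k (i # j # zs) =
     (if i \<le> m \<and> m < j then {(k, k + 1)} else {}) \<union> admissible_from m (k + 1) (j # zs)"
| "admissible_from m k zs = {}"

lemma admissible_from_bound: "p \<in> admissible_from m k zs \<Longrightarrow> k \<le> fst p \<and> snd p = fst p + 1"
  by (induction m k zs rule: admissible_from.induct) (fastforce split: if_splits)+

lemma admissible_from_finite: "finite (admissible_from m k zs)"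
  by (induction m k zs rule: admissible_from.induct) auto

lemma admissible_from_tl: "m < j \<Longrightarrow> admissible_from m k (j # zs) = admissible_from m (k + 1) zs"
  by (cases zs) auto

lemma admissible_from_nth:
  "admissible_from m k zs
    = {(k + i, k + i + 1) | i. i + 1 < length zs \<and> zs ! i \<le> m \<and> m < zs ! (i + 1)}"
proof (induction m k zs rule: admissible_from.induct)
  case (1 m k i j zs)
  have split: "{f i | i. Q i} = (if Q 0 then {f 0} else {}) \<union> {f (Suc i) | i. Q (Suc i)}"
    for f :: "nat \<Rightarrow> nat \<times> nat" and Q
  proof -
    have "{f i | i. Q i} = f ` Collect Q" by auto
    also have "Collect Q = (if Q 0 then {0} else {}) \<union> Suc ` {i. Q (Suc i)}"
      by (auto simp: image_iff) (metis not0_implies_Suc)+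
    finally show ?thesis by auto
  qed
  show ?case
    unfolding admissible_from.simps 1
      split[of "\<lambda>l. (k + l, k + l + 1)" "\<lambda>l. l + 1 < length (i # j # zs) \<and> (i # j # zs) ! l \<le> m
        \<and> m < (i # j # zs) ! (l + 1)"]
    by simp
qed auto

lemma contract_cong:
  assumes "\<And>i. k \<le> i \<Longrightarrow> (i, i + 1) \<in> T \<longleftrightarrow> (i, i + 1) \<in> T'"
  shows "contract B T k us = contract B T' k us"
  using assms by (induction B T k us rule: contract.induct) auto

lemma contract_keep_head:
  assumes "(k, k + 1) \<notin> T"
  shows "contract B T k (u # us) = u # contract B T (k + 1) us"
  using assms by (cases us) auto

lemma contract_closed:
  assumes "\<And>a b. a \<in> X \<Longrightarrow> b \<in> X \<Longrightarrow> a \<otimes>\<^bsub>B\<^esub> b \<in> X" "us \<in> lists X"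
  shows "contract B T k us \<in> lists X"
  using assms by (induction B T k us rule: contract.induct) auto

text \<open>For one shuffle, given as the list of its values, the sum over all sets of mergers.  A letter that
  has absorbed its right neighbour starts no further merger, as that neighbour came from the
  second word; this is why the second summand recurses on the list after both.\<close>
fun mergesum ::
    "'c \<Rightarrow> ('b, 'k) monoid_scheme \<Rightarrow> ('c, 'a, 'n) module_scheme \<Rightarrow> nat \<Rightarrow> (nat \<Rightarrow> 'b)
      \<Rightarrow> ('b list \<Rightarrow> 'a) \<Rightarrow> nat list \<Rightarrow> 'a" where
  "mergesum lam B N m u g [] = g []"
| "mergesum lam B N m u g [i] = g [u i]"
| "mergesum lam B N m u g (i # j # zs) =
     mergesum lam B N m u (\<lambda>w. g (u i # w)) (j # zs) \<oplus>\<^bsub>N\<^esub>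
     (if i \<le> m \<and> m < j
      then lam \<odot>\<^bsub>N\<^esub> mergesum lam B N m u (\<lambda>w. g ((u i \<otimes>\<^bsub>B\<^esub> u j) # w)) zs else \<zero>\<^bsub>N\<^esub>)"

context weighted_algebra
begin

lemma weight_pow_closed [simp]: "lam [^]\<^bsub>C\<^esub> (n::nat) \<in> carrier C"
  using weight_closed by simp

context
  fixes N :: "('a, 'x, 'y) module_scheme"
  assumes N: "module C N"
begin

interpretation N: module C N by (rule N)

lemma mergesum_closed:
  assumes "u \<in> set zs \<rightarrow> carrier B" "g \<in> letters \<rightarrow> carrier N"
  shows "mergesum lam B N m u g zs \<in> carrier N"
  using assms
proof (induction zs arbitrary: g rule: induct_list012)
  case (3 i j zs)
  have "u i \<in> carrier B" "u i \<cdot> u j \<in> carrier B" using 3(3) by (auto simp: mult_closed)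
  note gs = this[THEN Cons_fun[OF 3(4)]]
  have "mergesum lam B N m u (\<lambda>w. g (u i # w)) (j # zs) \<in> carrier N"
    by (rule 3(2)[OF _ gs(1)]) (use 3(3) in auto)
  moreover have "mergesum lam B N m u (\<lambda>w. g ((u i \<cdot> u j) # w)) zs \<in> carrier N"
    by (rule 3(1)[OF _ gs(2)]) (use 3(3) in auto)
  ultimately show ?case using weight_closed by simp
qed auto

text \<open>A set of admissible pairs either avoids the first pair or arises from such a set by inserting it.
  In the second case \<open>contract\<close> continues after the merged letter with an unmerged position, because the
  following pair is not admissible.\<close>
lemma mergesum_subsets:
  assumes "u \<in> set zs \<rightarrow> carrier B" "g \<in> letters \<rightarrow> carrier N"
  shows "(\<Oplus>\<^bsub>N\<^esub>T\<in>Pow (admissible_from m k zs). lam [^]\<^bsub>C\<^esub> card T \<odot>\<^bsub>N\<^esub> g (contract B T k (map u zs)))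
    = mergesum lam B N m u g zs"
  using assms
proof (induction zs arbitrary: g k rule: induct_list012)
  case (3 i j zs)
  let ?A = "admissible_from m (k + 1) (j # zs)" and ?p = "(k, k + 1)"
  let ?t = "\<lambda>T. lam [^]\<^bsub>C\<^esub> card T \<odot>\<^bsub>N\<^esub> g (contract B T k (map u (i # j # zs)))"
  have ui: "u i \<in> carrier B" "u j \<in> carrier B" "u i \<cdot> u j \<in> carrier B"
    using 3(3) by (auto simp: mult_closed)
  have us: "map u zs \<in> letters" "map u (j # zs) \<in> letters" "map u (i # j # zs) \<in> letters"
    using 3(3) by auto
  note gc = funcset_mem[OF 3(4)]
  note contract_mem = contract_closed[where X = "carrier B", OF mult_closed]
  have pA: "?p \<notin> T" if "T \<subseteq> ?A" for T
    using that admissible_from_bound[of ?p m "k + 1" "j # zs"] by auto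
  have term_closed: "?t T \<in> carrier N" for T
    using gc[OF contract_mem[OF _ _ us(3)]] by simp
  have "(\<Oplus>\<^bsub>N\<^esub>T\<in>Pow ?A. ?t T)
      = (\<Oplus>\<^bsub>N\<^esub>T\<in>Pow ?A. lam [^]\<^bsub>C\<^esub> card T \<odot>\<^bsub>N\<^esub> g (u i # contract B T (k + 1) (map u (j # zs))))"
  proof (rule N.M.finsum_cong'[OF refl])
    have keepT: "contract B T k (map u (i # j # zs)) = u i # contract B T (k + 1) (map u (j # zs))"
      if "T \<subseteq> ?A" for T
      by (simp only: list.map contract_keep_head[OF pA[OF that], of B "u i" "u j # map u zs"])
    show "?t T
        = lam [^]\<^bsub>C\<^esub> card T \<odot>\<^bsub>N\<^esub> g (u i # contract B T (k + 1) (map u (j # zs)))"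
      if "T \<in> Pow ?A" for T
      using that by (simp only: Pow_iff keepT)
    show "(\<lambda>T. lam [^]\<^bsub>C\<^esub> card T \<odot>\<^bsub>N\<^esub> g (u i # contract B T (k + 1) (map u (j # zs))))
        \<in> Pow ?A \<rightarrow> carrier N"
    proof (rule funcsetI)
      show "lam [^]\<^bsub>C\<^esub> card T \<odot>\<^bsub>N\<^esub> g (u i # contract B T (k + 1) (map u (j # zs))) \<in> carrier N"
        if "T \<in> Pow ?A" for T
        using term_closed[of T] that by (simp only: Pow_iff keepT)
    qed
  qed
  also have "\<dots> = mergesum lam B N m u (\<lambda>w. g (u i # w)) (j # zs)"
    using 3(3) by (intro 3(2) Cons_fun[OF 3(4) ui(1)]) auto
  finally have keep: "(\<Oplus>\<^bsub>N\<^esub>T\<in>Pow ?A. ?t T) = \<dots>" .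
  show ?case
  proof (cases "i \<le> m \<and> m < j")
    case False
    have "mergesum lam B N m u (\<lambda>w. g (u i # w)) (j # zs) \<in> carrier N"
      by (rule mergesum_closed[OF _ Cons_fun[OF 3(4) ui(1)]]) (use 3(3) in auto)
    then have merge: "mergesum lam B N m u g (i # j # zs) = mergesum lam B N m u (\<lambda>w. g (u i # w)) (j # zs)"
      using False by auto
    have adm: "admissible_from m k (i # j # zs) = ?A" using False by auto
    show ?thesis unfolding adm merge by (rule keep)
  next
    case True
    have A: "?A = admissible_from m (k + 2) zs" using True by (simp add: admissible_from_tl)
    have pA2: "(k + 1, k + 2) \<notin> T" if "T \<subseteq> ?A" for T
      using that admissible_from_bound[of "(k + 1, k + 2)" m "k + 2" zs] unfolding A by auto
    have merged: "contract B (insert ?p T) k (map u (i # j # zs))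
        = (u i \<cdot> u j) # contract B T (k + 2) (map u zs)" if "T \<subseteq> ?A" for T
    proof -
      have "contract B (insert ?p T) k (map u (i # j # zs))
          = contract B (insert ?p T) (k + 1) ((u i \<cdot> u j) # map u zs)" by simp
      also have "\<dots> = (u i \<cdot> u j) # contract B (insert ?p T) (k + 2) (map u zs)"
        using pA2[OF that] by (subst contract_keep_head) auto
      also have "contract B (insert ?p T) (k + 2) (map u zs) = contract B T (k + 2) (map u zs)"
        by (rule contract_cong) auto
      finally show ?thesis .
    qed
    let ?h = "\<lambda>T. lam [^]\<^bsub>C\<^esub> card T \<odot>\<^bsub>N\<^esub> g ((u i \<cdot> u j) # contract B T (k + 2) (map u zs))"
    have h_closed: "?h T \<in> carrier N" for T
      using gc contract_mem[OF _ _ us(1)] ui by auto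
    have finA: "finite (Pow ?A)" by (simp add: admissible_from_finite)
    have inj: "inj_on (insert ?p) (Pow ?A)"
      by (rule inj_onI) (metis PowD insert_ident pA)
    have "(\<Oplus>\<^bsub>N\<^esub>T\<in>insert ?p ` Pow ?A. ?t T)
        = (\<Oplus>\<^bsub>N\<^esub>T\<in>Pow ?A. ?t (insert ?p T))"
      using term_closed by (intro N.M.finsum_reindex inj) auto
    also have "\<dots> = (\<Oplus>\<^bsub>N\<^esub>T\<in>Pow ?A. lam \<odot>\<^bsub>N\<^esub> ?h T)"
    proof (rule N.M.finsum_cong'[OF refl])
      show "(\<lambda>T. lam \<odot>\<^bsub>N\<^esub> ?h T) \<in> Pow ?A \<rightarrow> carrier N" using h_closed weight_closed by auto
      fix T assume "T \<in> Pow ?A"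
      then have T: "T \<subseteq> ?A" by simp
      then have "card (insert ?p T) = Suc (card T)"
        using pA finite_subset[OF T admissible_from_finite] by simp
      moreover have "g ((u i \<cdot> u j) # contract B T (k + 2) (map u zs)) \<in> carrier N"
        using gc contract_mem[OF _ _ us(1)] ui by auto
      ultimately show "?t (insert ?p T) = lam \<odot>\<^bsub>N\<^esub> ?h T"
        unfolding merged[OF T] using weight_closed
        by (simp add: N.smult_assoc1 N.smult_lcomm[of lam])
    qed
    also have "\<dots> = lam \<odot>\<^bsub>N\<^esub> (\<Oplus>\<^bsub>N\<^esub>T\<in>Pow ?A. ?h T)"
      using h_closed weight_closed by (intro N.finsum_smult_ldistr[symmetric] finA) auto
    also have "(\<Oplus>\<^bsub>N\<^esub>T\<in>Pow ?A. ?h T) = mergesum lam B N m u (\<lambda>w. g ((u i \<cdot> u j) # w)) zs"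
      unfolding A using 3(3) by (intro 3(1) Cons_fun[OF 3(4) ui(3)]) auto
    finally have merge: "(\<Oplus>\<^bsub>N\<^esub>T\<in>insert ?p ` Pow ?A. ?t T) = lam \<odot>\<^bsub>N\<^esub> \<dots>" .
    have "admissible_from m k (i # j # zs) = insert ?p ?A" using True by auto
    then have "Pow (admissible_from m k (i # j # zs)) = Pow ?A \<union> insert ?p ` Pow ?A"
      by (simp only: Pow_insert)
    moreover have "Pow ?A \<inter> insert ?p ` Pow ?A = {}" using pA by auto
    ultimately have "(\<Oplus>\<^bsub>N\<^esub>T\<in>Pow (admissible_from m k (i # j # zs)).
?t T)
        = (\<Oplus>\<^bsub>N\<^esub>T\<in>Pow ?A. ?t T) \<oplus>\<^bsub>N\<^esub>
          (\<Oplus>\<^bsub>N\<^esub>T\<in>insert ?p ` Pow ?A. ?t T)"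
      using term_closed finA by (simp only: N.M.finsum_Un_disjoint Pi_I finite_imageI)
    then show ?thesis unfolding keep merge using True by simp
  qed
qed (auto simp: Pi_def)

lemma mergesum_no_merge:
  assumes "u \<in> set zs \<rightarrow> carrier B" "g \<in> letters \<rightarrow> carrier N"
    and "(\<forall>i\<in>set zs. i \<le> m) \<or> (\<forall>i\<in>set zs. m < i)"
  shows "mergesum lam B N m u g zs = g (map u zs)"
  using assms
proof (induction zs arbitrary: g rule: induct_list012)
  case (3 i j zs)
  have us: "u i \<in> carrier B" "map u (i # j # zs) \<in> letters" using 3(3) by auto
  have "mergesum lam B N m u (\<lambda>w. g (u i # w)) (j # zs) = g (u i # map u (j # zs))"
    by (rule 3(2)) (use 3(3,5) Cons_fun[OF 3(4) us(1)] in auto)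
  moreover have "\<not> (i \<le> m \<and> m < j)" using 3(5) by auto
  ultimately show ?case using funcset_mem[OF 3(4) us(2)] by auto
qed auto

lemma mergesum_Cons:
  assumes "u \<in> set (i # zs) \<rightarrow> carrier B" "g \<in> letters \<rightarrow> carrier N" "zs \<noteq> []"
  shows "mergesum lam B N m u g (i # zs) = mergesum lam B N m u (\<lambda>w. g (u i # w)) zs \<oplus>\<^bsub>N\<^esub>
     (if i \<le> m \<and> m < hd zs
      then lam \<odot>\<^bsub>N\<^esub> mergesum lam B N m u (\<lambda>w. g ((u i \<cdot> u (hd zs)) # w)) (tl zs) else \<zero>\<^bsub>N\<^esub>)"
  using assms by (cases zs) simp_all

lemma shuffles_hd_right:
  assumes "\<forall>i\<in>set xs. i \<le> m" "m < (j::nat)"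
  shows "{zs \<in> shuffles xs (j # ys). m < hd zs} = (#) j ` shuffles xs ys"
  using assms by (cases xs) auto

text \<open>Sort the shuffles by their first index.  Those starting in the second word contribute the
  second summand of the recursion.  Those starting with \<open>i\<close> contribute the first summand through
  the absence of a merger at the front, and the third summand through its presence: such a merger
  requires that the next index is the first one of the second word.\<close>
lemma mergesum_shuffles:
  assumes "u \<in> set xs \<union> set ys \<rightarrow> carrier B" "g \<in> letters \<rightarrow> carrier N"
    and "\<forall>i\<in>set xs. i \<le> m" "\<forall>j\<in>set ys. m < j"
  shows "(\<Oplus>\<^bsub>N\<^esub>zs\<in>shuffles xs ys. mergesum lam B N m u g zs) = mixsum lam B N g (map u xs) (map u ys)"
  using assms
proof (induction xs ys arbitrary: g rule: list_pair_induct_raw)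
  case (1 ys)
  have "mergesum lam B N m u g ys = g (map u ys)"
    by (rule mergesum_no_merge) (use 1 in auto)
  moreover have "g (map u ys) \<in> carrier N"
    by (rule funcset_mem[OF 1(2)]) (use 1(1) in auto)
  ultimately show ?case by simp
next
  case (2 i xs)
  have "mergesum lam B N m u g (i # xs) = g (map u (i # xs))"
    by (rule mergesum_no_merge) (use 2 in auto)
  moreover have "g (map u (i # xs)) \<in> carrier N"
    by (rule funcset_mem[OF 2(2)]) (use 2(1) in auto)
  ultimately show ?case by simp
next
  case (3 i xs j ys)
  let ?G = "mergesum lam B N m u"
  let ?l = "\<lambda>zs. lam \<odot>\<^bsub>N\<^esub> ?G (\<lambda>w. g ((u i \<cdot> u (hd zs)) # w)) (tl zs)"
  let ?m = "\<lambda>zs. if m < hd zs then ?l zs else \<zero>\<^bsub>N\<^esub>"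
  let ?X = "shuffles xs (j # ys)" and ?Y = "shuffles (i # xs) ys"
  have ij: "i \<le> m" "m < j" using 3(6,7) by auto
  have u: "u i \<in> carrier B" "u j \<in> carrier B" "u i \<cdot> u j \<in> carrier B"
    using 3(4) by (auto simp: mult_closed)
  note gi = u[THEN Cons_fun[OF 3(5)]]
  have setX: "u \<in> set zs \<rightarrow> carrier B" if "zs \<in> ?X \<union> ?Y \<union> shuffles xs ys" for zs
    using that 3(4) by (auto dest!: set_shuffles)
  have closedG: "?G (\<lambda>w. g (e # w)) zs \<in> carrier N" if "zs \<in> ?X \<union> ?Y \<union> shuffles xs ys"
    "e \<in> carrier B" for zs e
    using that setX by (intro mergesum_closed Cons_fun[OF 3(5)])
  have closed2: "?G g (e # zs) \<in> carrier N" if "zs \<in> ?X \<union> ?Y \<union> shuffles xs ys"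
    "u e \<in> carrier B" for zs e
    by (rule mergesum_closed[OF _ 3(5)]) (use that setX[OF that(1)] in auto)
  have closedM: "?G (\<lambda>w. g ((u i \<cdot> u (hd zs)) # w)) (tl zs) \<in> carrier N" if "zs \<in> ?X" for zs
  proof -
    obtain e es where e: "zs = e # es" using \<open>zs \<in> ?X\<close> by (cases zs) auto
    then have "u e \<in> carrier B" "u \<in> set es \<rightarrow> carrier B" using setX[of zs] that by auto
    then show ?thesis
      using u e by (auto intro!: mergesum_closed Cons_fun[OF 3(5)] mult_closed)
  qed
  have "(\<Oplus>\<^bsub>N\<^esub>zs\<in>shuffles (i # xs) (j # ys). ?G g zs)
      = (\<Oplus>\<^bsub>N\<^esub>zs\<in>(#) i ` ?X. ?G g zs) \<oplus>\<^bsub>N\<^esub> (\<Oplus>\<^bsub>N\<^esub>zs\<in>(#) j ` ?Y. ?G g zs)"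
    unfolding shuffles.simps
    by (rule N.M.finsum_Un_disjoint) (use ij closed2 u in auto)
  also have "(\<Oplus>\<^bsub>N\<^esub>zs\<in>(#) j ` ?Y. ?G g zs) = (\<Oplus>\<^bsub>N\<^esub>zs\<in>?Y. ?G g (j # zs))"
    by (rule N.M.finsum_reindex) (use closed2 u in \<open>auto simp: inj_on_def\<close>)
  also have "\<dots> = (\<Oplus>\<^bsub>N\<^esub>zs\<in>?Y. ?G (\<lambda>w. g (u j # w)) zs)"
  proof (rule N.M.finsum_cong'[OF refl])
    fix zs assume zs: "zs \<in> ?Y"
    then have "zs \<noteq> []" by auto
    then show "?G g (j # zs) = ?G (\<lambda>w. g (u j # w)) zs"
      using zs ij closedG[of zs "u j"] u setX[of zs]
      by (subst mergesum_Cons[OF _ 3(5)]) auto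
  qed (use closedG u in auto)
  also have "\<dots> = mixsum lam B N (\<lambda>w. g (u j # w)) (map u (i # xs)) (map u ys)"
    by (rule 3(2)[OF _ gi(2)]) (use 3(4-) in auto)
  also have "(\<Oplus>\<^bsub>N\<^esub>zs\<in>(#) i ` ?X. ?G g zs) = (\<Oplus>\<^bsub>N\<^esub>zs\<in>?X. ?G g (i # zs))"
    by (rule N.M.finsum_reindex) (use closed2 u in \<open>auto simp: inj_on_def\<close>)
  also have "\<dots> = (\<Oplus>\<^bsub>N\<^esub>zs\<in>?X. ?G (\<lambda>w. g (u i # w)) zs \<oplus>\<^bsub>N\<^esub>
      ?m zs)"
  proof (rule N.M.finsum_cong'[OF refl])
    fix zs assume zs: "zs \<in> ?X"
    then have "zs \<noteq> []" by auto
    then show "?G g (i # zs) = ?G (\<lambda>w. g (u i # w)) zs \<oplus>\<^bsub>N\<^esub>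
      ?m zs"
      using zs ij u setX[of zs] by (subst mergesum_Cons[OF _ 3(5)]) auto
  qed (use closedG closedM u weight_closed in auto)
  also have "\<dots> = (\<Oplus>\<^bsub>N\<^esub>zs\<in>?X. ?G (\<lambda>w. g (u i # w)) zs) \<oplus>\<^bsub>N\<^esub> (\<Oplus>\<^bsub>N\<^esub>zs\<in>?X.
      ?m zs)"
    (is "_ = _ \<oplus>\<^bsub>N\<^esub> ?M")
    by (rule N.M.finsum_addf) (use closedG closedM u weight_closed in auto)
  also have "(\<Oplus>\<^bsub>N\<^esub>zs\<in>?X. ?G (\<lambda>w. g (u i # w)) zs) = mixsum lam B N (\<lambda>w. g (u i # w)) (map u xs) (map u (j # ys))"
    by (rule 3(1)[OF _ gi(1)]) (use 3(4-) in auto)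
  also have "?M = (\<Oplus>\<^bsub>N\<^esub>zs\<in>(#) j ` shuffles xs ys. ?l zs)"
    using ij 3(6) closedM weight_closed
    by (intro N.M.add.finprod_mono_neutral_cong_right)
      (auto simp flip: shuffles_hd_right[of xs m j ys])
  also have "\<dots> = (\<Oplus>\<^bsub>N\<^esub>zs\<in>shuffles xs ys. lam \<odot>\<^bsub>N\<^esub> ?G (\<lambda>w. g ((u i \<cdot> u j) # w)) zs)"
    using closedG u weight_closed
    by (subst N.M.finsum_reindex) (auto simp: inj_on_def)
  also have "\<dots> = lam \<odot>\<^bsub>N\<^esub> (\<Oplus>\<^bsub>N\<^esub>zs\<in>shuffles xs ys. ?G (\<lambda>w. g ((u i \<cdot> u j) # w)) zs)"
    using closedG u weight_closed by (intro N.finsum_smult_ldistr[symmetric]) auto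
  also have "(\<Oplus>\<^bsub>N\<^esub>zs\<in>shuffles xs ys. ?G (\<lambda>w. g ((u i \<cdot> u j) # w)) zs)
      = mixsum lam B N (\<lambda>w. g ((u i \<cdot> u j) # w)) (map u xs) (map u ys)"
    by (rule 3(3)[OF _ gi(3)]) (use 3(4-) in auto)
  finally have total: "(\<Oplus>\<^bsub>N\<^esub>zs\<in>shuffles (i # xs) (j # ys). ?G g zs)
    = mixsum lam B N (\<lambda>w. g (u i # w)) (map u xs) (map u (j # ys))
      \<oplus>\<^bsub>N\<^esub> lam \<odot>\<^bsub>N\<^esub> mixsum lam B N (\<lambda>w. g ((u i \<cdot> u j) # w)) (map u xs) (map u ys)
      \<oplus>\<^bsub>N\<^esub> mixsum lam B N (\<lambda>w. g (u j # w)) (map u (i # xs)) (map u ys)" .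
  have lets: "map u xs \<in> letters" "map u ys \<in> letters" using 3(4) by auto
  have "mixsum lam B N (\<lambda>w. g (u i # w)) (map u xs) (map u (j # ys)) \<in> carrier N"
    "mixsum lam B N (\<lambda>w. g ((u i \<cdot> u j) # w)) (map u xs) (map u ys) \<in> carrier N"
    "mixsum lam B N (\<lambda>w. g (u j # w)) (map u (i # xs)) (map u ys) \<in> carrier N"
    by (rule mixsum_closed[OF N _ _ gi(1)] mixsum_closed[OF N _ _ gi(2)] mixsum_closed[OF N _ _ gi(3)];
        use lets u in simp)+
  then show ?case unfolding total using weight_closed by (simp add: N.M.a_ac)
qed

end

end

lemma sorted_wrt_filter_iff:
  "sorted_wrt R (filter Q zs) \<longleftrightarrow> sorted_wrt (\<lambda>i j. Q i \<and> Q j \<longrightarrow> R i j) zs"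
proof (induction zs)
  case (Cons i zs)
  have "(\<forall>j\<in>set (filter Q zs). R i j) \<longleftrightarrow> (\<forall>j\<in>set zs. Q j \<longrightarrow> R i j)" by auto
  then show ?case using Cons by auto
qed simp

text \<open>Both sides say that \<open>\<sigma> p < \<sigma> q\<close> whenever \<open>p < q\<close> and both values lie in \<open>X\<close>; for the inverse,
  substitute \<open>i = \<sigma> p\<close>.\<close>
lemma strict_mono_on_inverse_iff:
  fixes \<sigma> :: "nat \<Rightarrow> nat"
  assumes \<sigma>: "\<sigma> permutes {1..N}" and X: "X \<subseteq> {1..N}"
  shows "strict_mono_on X (inv_into UNIV \<sigma>)
    \<longleftrightarrow> sorted_wrt (<) (filter (\<lambda>i. i \<in> X) (map \<sigma> [1..<N + 1]))"
proof -
  have inv: "inv_into UNIV \<sigma> (\<sigma> k) = k" "\<sigma> (inv_into UNIV \<sigma> k) = k" for k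
    using permutes_inverses[OF \<sigma>] by simp_all
  have mem: "\<sigma> k \<in> {1..N} \<longleftrightarrow> k \<in> {1..N}" for k by (rule permutes_in_image[OF \<sigma>])
  have "sorted_wrt (<) (filter (\<lambda>i. i \<in> X) (map \<sigma> [1..<N + 1]))
      \<longleftrightarrow> (\<forall>p\<in>{1..N}. \<forall>q\<in>{1..N}. p < q \<longrightarrow> \<sigma> p \<in> X \<and> \<sigma> q \<in> X \<longrightarrow> \<sigma> p < \<sigma> q)"
    unfolding sorted_wrt_filter_iff sorted_wrt_map
    unfolding sorted_wrt_iff_nth_less
  proof (intro iffI ballI impI allI; (elim conjE)?)
    fix p q assume *: "\<forall>i j. i < j \<longrightarrow> j < length [1..<N + 1] \<longrightarrow>
        \<sigma> ([1..<N + 1] ! i) \<in> X \<and> \<sigma> ([1..<N + 1] ! j) \<in> X \<longrightarrow>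
        \<sigma> ([1..<N + 1] ! i) < \<sigma> ([1..<N + 1] ! j)"
      and pq: "p \<in> {1..N}" "q \<in> {1..N}" "p < q" "\<sigma> p \<in> X" "\<sigma> q \<in> X"
    have "p - 1 < q - 1" "q - 1 < length [1..<N + 1]" "[1..<N + 1] ! (p - 1) = p" "[1..<N + 1] ! (q - 1) = q"
      using pq by (auto simp del: upt_Suc)
    then show "\<sigma> p < \<sigma> q" using *[rule_format, of "p - 1" "q - 1"] pq by simp
  next
    fix i j assume *: "\<forall>p\<in>{1..N}. \<forall>q\<in>{1..N}. p < q \<longrightarrow> \<sigma> p \<in> X \<and> \<sigma> q \<in> X \<longrightarrow> \<sigma> p < \<sigma> q"
      and ij: "i < j" "j < length [1..<N + 1]" "\<sigma> ([1..<N + 1] ! i) \<in> X" "\<sigma> ([1..<N + 1] ! j) \<in> X"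
    have "[1..<N + 1] ! i = i + 1" "[1..<N + 1] ! j = j + 1"
      using ij by (auto simp del: upt_Suc)
    then show "\<sigma> ([1..<N + 1] ! i) < \<sigma> ([1..<N + 1] ! j)"
      using *[rule_format, of "i + 1" "j + 1"] ij by (simp del: upt_Suc)
  qed
  also have "\<dots> \<longleftrightarrow> strict_mono_on X (inv_into UNIV \<sigma>)"
  proof
    assume *: "\<forall>p\<in>{1..N}. \<forall>q\<in>{1..N}. p < q \<longrightarrow> \<sigma> p \<in> X \<and> \<sigma> q \<in> X \<longrightarrow> \<sigma> p < \<sigma> q"
    show "strict_mono_on X (inv_into UNIV \<sigma>)"
    proof (rule strict_mono_onI)
      fix i j assume ij: "i \<in> X" "j \<in> X" "i < j"
      have "inv_into UNIV \<sigma> i \<in> {1..N}" "inv_into UNIV \<sigma> j \<in> {1..N}"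
        using ij X mem[of "inv_into UNIV \<sigma> i"] mem[of "inv_into UNIV \<sigma> j"] unfolding inv by blast+
      then have "\<not> inv_into UNIV \<sigma> j < inv_into UNIV \<sigma> i"
        using *[rule_format, of "inv_into UNIV \<sigma> j" "inv_into UNIV \<sigma> i"] ij unfolding inv by auto
      moreover have "inv_into UNIV \<sigma> j \<noteq> inv_into UNIV \<sigma> i"
        using ij inv(2) by (metis less_irrefl)
      ultimately show "inv_into UNIV \<sigma> i < inv_into UNIV \<sigma> j" by linarith
    qed
  next
    assume mono: "strict_mono_on X (inv_into UNIV \<sigma>)"
    show "\<forall>p\<in>{1..N}. \<forall>q\<in>{1..N}. p < q \<longrightarrow> \<sigma> p \<in> X \<and> \<sigma> q \<in> X \<longrightarrow> \<sigma> p < \<sigma> q"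
    proof (intro ballI impI; elim conjE)
      fix p q assume pq: "p < q" "\<sigma> p \<in> X" "\<sigma> q \<in> X"
      then have "\<not> \<sigma> q < \<sigma> p" using strict_mono_onD[OF mono, of "\<sigma> q" "\<sigma> p"] unfolding inv by auto
      moreover have "\<sigma> p \<noteq> \<sigma> q" using pq inv(1) by (metis less_irrefl)
      ultimately show "\<sigma> p < \<sigma> q" by linarith
    qed
  qed
  finally show ?thesis by simp
qed

text \<open>A list without repetitions shuffles two disjoint lists that together have the same elements exactly
  if it restricts to each of them; for the list of values of a permutation and the two blocks of
  indices this says that both restrictions are sorted.\<close>
lemma shuffles_perm_iff:
  assumes \<sigma>: "\<sigma> permutes {1..m + n}"
  shows "\<sigma> \<in> shuffles_perm m n
    \<longleftrightarrow> map \<sigma> [1..<m + n + 1] \<in> shuffles [1..<m + 1] [m + 1..<m + n + 1]"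
proof -
  let ?zs = "map \<sigma> [1..<m + n + 1]"
  have set: "set ?zs = {1..m + n}"
    using permutes_image[OF \<sigma>] by (simp add: atLeastLessThanSuc_atLeastAtMost del: upt_Suc)
  have dist: "distinct ?zs"
    using permutes_inj_on[OF \<sigma>] by (simp add: distinct_map del: upt_Suc)
  have sorted: "sorted_wrt (<) (filter (\<lambda>i. i \<in> {a + 1..b}) ?zs) \<longleftrightarrow> filter (\<lambda>i. i \<in> {a + 1..b}) ?zs = [a + 1..<b + 1]"
    if "b \<le> m + n" for a b
  proof
    assume "sorted_wrt (<) (filter (\<lambda>i. i \<in> {a + 1..b}) ?zs)"
    moreover have "set (filter (\<lambda>i. i \<in> {a + 1..b}) ?zs) = set [a + 1..<b + 1]"
      using that unfolding set_filter set by auto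
    ultimately show "filter (\<lambda>i. i \<in> {a + 1..b}) ?zs = [a + 1..<b + 1]"
      by (intro strict_sorted_equal) (simp_all add: sorted_wrt_upt del: upt_Suc)
  next
    assume "filter (\<lambda>i. i \<in> {a + 1..b}) ?zs = [a + 1..<b + 1]"
    then show "sorted_wrt (<) (filter (\<lambda>i. i \<in> {a + 1..b}) ?zs)" by (simp only: sorted_wrt_upt)
  qed
  have "\<sigma> \<in> shuffles_perm m n \<longleftrightarrow> filter (\<lambda>i. i \<in> {1..m}) ?zs = [1..<m + 1]
      \<and> filter (\<lambda>i. i \<in> {m + 1..m + n}) ?zs = [m + 1..<m + n + 1]"
    unfolding shuffles_perm_def using \<sigma> sorted[of m 0] sorted[of "m + n" m]
    by (simp add: strict_mono_on_inverse_iff[OF \<sigma>] del: upt_Suc)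
  also have "\<dots> \<longleftrightarrow> ?zs \<in> shuffles [1..<m + 1] [m + 1..<m + n + 1]"
  proof
    assume eq: "filter (\<lambda>i. i \<in> {1..m}) ?zs = [1..<m + 1]
      \<and> filter (\<lambda>i. i \<in> {m + 1..m + n}) ?zs = [m + 1..<m + n + 1]"
    have "filter (\<lambda>i. i \<in> {m + 1..m + n}) ?zs = filter (\<lambda>i. i \<notin> {1..m}) ?zs"
      by (rule filter_cong[OF refl]) (use set in auto)
    then show "?zs \<in> shuffles [1..<m + 1] [m + 1..<m + n + 1]"
      using eq partition_in_shuffles[of ?zs "\<lambda>i. i \<in> {1..m}"] by metis
  next
    assume "?zs \<in> shuffles [1..<m + 1] [m + 1..<m + n + 1]"
    moreover have "set [1..<m + 1] \<inter> set [m + 1..<m + n + 1] = {}" by auto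
    moreover have "set [1..<m + 1] = {1..m}" "set [m + 1..<m + n + 1] = {m + 1..m + n}" by auto
    ultimately show "filter (\<lambda>i. i \<in> {1..m}) ?zs = [1..<m + 1]
      \<and> filter (\<lambda>i. i \<in> {m + 1..m + n}) ?zs = [m + 1..<m + n + 1]"
      by (metis filter_shuffles_disjoint1(1) filter_shuffles_disjoint2(1))
  qed
  finally show ?thesis .
qed

lemma bij_betw_shuffles_perm:
  "bij_betw (\<lambda>\<sigma>. map \<sigma> [1..<m + n + 1]) (shuffles_perm m n) (shuffles [1..<m + 1] [m + 1..<m + n + 1])"
proof (rule bij_betwI')
  let ?N = "m + n"
  have perm: "\<sigma> permutes {1..?N}" if "\<sigma> \<in> shuffles_perm m n" for \<sigma>
    using that by (simp add: shuffles_perm_def)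
  show "map \<sigma> [1..<?N + 1] = map \<tau> [1..<?N + 1] \<longleftrightarrow> \<sigma> = \<tau>"
    if "\<sigma> \<in> shuffles_perm m n" "\<tau> \<in> shuffles_perm m n" for \<sigma> \<tau>
  proof
    assume eq: "map \<sigma> [1..<?N + 1] = map \<tau> [1..<?N + 1]"
    show "\<sigma> = \<tau>"
    proof
      fix k show "\<sigma> k = \<tau> k"
      proof (cases "k \<in> {1..?N}")
        case True
        then show ?thesis using eq unfolding map_eq_conv by auto
      next
        case False
        then show ?thesis using perm that by (metis permutes_not_in)
      qed
    qed
  qed simp
  show "map \<sigma> [1..<?N + 1] \<in> shuffles [1..<m + 1] [m + 1..<?N + 1]" if "\<sigma> \<in> shuffles_perm m n" for \<sigma>
    using that shuffles_perm_iff[OF perm[OF that]] by simp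
  show "\<exists>\<sigma>\<in>shuffles_perm m n. zs = map \<sigma> [1..<?N + 1]"
    if zs: "zs \<in> shuffles [1..<m + 1] [m + 1..<?N + 1]" for zs
  proof -
    have "set zs = set [1..<m + 1] \<union> set [m + 1..<?N + 1]" by (rule set_shuffles[OF zs])
    also have "\<dots> = {1..?N}" unfolding set_upt by auto
    finally have set: "set zs = {1..?N}" .
    have len: "length zs = ?N" using length_shuffles[OF zs] unfolding length_upt by linarith
    define \<sigma> where "\<sigma> k = (if k \<in> {1..?N} then zs ! (k - 1) else k)" for k
    have map: "zs = map \<sigma> [1..<?N + 1]"
    proof (rule nth_equalityI)
      show "length zs = length (map \<sigma> [1..<?N + 1])" unfolding length_map length_upt len by linarith
      show "zs ! i = map \<sigma> [1..<?N + 1] ! i" if "i < length zs" for i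
      proof -
        have "i < length [1..<?N + 1]" "1 + i < ?N + 1" using that len by simp_all
        then have "map \<sigma> [1..<?N + 1] ! i = \<sigma> (1 + i)" by (simp only: nth_map nth_upt)
        then show ?thesis using that len by (simp add: \<sigma>_def)
      qed
    qed
    have "\<sigma> permutes {1..?N}"
    proof (rule bij_imp_permutes)
      have "\<sigma> ` {1..?N} = {1..?N}"
      proof -
        have "set zs = \<sigma> ` {1..?N}" by (subst map) (simp add: atLeastLessThanSuc_atLeastAtMost del: upt_Suc)
        then show ?thesis using set by simp
      qed
      then show "bij_betw \<sigma> {1..?N} {1..?N}"
        by (simp add: bij_betw_def eq_card_imp_inj_on)
    qed (auto simp: \<sigma>_def)
    then have "\<sigma> \<in> shuffles_perm m n" using shuffles_perm_iff zs map by simp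
    then show ?thesis using map by blast
  qed
qed

lemma admissible_pairs_eq: "admissible_pairs m n \<sigma> = admissible_from m 1 (map \<sigma> [1..<m + n + 1])"
proof -
  have "admissible_from m 1 (map \<sigma> [1..<m + n + 1])
      = {(1 + i, 1 + i + 1) | i. i + 1 < m + n \<and> \<sigma> (i + 1) \<le> m \<and> m < \<sigma> (i + 2)}"
    unfolding admissible_from_nth by (auto simp del: upt_Suc)
  also have "\<dots> = admissible_pairs m n \<sigma>"
    unfolding admissible_pairs_def
  proof (intro Set.set_eqI iffI)
    fix p assume "p \<in> {(k, k + 1) | k. 1 \<le> k \<and> k < m + n \<and> \<sigma> k \<le> m \<and> m < \<sigma> (k + 1)}"
    then obtain k where "p = (k, k + 1)" "1 \<le> k" "k < m + n" "\<sigma> k \<le> m" "m < \<sigma> (k + 1)" by blast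
    then show "p \<in> {(1 + i, 1 + i + 1) | i. i + 1 < m + n \<and> \<sigma> (i + 1) \<le> m \<and> m < \<sigma> (i + 2)}"
      by (intro CollectI exI[of _ "k - 1"]) auto
  next
    fix p assume "p \<in> {(1 + i, 1 + i + 1) | i. i + 1 < m + n \<and> \<sigma> (i + 1) \<le> m \<and> m < \<sigma> (i + 2)}"
    then obtain i where "p = (1 + i, 1 + i + 1)" "i + 1 < m + n" "\<sigma> (i + 1) \<le> m" "m < \<sigma> (i + 2)" by blast
    then show "p \<in> {(k, k + 1) | k. 1 \<le> k \<and> k < m + n \<and> \<sigma> k \<le> m \<and> m < \<sigma> (k + 1)}"
      by (intro CollectI exI[of _ "i + 1"]) auto
  qed
  finally show ?thesis by simp
qed

text \<open>Sum over \<open>T\<close> first (\<open>mergesum_subsets\<close>), with \<open>\<sigma>\<close> replaced by its list of values, and then over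
  these lists (\<open>mergesum_shuffles\<close>).\<close>
lemma (in weighted_algebra) mixsum_eq_mixable_shuffles:
  fixes N :: "('a, 'x, 'y) module_scheme"
  assumes N: "module C N" and x: "x \<in> letters" and y: "y \<in> letters"
    and g: "g \<in> letters \<rightarrow> carrier N"
  shows "finsum N (\<lambda>(\<sigma>, T). lam [^]\<^bsub>C\<^esub> card T \<odot>\<^bsub>N\<^esub> g (shuffle_word B x y \<sigma> T))
      (mixable_shuffles (length x) (length y)) = mixsum lam B N g x y"
    and "finite (mixable_shuffles (length x) (length y))"
    and "\<And>\<sigma> T. (\<sigma>, T) \<in> mixable_shuffles (length x) (length y) \<Longrightarrow> shuffle_word B x y \<sigma> T \<in> letters"
proof -
  interpret N: module C N by (rule N)
  let ?m = "length x" and ?n = "length y"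
  let ?zs = "\<lambda>\<sigma>. map \<sigma> [1..<?m + ?n + 1]"
  let ?S = "shuffles [1..<?m + 1] [?m + 1..<?m + ?n + 1]"
  define u where "u i = (x @ y) ! (i - 1)" for i
  note bij = bij_betw_shuffles_perm[of ?m ?n]
  have fin: "finite (shuffles_perm ?m ?n)" using bij_betw_finite[OF bij] by simp
  have mix: "mixable_shuffles ?m ?n
      = (SIGMA \<sigma>:shuffles_perm ?m ?n. Pow (admissible_from ?m 1 (?zs \<sigma>)))"
    by (auto simp: mixable_shuffles_def admissible_pairs_eq simp del: upt_Suc)
  have word: "shuffle_word B x y \<sigma> T = contract B T 1 (map u (?zs \<sigma>))" for \<sigma> T
    by (simp add: shuffle_word_def u_def comp_def del: upt_Suc)
  have ui: "u i \<in> carrier B" if "i \<in> {1..?m + ?n}" for i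
  proof -
    have "u i \<in> set (x @ y)" unfolding u_def using that by (intro nth_mem) auto
    then show ?thesis using x y by auto
  qed
  have set: "set (?zs \<sigma>) = {1..?m + ?n}" if "\<sigma> \<in> shuffles_perm ?m ?n" for \<sigma>
  proof -
    have "set (?zs \<sigma>) = set [1..<?m + 1] \<union> set [?m + 1..<?m + ?n + 1]"
      by (rule set_shuffles) (rule bij_betwE[OF bij, rule_format, OF that])
    also have "\<dots> = {1..?m + ?n}" unfolding set_upt by auto
    finally show ?thesis .
  qed
  have us: "map u (?zs \<sigma>) \<in> letters" if "\<sigma> \<in> shuffles_perm ?m ?n" for \<sigma>
    unfolding in_lists_conv_set set_map[of u] set[OF that] using ui by blast
  note contract_mem = contract_closed[where X = "carrier B", OF mult_closed us]
  show fin_mix: "finite (mixable_shuffles ?m ?n)"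
    unfolding mix using fin admissible_from_finite by auto
  show "shuffle_word B x y \<sigma> T \<in> letters" if "(\<sigma>, T) \<in> mixable_shuffles ?m ?n" for \<sigma> T
    unfolding word using that by (intro contract_mem) (auto simp: mixable_shuffles_def)
  have map_u: "map u [1..<?m + 1] = x" "map u [?m + 1..<?m + ?n + 1] = y"
    by (rule nth_equalityI; auto simp: u_def nth_append simp del: upt_Suc)+
  have "finsum N (\<lambda>(\<sigma>, T). lam [^]\<^bsub>C\<^esub> card T \<odot>\<^bsub>N\<^esub> g (shuffle_word B x y \<sigma> T)) (mixable_shuffles ?m ?n)
      = (\<Oplus>\<^bsub>N\<^esub>\<sigma>\<in>shuffles_perm ?m ?n. \<Oplus>\<^bsub>N\<^esub>T\<in>Pow (admissible_from ?m 1 (?zs \<sigma>)).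
           lam [^]\<^bsub>C\<^esub> card T \<odot>\<^bsub>N\<^esub> g (contract B T 1 (map u (?zs \<sigma>))))"
    unfolding mix word case_prod_unfold
    by (rule N.M.finsum_Sigma[OF fin])
      (simp_all add: admissible_from_finite funcset_mem[OF g contract_mem] weight_closed
        del: upt_Suc map_map One_nat_def)
  also have "\<dots> = (\<Oplus>\<^bsub>N\<^esub>\<sigma>\<in>shuffles_perm ?m ?n. mergesum lam B N ?m u g (?zs \<sigma>))"
    by (intro N.M.finsum_cong'[OF refl] funcsetI mergesum_subsets[OF N _ g] mergesum_closed[OF N _ g])
      (use ui set in \<open>simp_all del: upt_Suc set_map\<close>)
  also have "\<dots> = (\<Oplus>\<^bsub>N\<^esub>zs\<in>?zs ` shuffles_perm ?m ?n. mergesum lam B N ?m u g zs)"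
  proof (rule N.M.finsum_reindex[symmetric])
    show "mergesum lam B N ?m u g \<in> ?zs ` shuffles_perm ?m ?n \<rightarrow> carrier N"
      using ui set by (auto simp del: upt_Suc set_map intro!: mergesum_closed[OF N _ g])
    show "inj_on ?zs (shuffles_perm ?m ?n)" using bij by (simp only: bij_betw_def)
  qed
  also have "?zs ` shuffles_perm ?m ?n = ?S"
    using bij by (simp only: bij_betw_def)
  also have "(\<Oplus>\<^bsub>N\<^esub>zs\<in>?S. mergesum lam B N ?m u g zs)
      = mixsum lam B N g (map u [1..<?m + 1]) (map u [?m + 1..<?m + ?n + 1])"
    by (rule mergesum_shuffles[OF N _ g]) (use ui in auto)
  finally show "finsum N (\<lambda>(\<sigma>, T). lam [^]\<^bsub>C\<^esub> card T \<odot>\<^bsub>N\<^esub> g (shuffle_word B x y \<sigma> T))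
      (mixable_shuffles ?m ?n) = mixsum lam B N g x y"
    unfolding map_u .
qed

section \<open>Quotients and subalgebras of Baxter algebras\<close>

lemma module_transfer:
  fixes M N :: "('c, 'a, 'n) module_scheme"
  assumes "module C M" "carrier N = carrier M" "add N = add M" "zero N = zero M" "smult N = smult M"
  shows "module C N"
  using assms
  by (simp add: module_def module_axioms_def abelian_group_def abelian_monoid_def abelian_group_axioms_def)

lemma submodule_transfer:
  fixes M N :: "('c, 'a, 'n) module_scheme"
  assumes "submodule H C M" "carrier N = carrier M" "add N = add M" "zero N = zero M" "smult N = smult M"
  shows "submodule H C N"
  using assms by (simp add: submodule_def submodule_axioms_def)

text \<open>The operations are those used for the shuffle algebra, for an arbitrary algebra and submodule.\<close>
definition coset_algebra ::
    "('c, 'a, 'n) module_scheme \<Rightarrow> 'a set \<Rightarrow> ('c, 'a set) module" where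
  "coset_algebra F I =
    \<lparr>carrier = a_rcosets\<^bsub>F\<^esub> I, monoid.mult = rcoset_mult F I,
      one = I +>\<^bsub>F\<^esub> \<one>\<^bsub>F\<^esub>, zero = I, add = set_add F,
      smult = (\<lambda>c X. \<Union>f\<in>X. I +>\<^bsub>F\<^esub> (c \<odot>\<^bsub>F\<^esub> f))\<rparr>"

definition coset_map ::
    "('a, 'n) ring_scheme \<Rightarrow> 'a set \<Rightarrow> ('a \<Rightarrow> 'a) \<Rightarrow> 'a set \<Rightarrow> 'a set" where
  "coset_map F I P X = (\<Union>f\<in>X. I +>\<^bsub>F\<^esub> P f)"

locale quotient_module = module C F for C (structure) and F (structure) +
  fixes I
  assumes submodule: "submodule I C F"
begin

abbreviation coset where "coset f \<equiv> I +>\<^bsub>F\<^esub> f"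
abbreviation "Q \<equiv> coset_algebra F I"

lemma abelian_subgroup: "abelian_subgroup I F"
  using submodule.axioms(1)[OF submodule]
  by (intro abelian_subgroupI3 additive_subgroupI M.abelian_group_axioms)

lemma ideal_subset: "I \<subseteq> carrier F" by (rule submoduleE(1)[OF submodule])

lemma mem_coset: "f \<in> carrier F \<Longrightarrow> f \<in> coset f"
  using abelian_subgroup.a_rcos_self[OF abelian_subgroup] by simp

lemma mem_coset_iff:
  assumes "g \<in> carrier F"
  shows "f \<in> coset g \<longleftrightarrow> f \<in> carrier F \<and> coset f = coset g"
  using assms mem_coset M.a_r_coset_subset_G[OF ideal_subset]
    M.a_repr_independence[OF _ _ submodule.axioms(1)[OF submodule]]
  by blast

lemma coset_eq_iff:
  assumes "f \<in> carrier F" "g \<in> carrier F"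
  shows "coset f = coset g \<longleftrightarrow> f \<ominus>\<^bsub>F\<^esub> g \<in> I"
  using abelian_subgroup.a_rcos_module[OF abelian_subgroup assms(2,1)] mem_coset_iff[OF assms(2)] assms(1)
  by (simp add: a_minus_def)

lemma mem_cosetD:
  assumes "f \<in> coset g" "g \<in> carrier F"
  shows "f \<in> carrier F" "f \<ominus>\<^bsub>F\<^esub> g \<in> I"
  using assms by (auto simp: mem_coset_iff coset_eq_iff)

lemma coset_carrier: "carrier Q = coset ` carrier F"
  by (auto simp: coset_algebra_def A_RCOSETS_def')

lemma coset_closed: "f \<in> carrier F \<Longrightarrow> coset f \<in> carrier Q"
  by (simp add: coset_carrier)

lemma coset_zero: "\<zero>\<^bsub>Q\<^esub> = coset \<zero>\<^bsub>F\<^esub>"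
  by (simp add: coset_algebra_def ideal_subset)

lemma coset_add:
  assumes "f \<in> carrier F" "g \<in> carrier F"
  shows "coset f \<oplus>\<^bsub>Q\<^esub> coset g = coset (f \<oplus>\<^bsub>F\<^esub> g)"
  using abelian_subgroup.a_rcos_sum[OF abelian_subgroup] assms by (simp add: coset_algebra_def)

lemma coset_map_coset:
  assumes P: "P \<in> linear_maps C F F" "\<And>h. h \<in> I \<Longrightarrow> P h \<in> I" and f: "f \<in> carrier F"
  shows "coset_map F I P (coset f) = coset (P f)"
proof -
  have "coset (P g) = coset (P f)" if "g \<in> coset f" for g
  proof -
    have g: "g \<in> carrier F" "g \<ominus>\<^bsub>F\<^esub> f \<in> I" using mem_cosetD[OF that f] by simp_all
    have "P g \<ominus>\<^bsub>F\<^esub> P f = P (g \<ominus>\<^bsub>F\<^esub> f)"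
      using g f by (intro linear_minus[symmetric, OF module_axioms module_axioms P(1)])
    then show ?thesis using g f P(2) linear_closed[OF P(1)] by (simp add: coset_eq_iff)
  qed
  moreover have "f \<in> coset f" using f by (rule mem_coset)
  ultimately show ?thesis unfolding coset_map_def by blast
qed

lemma smult_linear: "c \<in> carrier C \<Longrightarrow> (\<lambda>f. c \<odot>\<^bsub>F\<^esub> f) \<in> linear_maps C F F"
  by (rule linear_mapsI) (simp_all add: smult_r_distr smult_lcomm[of c])

lemma coset_smult:
  assumes "c \<in> carrier C" "f \<in> carrier F"
  shows "c \<odot>\<^bsub>Q\<^esub> coset f = coset (c \<odot>\<^bsub>F\<^esub> f)"
  using coset_map_coset[OF smult_linear[OF assms(1)] _ assms(2)] submoduleE(4)[OF submodule assms(1)]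
  by (simp add: coset_algebra_def coset_map_def)

lemma quotient_cases:
  assumes "X \<in> carrier Q"
  obtains f where "f \<in> carrier F" "X = coset f"
  using assms by (auto simp: coset_carrier)

lemma quotient_is_module: "module C Q"
proof (rule moduleI)
  show "abelian_group Q"
  proof (rule abelian_groupI)
    fix X assume "X \<in> carrier Q"
    then obtain f where f: "f \<in> carrier F" "X = coset f" by (auto simp: coset_carrier)
    then show "\<exists>Y\<in>carrier Q. Y \<oplus>\<^bsub>Q\<^esub> X = \<zero>\<^bsub>Q\<^esub>"
      by (intro bexI[of _ "coset (\<ominus>\<^bsub>F\<^esub> f)"]) (simp_all add: coset_add coset_zero coset_closed M.l_neg)
  qed (auto elim!: quotient_cases simp: coset_add coset_zero coset_closed M.a_ac)
qed (auto elim!: quotient_cases simp: coset_add coset_smult coset_closed smult_l_distr smult_r_distr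
    smult_assoc1 R.is_cring)

lemma coset_linear: "coset \<in> linear_maps C F Q"
  by (rule linear_mapsI) (simp_all add: coset_closed coset_add coset_smult)

text \<open>The value at a coset is taken at a chosen representative; the choice does not matter since \<open>h\<close>
  vanishes on \<open>I\<close>.\<close>
lemma linear_descends:
  assumes N: "module C N" and h: "h \<in> linear_maps C F N" and kernel: "\<And>f. f \<in> I \<Longrightarrow> h f = \<zero>\<^bsub>N\<^esub>"
  obtains k where "k \<in> linear_maps C Q N" "\<And>f. f \<in> carrier F \<Longrightarrow> k (coset f) = h f"
proof -
  interpret N: module C N by (rule N)
  define k where "k X = h (SOME f. f \<in> X)" for X
  have k: "k (coset f) = h f" if f: "f \<in> carrier F" for f
  proof -
    define g where "g = (SOME g. g \<in> coset f)"
    have "g \<in> coset f" unfolding g_def using mem_coset[OF f] by (rule someI)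
    then have g: "g \<in> carrier F" "g \<ominus>\<^bsub>F\<^esub> f \<in> I" using mem_cosetD f by blast+
    then have "h g \<ominus>\<^bsub>N\<^esub> h f = \<zero>\<^bsub>N\<^esub>"
      using linear_minus[OF module_axioms N h g(1) f] kernel by simp
    then have "\<ominus>\<^bsub>N\<^esub> (\<ominus>\<^bsub>N\<^esub> h f) = h g"
      using linear_closed[OF h] g f by (intro N.M.minus_equality) (simp_all add: a_minus_def)
    then show ?thesis
      using linear_closed[OF h] f by (simp add: k_def g_def[symmetric])
  qed
  show ?thesis
  proof (rule that[OF _ k])
    show "k \<in> linear_maps C Q N"
      by (rule linear_mapsI)
        (auto elim!: quotient_cases simp: coset_add coset_smult k linear_closed[OF h] linear_add[OF h] linear_smult[OF h])
  qed
qed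

lemma coset_mult:
  assumes F: "comm_algebra0 C F" and ideal: "\<And>h g. h \<in> I \<Longrightarrow> g \<in> carrier F \<Longrightarrow> h \<otimes>\<^bsub>F\<^esub> g \<in> I"
    and fg: "f \<in> carrier F" "g \<in> carrier F"
  shows "coset f \<otimes>\<^bsub>Q\<^esub> coset g = coset (f \<otimes>\<^bsub>F\<^esub> g)"
proof -
  interpret F: comm_algebra0 C F by (rule F)
  have left: "coset (f' \<otimes>\<^bsub>F\<^esub> h) = coset (f \<otimes>\<^bsub>F\<^esub> h)"
    if "f' \<in> coset f" "f \<in> carrier F" "h \<in> carrier F" for f f' h
  proof -
    have lin: "(\<lambda>x. x \<otimes>\<^bsub>F\<^esub> h) \<in> linear_maps C F F"
      by (rule linear_mapsI) (use that in \<open>simp_all add: F.mult_closed F.mult_distr F.smult_mult\<close>)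
    have f': "f' \<in> carrier F" "f' \<ominus>\<^bsub>F\<^esub> f \<in> I" using mem_cosetD that by blast+
    have "(f' \<otimes>\<^bsub>F\<^esub> h) \<ominus>\<^bsub>F\<^esub> (f \<otimes>\<^bsub>F\<^esub> h) = (f' \<ominus>\<^bsub>F\<^esub> f) \<otimes>\<^bsub>F\<^esub> h"
      using linear_minus[OF module_axioms module_axioms lin f'(1) that(2)] by simp
    then show ?thesis using f' that ideal by (simp add: coset_eq_iff F.mult_closed)
  qed
  have "coset (f' \<otimes>\<^bsub>F\<^esub> g') = coset (f \<otimes>\<^bsub>F\<^esub> g)" if "f' \<in> coset f" "g' \<in> coset g" for f' g'
  proof -
    have c: "f' \<in> carrier F" "g' \<in> carrier F" using that fg by (simp_all add: mem_coset_iff)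
    have "coset (f' \<otimes>\<^bsub>F\<^esub> g') = coset (g' \<otimes>\<^bsub>F\<^esub> f)"
      using left[OF that(1) fg(1) c(2)] fg c by (simp add: F.mult_comm)
    also have "\<dots> = coset (g \<otimes>\<^bsub>F\<^esub> f)" by (rule left[OF that(2) fg(2,1)])
    finally show ?thesis using fg by (simp add: F.mult_comm)
  qed
  moreover have "f \<in> coset f" "g \<in> coset g" using fg by (simp_all add: mem_coset)
  ultimately have "(\<Union>f'\<in>coset f. \<Union>g'\<in>coset g. coset (f' \<otimes>\<^bsub>F\<^esub> g')) = coset (f \<otimes>\<^bsub>F\<^esub> g)"
    by blast
  then show ?thesis by (simp add: coset_algebra_def rcoset_mult_def)
qed

lemma quotient_baxter:
  assumes F: "baxter_algebra0 C lam F P"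
    and ideal: "\<And>h g. h \<in> I \<Longrightarrow> g \<in> carrier F \<Longrightarrow> h \<otimes>\<^bsub>F\<^esub> g \<in> I" "\<And>h. h \<in> I \<Longrightarrow> P h \<in> I"
  shows "baxter_algebra0 C lam Q (coset_map F I P)"
proof -
  interpret F: baxter_algebra0 C lam F P by (rule F)
  note P = F.operator_linear
  note mult = coset_mult[OF F.comm_algebra0_axioms ideal(1)]
  note map = coset_map_coset[OF P ideal(2)]
  note Pc = linear_closed[OF P]
  show ?thesis
  proof (intro baxter_algebra0.intro comm_algebra0.intro quotient_is_module
      comm_algebra0_axioms.intro baxter_algebra0_axioms.intro)
    show "coset_map F I P \<in> linear_maps C Q Q"
      by (rule linear_mapsI)
        (auto elim!: quotient_cases simp: coset_add coset_smult coset_closed map Pc linear_add[OF P] linear_smult[OF P])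
    show "lam \<in> carrier C" by (rule F.weight_closed)
  next
    fix X Y assume "X \<in> carrier Q" "Y \<in> carrier Q"
    then obtain f g where fg: "f \<in> carrier F" "X = coset f" "g \<in> carrier F" "Y = coset g"
      by (auto simp: coset_carrier)
    show "X \<otimes>\<^bsub>Q\<^esub> Y \<in> carrier Q" "X \<otimes>\<^bsub>Q\<^esub> Y = Y \<otimes>\<^bsub>Q\<^esub> X"
      using fg by (simp_all add: mult coset_closed F.mult_closed F.mult_comm)
    show "coset_map F I P X \<otimes>\<^bsub>Q\<^esub> coset_map F I P Y
       = coset_map F I P (X \<otimes>\<^bsub>Q\<^esub> coset_map F I P Y) \<oplus>\<^bsub>Q\<^esub> coset_map F I P (Y \<otimes>\<^bsub>Q\<^esub> coset_map F I P X)
         \<oplus>\<^bsub>Q\<^esub> lam \<odot>\<^bsub>Q\<^esub> coset_map F I P (X \<otimes>\<^bsub>Q\<^esub> Y)"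
      using fg by (simp add: mult map Pc coset_add coset_smult F.mult_closed F.weight_closed F.baxter)
  next
    fix X Y Z assume "X \<in> carrier Q" "Y \<in> carrier Q" "Z \<in> carrier Q"
    then obtain f g h where "f \<in> carrier F" "X = coset f" "g \<in> carrier F" "Y = coset g"
      "h \<in> carrier F" "Z = coset h"
      by (auto simp: coset_carrier)
    then show "X \<otimes>\<^bsub>Q\<^esub> Y \<otimes>\<^bsub>Q\<^esub> Z = X \<otimes>\<^bsub>Q\<^esub> (Y \<otimes>\<^bsub>Q\<^esub> Z)"
      "(X \<oplus>\<^bsub>Q\<^esub> Y) \<otimes>\<^bsub>Q\<^esub> Z = X \<otimes>\<^bsub>Q\<^esub> Z \<oplus>\<^bsub>Q\<^esub> Y \<otimes>\<^bsub>Q\<^esub> Z"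
      by (simp_all add: mult coset_add F.mult_closed F.mult_assoc F.mult_distr)
  next
    fix c X Y assume "c \<in> carrier C" "X \<in> carrier Q" "Y \<in> carrier Q"
    then obtain f g where "f \<in> carrier F" "X = coset f" "g \<in> carrier F" "Y = coset g" "c \<in> carrier C"
      by (auto simp: coset_carrier)
    then show "c \<odot>\<^bsub>Q\<^esub> X \<otimes>\<^bsub>Q\<^esub> Y = c \<odot>\<^bsub>Q\<^esub> (X \<otimes>\<^bsub>Q\<^esub> Y)"
      by (simp add: mult coset_smult F.mult_closed F.smult_mult)
  qed
qed

end

lemma (in baxter_algebra0) subalgebra_baxter:
  assumes H: "submodule H C R"
    and mult: "\<And>x y. x \<in> H \<Longrightarrow> y \<in> H \<Longrightarrow> x \<otimes>\<^bsub>R\<^esub> y \<in> H" and P: "\<And>x. x \<in> H \<Longrightarrow> P x \<in> H"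
  shows "baxter_algebra0 C lam (R\<lparr>carrier := H\<rparr>) (restrict P H)"
proof -
  have mem: "x \<in> H \<Longrightarrow> x \<in> carrier R" for x using submoduleE(1)[OF H] by auto
  have Pl: "restrict P H \<in> linear_maps C (R\<lparr>carrier := H\<rparr>) (R\<lparr>carrier := H\<rparr>)"
    by (rule linear_mapsI)
      (use P submoduleE(4,5)[OF H] in
        \<open>simp_all add: mem linear_add[OF operator_linear] linear_smult[OF operator_linear]\<close>)
  have "comm_algebra0_axioms C (R\<lparr>carrier := H\<rparr>)"
    by (rule comm_algebra0_axioms.intro)
      (simp_all add: mem mult mult_assoc mult_distr smult_mult, simp add: mem mult_comm)
  moreover have "baxter_algebra0_axioms C lam (R\<lparr>carrier := H\<rparr>) (restrict P H)"
    by (rule baxter_algebra0_axioms.intro[OF weight_closed Pl]) (simp add: mem P mult baxter)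
  ultimately show ?thesis
    by (intro baxter_algebra0.intro comm_algebra0.intro
        submodule.submodule_is_module[OF H module_axioms])
qed

section \<open>The Baxter algebra of words\<close>

lemma words_iff: "w \<in> words B \<longleftrightarrow> w \<noteq> [] \<and> w \<in> lists (carrier B)"
  by (auto simp: words_def)

lemma wordsE:
  assumes "w \<in> words B"
  obtains a x where "w = a # x" "a \<in> carrier B" "x \<in> lists (carrier B)"
  using assms by (cases w) (auto simp: words_def)

lemma Cons_words: "a \<in> carrier B \<Longrightarrow> x \<in> lists (carrier B) \<Longrightarrow> a # x \<in> words B"
  by (auto simp: words_def)

definition word_op ::
    "('c, 'm) ring_scheme \<Rightarrow> ('c, 'b, 'n) module_scheme \<Rightarrow> ('b list \<Rightarrow> 'c) \<Rightarrow> 'b list \<Rightarrow> 'c" where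
  "word_op C B = lin_ext C (word_module C B) (\<lambda>w. basis_vec C (\<one>\<^bsub>B\<^esub> # w))"

lemma word_algebra_simps [simp]:
  "carrier (word_algebra C lam B) = carrier (word_module C B)"
  "add (word_algebra C lam B) = add (word_module C B)"
  "zero (word_algebra C lam B) = zero (word_module C B)"
  "smult (word_algebra C lam B) = smult (word_module C B)"
  by (simp_all add: word_algebra_def)

lemma linear_maps_word_algebra [simp]:
  "linear_maps C (word_algebra C lam B) N = linear_maps C (word_module C B) N"
  "linear_maps C N (word_algebra C lam B) = linear_maps C N (word_module C B)"
  by (simp_all add: linear_maps_def)

declare diamond.simps [simp del]

context weighted_algebra
begin

abbreviation "F \<equiv> word_module C B"
abbreviation word_mult (infixl "\<star>" 70) where "f \<star> g \<equiv> f \<otimes>\<^bsub>word_algebra C lam B\<^esub> g"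
abbreviation "e \<equiv> basis_vec C"

lemma word_module: "module C F"
  unfolding word_module_def by (rule R.free_module_module)

interpretation F: module C F by (rule word_module)

lemma e_closed: "w \<in> words B \<Longrightarrow> e w \<in> carrier F"
  unfolding word_module_def by (rule R.basis_vec_closed)

lemma e_Cons_closed: "a \<in> carrier B \<Longrightarrow> x \<in> letters \<Longrightarrow> e (a # x) \<in> carrier F"
  by (intro e_closed Cons_words)

lemma e_Cons_fun: "a \<in> carrier B \<Longrightarrow> (\<lambda>u. e (a # u)) \<in> letters \<rightarrow> carrier F"
  by (intro funcsetI e_Cons_closed)

lemma word_induct [consumes 1, case_names basis zero lincomb]:
  assumes "f \<in> carrier F"
    and "\<And>w. w \<in> words B \<Longrightarrow> Q (e w)" and "Q \<zero>\<^bsub>F\<^esub>"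
    and "\<And>c f g. \<lbrakk>c \<in> carrier C; f \<in> carrier F; g \<in> carrier F; Q f; Q g\<rbrakk>
      \<Longrightarrow> Q (c \<odot>\<^bsub>F\<^esub> f \<oplus>\<^bsub>F\<^esub> g)"
  shows "Q f"
  using assms unfolding word_module_def by (rule R.free_module_induct)

lemma word_lin_ext:
  assumes "module C N" "g \<in> words B \<rightarrow> carrier N"
  shows "lin_ext C N g \<in> linear_maps C F N" "\<And>w. w \<in> words B \<Longrightarrow> lin_ext C N g (e w) = g w"
  using module.lin_ext_linear[OF assms] module.lin_ext_basis[OF assms(1), of g] funcset_mem[OF assms(2)]
  unfolding word_module_def by auto

lemma word_linear_eq:
  assumes "module C N" "h \<in> linear_maps C F N" "k \<in> linear_maps C F N"
    and "\<And>w. w \<in> words B \<Longrightarrow> h (e w) = k (e w)" "f \<in> carrier F"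
  shows "h f = k f"
  using assms module.linear_eq_on_basis[OF assms(1)] unfolding word_module_def by blast

text \<open>If one of the two tails is empty, \<open>diamond\<close> treats the product separately; the recursion includes
  these cases.\<close>
lemma diamond_mixsum:
  assumes "a \<in> carrier B" "b \<in> carrier B" "x \<in> letters" "y \<in> letters"
  shows "diamond C lam B (a # x) (b # y) = mixsum lam B F (\<lambda>u. e ((a \<cdot> b) # u)) x y"
proof (cases "x = [] \<or> y = []")
  case True
  then show ?thesis by (auto simp: diamond.simps)
next
  case False
  have "(\<lambda>u. e ((a \<cdot> b) # u)) \<in> letters \<rightarrow> carrier F"
    using assms by (intro e_Cons_fun mult_closed)
  from mixsum_eq_mixable_shuffles(1)[OF word_module assms(3,4) this] False
  show ?thesis by (simp add: diamond.simps)
qed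

text \<open>All computations with products of words go through this lemma: a linear map is pushed inside the
  recursion, where it only meets basis vectors.\<close>
lemma linear_diamond:
  assumes N: "module C N" and k: "k \<in> linear_maps C F N"
    and "a \<in> carrier B" "b \<in> carrier B" "x \<in> letters" "y \<in> letters"
  shows "k (diamond C lam B (a # x) (b # y)) = mixsum lam B N (\<lambda>u. k (e ((a \<cdot> b) # u))) x y"
  using assms unfolding diamond_mixsum[OF assms(3-)]
  by (intro mixsum_linear[OF word_module N k] e_Cons_fun mult_closed)

lemma diamond_closed:
  assumes "v \<in> words B" "w \<in> words B"
  shows "diamond C lam B v w \<in> carrier F"
  using assms
  by (elim wordsE) (simp add: diamond_mixsum mixsum_closed[OF word_module] e_Cons_fun mult_closed)

lemma word_mult_eq:
  assumes f: "f \<in> carrier F" and g: "g \<in> carrier F"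
  shows "f \<star> g = lin_ext C F (\<lambda>v. lin_ext C F (diamond C lam B v) g) f"
proof -
  have fc: "f v \<in> carrier C" "g v \<in> carrier C" for v
    using f g by (auto simp: word_module_def free_module_carrier)
  have sub: "finite (supp C f)" "finite (supp C g)" "v \<in> supp C f \<Longrightarrow> v \<in> words B"
    "v \<in> supp C g \<Longrightarrow> v \<in> words B" for v
    using f g by (auto simp: word_module_def free_module_carrier)
  have inner: "(\<Oplus>\<^bsub>F\<^esub>w\<in>supp C g. (f v \<otimes>\<^bsub>C\<^esub> g w) \<odot>\<^bsub>F\<^esub> diamond C lam B v w)
      = f v \<odot>\<^bsub>F\<^esub> lin_ext C F (diamond C lam B v) g" if v: "v \<in> supp C f" for v
  proof -
    have "(\<Oplus>\<^bsub>F\<^esub>w\<in>supp C g. (f v \<otimes>\<^bsub>C\<^esub> g w) \<odot>\<^bsub>F\<^esub> diamond C lam B v w)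
        = (\<Oplus>\<^bsub>F\<^esub>w\<in>supp C g. f v \<odot>\<^bsub>F\<^esub> (g w \<odot>\<^bsub>F\<^esub> diamond C lam B v w))"
      by (intro F.M.finsum_cong'[OF refl] funcsetI)
        (use sub v diamond_closed in \<open>simp_all add: fc F.smult_assoc1\<close>)
    also have "\<dots> = f v \<odot>\<^bsub>F\<^esub> lin_ext C F (diamond C lam B v) g"
      unfolding lin_ext_def using sub v diamond_closed
      by (intro F.finsum_smult_ldistr[symmetric] funcsetI) (simp_all add: fc)
    finally show ?thesis .
  qed
  have closed: "lin_ext C F (diamond C lam B v) g \<in> carrier F" if "v \<in> words B" for v
    using that g diamond_closed by (intro linear_closed[OF word_lin_ext(1)[OF word_module]]) auto
  have "f \<star> g = (\<Oplus>\<^bsub>F\<^esub>v\<in>supp C f. \<Oplus>\<^bsub>F\<^esub>w\<in>supp C g. (f v \<otimes>\<^bsub>C\<^esub> g w) \<odot>\<^bsub>F\<^esub> diamond C lam B v w)"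
    by (simp add: word_algebra_def)
  also have "\<dots> = lin_ext C F (\<lambda>v. lin_ext C F (diamond C lam B v) g) f"
    unfolding lin_ext_def[of C F "\<lambda>v. lin_ext C F (diamond C lam B v) g"]
    by (intro F.M.finsum_cong'[OF refl] funcsetI inner)
      (use closed sub in \<open>auto simp: fc\<close>)
  finally show ?thesis .
qed

lemma diamond_ext_linear:
  assumes "v \<in> words B"
  shows "lin_ext C F (diamond C lam B v) \<in> linear_maps C F F"
  using assms diamond_closed by (intro word_lin_ext(1)[OF word_module]) auto

lemma diamond_ext_fun:
  assumes "g \<in> carrier F"
  shows "(\<lambda>v. lin_ext C F (diamond C lam B v) g) \<in> words B \<rightarrow> carrier F"
  using assms linear_closed[OF diamond_ext_linear] by auto

lemma word_mult_linear_left: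
  assumes g: "g \<in> carrier F"
  shows "(\<lambda>f. f \<star> g) \<in> linear_maps C F F"
  by (rule linear_cong[OF word_module word_lin_ext(1)[OF word_module diamond_ext_fun[OF g]]])
    (simp add: word_mult_eq g)

lemma word_mult_basis_left:
  assumes v: "v \<in> words B" and g: "g \<in> carrier F"
  shows "e v \<star> g = lin_ext C F (diamond C lam B v) g"
  using word_lin_ext(2)[OF word_module diamond_ext_fun[OF g] v] by (simp add: word_mult_eq e_closed v g)

lemma word_mult_basis:
  assumes "v \<in> words B" "w \<in> words B"
  shows "e v \<star> e w = diamond C lam B v w"
  unfolding word_mult_basis_left[OF assms(1) e_closed[OF assms(2)]]
  by (rule word_lin_ext(2)[OF word_module]) (use assms diamond_closed in auto)

lemma word_mult_linear_right:
  assumes f: "f \<in> carrier F"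
  shows "(\<lambda>g. f \<star> g) \<in> linear_maps C F F"
  using f
proof (induction rule: word_induct)
  case (basis v)
  show ?case
    by (rule linear_cong[OF word_module diamond_ext_linear[OF basis]]) (simp add: word_mult_basis_left basis)
next
  case zero
  have "(\<lambda>g. \<zero>\<^bsub>F\<^esub>) \<in> linear_maps C F F" by (rule linear_mapsI) simp_all
  then show ?case
    by (rule linear_cong[OF word_module])
      (rule linear_zero[OF word_module word_module word_mult_linear_left])
next
  case (lincomb c f f')
  show ?case
    by (rule linear_cong[OF word_module linear_lincomb[OF word_module word_module lincomb(4,5,1)]])
      (use lincomb in \<open>simp add: linear_add[OF word_mult_linear_left] linear_smult[OF word_mult_linear_left]\<close>)
qed

lemma word_mult_closed: "f \<in> carrier F \<Longrightarrow> g \<in> carrier F \<Longrightarrow> f \<star> g \<in> carrier F"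
  by (rule linear_closed[OF word_mult_linear_left])

lemma word_mult_comm:
  assumes f: "f \<in> carrier F" and g: "g \<in> carrier F"
  shows "f \<star> g = g \<star> f"
proof -
  have "e v \<star> e w = e w \<star> e v" if vw: "v \<in> words B" "w \<in> words B" for v w
  proof -
    obtain a x b y where v: "v = a # x" "a \<in> carrier B" "x \<in> letters"
      and w: "w = b # y" "b \<in> carrier B" "y \<in> letters" using vw by (elim wordsE) auto
    show ?thesis
      using vw mixsum_commute[OF word_module v(3) w(3) e_Cons_fun[OF mult_closed[OF v(2) w(2)]]]
        mult_comm[OF v(2) w(2)]
      by (simp add: word_mult_basis diamond_mixsum v w)
  qed
  then have "e v \<star> g = g \<star> e v" if "v \<in> words B" for v
    using word_linear_eq[OF word_module word_mult_linear_right word_mult_linear_left _ g] that e_closed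
    by blast
  then show ?thesis
    using word_linear_eq[OF word_module word_mult_linear_left word_mult_linear_right _ f] g by blast
qed

text \<open>On basis vectors this is \<open>mixsum_assoc\<close> for the tails; both sides are linear in each factor.\<close>
lemma word_mult_assoc:
  assumes f: "f \<in> carrier F" and g: "g \<in> carrier F" and h: "h \<in> carrier F"
  shows "(f \<star> g) \<star> h = f \<star> (g \<star> h)"
proof -
  note L = word_mult_linear_left and Rt = word_mult_linear_right
  have 1: "(e u \<star> e v) \<star> e w = e u \<star> (e v \<star> e w)"
    if uvw: "u \<in> words B" "v \<in> words B" "w \<in> words B" for u v w
  proof -
    obtain a x b y c z where u: "u = a # x" "a \<in> carrier B" "x \<in> letters"
      and v: "v = b # y" "b \<in> carrier B" "y \<in> letters"
      and w: "w = c # z" "c \<in> carrier B" "z \<in> letters" using uvw by (elim wordsE) auto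
    have ab: "a \<cdot> b \<in> carrier B" "b \<cdot> c \<in> carrier B" "a \<cdot> b \<cdot> c \<in> carrier B"
      using u v w by (simp_all add: mult_closed)
    let ?g = "\<lambda>t. e ((a \<cdot> b \<cdot> c) # t)"
    have "(e u \<star> e v) \<star> e w = mixsum lam B F (\<lambda>s. e ((a \<cdot> b) # s) \<star> e w) x y"
      unfolding word_mult_basis[OF uvw(1,2)] unfolding u(1) v(1)
      by (rule linear_diamond[OF word_module L[OF e_closed[OF uvw(3)]] u(2) v(2) u(3) v(3)])
    also have "\<dots> = mixsum lam B F (\<lambda>s. mixsum lam B F ?g s z) x y"
      by (rule mixsum_cong[OF word_module u(3) v(3)])
        (use ab uvw w in \<open>simp add: word_mult_basis Cons_words diamond_mixsum\<close>)
    also have "\<dots> = mixsum lam B F (\<lambda>s. mixsum lam B F ?g x s) y z"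
      by (rule mixsum_assoc[OF word_module u(3) v(3) w(3) e_Cons_fun[OF ab(3)]])
    also have "\<dots> = mixsum lam B F (\<lambda>s. e u \<star> e ((b \<cdot> c) # s)) y z"
      by (rule mixsum_cong[OF word_module v(3) w(3)])
        (use ab uvw u v(2) w(2) in \<open>simp add: word_mult_basis Cons_words diamond_mixsum mult_assoc\<close>)
    also have "\<dots> = e u \<star> (e v \<star> e w)"
      unfolding word_mult_basis[OF uvw(2,3)] unfolding v(1) w(1)
      by (rule linear_diamond[OF word_module Rt[OF e_closed[OF uvw(1)]] v(2) w(2) v(3) w(3), symmetric])
    finally show ?thesis .
  qed
  have 2: "(e u \<star> e v) \<star> h = e u \<star> (e v \<star> h)" if "u \<in> words B" "v \<in> words B" for u v
    using that 1 e_closed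
      word_linear_eq[OF word_module Rt linear_compose[OF Rt Rt], of "e u \<star> e v" "e v" "e u" h] h
    by (simp add: word_mult_closed)
  have 3: "(e u \<star> g) \<star> h = e u \<star> (g \<star> h)" if "u \<in> words B" for u
    using that 2 e_closed
      word_linear_eq[OF word_module linear_compose[OF Rt L] linear_compose[OF L Rt], of "e u" h h "e u" g] g h
    by simp
  show ?thesis
    using 3 word_linear_eq[OF word_module linear_compose[OF L L] L, of g h "g \<star> h" f] f g h
    by (simp add: word_mult_closed)
qed

lemma word_algebra_comm_algebra: "comm_algebra0 C (word_algebra C lam B)"
proof (intro comm_algebra0.intro comm_algebra0_axioms.intro)
  show "module C (word_algebra C lam B)"
    by (rule module_transfer[OF word_module]) simp_all
qed (simp_all add: word_mult_closed word_mult_assoc linear_add[OF word_mult_linear_left]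
    linear_smult[OF word_mult_linear_left], rule word_mult_comm)

end

locale unital_weighted_algebra = weighted_algebra +
  assumes one_closed: "\<one>\<^bsub>B\<^esub> \<in> carrier B"
    and one_mult: "a \<in> carrier B \<Longrightarrow> \<one>\<^bsub>B\<^esub> \<cdot> a = a"
begin

interpretation F: module C F by (rule word_module)

abbreviation "op \<equiv> word_op C B"

lemma op_linear: "op \<in> linear_maps C F F"
  unfolding word_op_def
  by (intro word_lin_ext(1)[OF word_module] funcsetI e_closed) (auto simp: words_iff one_closed)

lemma op_basis: "w \<in> words B \<Longrightarrow> op (e w) = e (\<one>\<^bsub>B\<^esub> # w)"
  unfolding word_op_def
  by (intro word_lin_ext(2)[OF word_module] funcsetI e_closed) (auto simp: words_iff one_closed)

lemma mult_one: "a \<in> carrier B \<Longrightarrow> a \<cdot> \<one>\<^bsub>B\<^esub> = a"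
  using one_closed by (simp add: mult_comm[of a] one_mult)

lemma op_mult_op_basis:
  assumes vw: "v \<in> words B" "w \<in> words B"
  shows "op (e v \<star> op (e w)) = mixsum lam B F (\<lambda>u. e (\<one>\<^bsub>B\<^esub> # hd v # u)) (tl v) w"
proof -
  obtain a x where v: "v = a # x" "a \<in> carrier B" "x \<in> letters" using vw by (elim wordsE)
  have w: "w \<in> letters" using vw by (simp add: words_iff)
  have "op (e v \<star> op (e w)) = op (diamond C lam B (a # x) (\<one>\<^bsub>B\<^esub> # w))"
    using vw w by (simp add: op_basis word_mult_basis Cons_words one_closed v)
  also have "\<dots> = mixsum lam B F (\<lambda>u. op (e ((a \<cdot> \<one>\<^bsub>B\<^esub>) # u))) x w"
    by (rule linear_diamond[OF word_module op_linear v(2) one_closed v(3) w])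
  also have "\<dots> = mixsum lam B F (\<lambda>u. e (\<one>\<^bsub>B\<^esub> # a # u)) x w"
    by (rule mixsum_cong[OF word_module v(3) w]) (use v in \<open>simp add: mult_one op_basis Cons_words\<close>)
  finally show ?thesis using v by simp
qed

text \<open>The first letters of \<open>1 v\<close> and \<open>1 w\<close> multiply to \<open>1\<close>, so the product of these words is \<open>1\<close> followed by
  \<open>v * w\<close>.  The three summands of the recursion for \<open>v * w\<close> are the three terms of the Baxter identity.\<close>
lemma baxter_basis:
  assumes vw: "v \<in> words B" "w \<in> words B"
  shows "op (e v) \<star> op (e w)
    = op (e v \<star> op (e w)) \<oplus>\<^bsub>F\<^esub> op (e w \<star> op (e v)) \<oplus>\<^bsub>F\<^esub> lam \<odot>\<^bsub>F\<^esub> op (e v \<star> e w)"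
proof -
  obtain a x b y where v: "v = a # x" "a \<in> carrier B" "x \<in> letters"
    and w: "w = b # y" "b \<in> carrier B" "y \<in> letters" using vw by (elim wordsE) auto
  have vl: "v \<in> letters" "w \<in> letters" using vw by (simp_all add: words_iff)
  have ab: "a \<cdot> b \<in> carrier B" using v w by (simp add: mult_closed)
  have "op (e v) \<star> op (e w) = mixsum lam B F (\<lambda>u. e ((\<one>\<^bsub>B\<^esub> \<cdot> \<one>\<^bsub>B\<^esub>) # u)) v w"
    using vw vl one_closed by (simp add: op_basis word_mult_basis Cons_words diamond_mixsum)
  also have "\<dots> = mixsum lam B F (\<lambda>u. e (\<one>\<^bsub>B\<^esub> # a # u)) x w
      \<oplus>\<^bsub>F\<^esub> mixsum lam B F (\<lambda>u. e (\<one>\<^bsub>B\<^esub> # b # u)) v y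
      \<oplus>\<^bsub>F\<^esub> lam \<odot>\<^bsub>F\<^esub> mixsum lam B F (\<lambda>u. e (\<one>\<^bsub>B\<^esub> # (a \<cdot> b) # u)) x y"
    by (simp add: v w one_mult[OF one_closed])
  also have "mixsum lam B F (\<lambda>u. e (\<one>\<^bsub>B\<^esub> # a # u)) x w = op (e v \<star> op (e w))"
    using op_mult_op_basis[OF vw] v by simp
  also have "mixsum lam B F (\<lambda>u. e (\<one>\<^bsub>B\<^esub> # b # u)) v y = op (e w \<star> op (e v))"
    using op_mult_op_basis[OF vw(2,1)] w vl v
      mixsum_commute[OF word_module vl(1) w(3) Cons_fun[OF e_Cons_fun[OF one_closed] w(2)]] by simp
  also have "mixsum lam B F (\<lambda>u. e (\<one>\<^bsub>B\<^esub> # (a \<cdot> b) # u)) x y = op (e v \<star> e w)"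
  proof -
    have "op (e v \<star> e w) = mixsum lam B F (\<lambda>u. op (e ((a \<cdot> b) # u))) x y"
      unfolding word_mult_basis[OF vw] unfolding v(1) w(1)
      by (rule linear_diamond[OF word_module op_linear v(2) w(2) v(3) w(3)])
    also have "\<dots> = mixsum lam B F (\<lambda>u. e (\<one>\<^bsub>B\<^esub> # (a \<cdot> b) # u)) x y"
      by (rule mixsum_cong[OF word_module v(3) w(3)]) (use ab in \<open>simp add: op_basis Cons_words\<close>)
    finally show ?thesis by simp
  qed
  finally show ?thesis .
qed

lemma op_closed: "f \<in> carrier F \<Longrightarrow> op f \<in> carrier F"
  by (rule linear_closed[OF op_linear])

lemma word_algebra_baxter: "baxter_algebra0 C lam (word_algebra C lam B) op"
proof (intro baxter_algebra0.intro baxter_algebra0_axioms.intro word_algebra_comm_algebra weight_closed)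
  show "op \<in> linear_maps C (word_algebra C lam B) (word_algebra C lam B)"
    by (simp add: op_linear)
next
  fix f g assume "f \<in> carrier (word_algebra C lam B)" "g \<in> carrier (word_algebra C lam B)"
  then have f: "f \<in> carrier F" and g: "g \<in> carrier F" by simp_all
  note L = word_mult_linear_left and Rt = word_mult_linear_right and P = op_linear
    and comp = linear_compose and M = word_module
  have 1: "op (e v) \<star> op g
      = op (e v \<star> op g) \<oplus>\<^bsub>F\<^esub> op (g \<star> op (e v)) \<oplus>\<^bsub>F\<^esub> lam \<odot>\<^bsub>F\<^esub> op (e v \<star> g)"
    if v: "v \<in> words B" for v
    using word_linear_eq[OF M comp[OF P Rt]
        linear_sum[OF M M linear_sum[OF M M comp[OF P comp[OF Rt P]] comp[OF L P]]
          linear_scaled[OF M M comp[OF Rt P] weight_closed]],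
        of "op (e v)" "e v" "op (e v)" "e v" g]
      baxter_basis[OF v] e_closed[OF v] g
    by (simp add: op_closed)
  have "op f \<star> op g = op (f \<star> op g) \<oplus>\<^bsub>F\<^esub> op (g \<star> op f) \<oplus>\<^bsub>F\<^esub> lam \<odot>\<^bsub>F\<^esub> op (f \<star> g)"
    using word_linear_eq[OF M comp[OF P L]
        linear_sum[OF M M linear_sum[OF M M comp[OF L P] comp[OF P comp[OF Rt P]]]
          linear_scaled[OF M M comp[OF L P] weight_closed]],
        of "op g" "op g" g g f] 1 f g
    by (simp add: op_closed)
  then show "op f \<star> op g = op (f \<star> op g) \<oplus>\<^bsub>word_algebra C lam B\<^esub> op (g \<star> op f)
      \<oplus>\<^bsub>word_algebra C lam B\<^esub> lam \<odot>\<^bsub>word_algebra C lam B\<^esub> op (f \<star> g)" by simp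
qed

end

section \<open>The shuffle Baxter algebra\<close>

context weighted_algebra
begin

interpretation F: module C F by (rule word_module)

abbreviation "I \<equiv> tensor_ideal C B"
abbreviation "tensor \<equiv> pure_tensor C B"
abbreviation "ShB \<equiv> Sh C lam B"

lemma in_words [simp]: "us @ a # vs \<in> words B \<longleftrightarrow> us \<in> letters \<and> a \<in> carrier B \<and> vs \<in> letters"
  by (auto simp: words_iff)

lemma relationsE [consumes 1, case_names add smult]:
  assumes "x \<in> multilinear_relations C B"
  obtains us vs a b where "us \<in> letters" "vs \<in> letters" "a \<in> carrier B" "b \<in> carrier B"
      "x = e (us @ (a \<oplus>\<^bsub>B\<^esub> b) # vs) \<ominus>\<^bsub>F\<^esub> (e (us @ a # vs) \<oplus>\<^bsub>F\<^esub> e (us @ b # vs))"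
    | us vs a c where "us \<in> letters" "vs \<in> letters" "a \<in> carrier B" "c \<in> carrier C"
      "x = e (us @ (c \<odot>\<^bsub>B\<^esub> a) # vs) \<ominus>\<^bsub>F\<^esub> c \<odot>\<^bsub>F\<^esub> e (us @ a # vs)"
  using assms unfolding multilinear_relations_def
proof (elim UnE CollectE exE conjE)
  fix us vs a b
  assume "x = e (us @ [a \<oplus>\<^bsub>B\<^esub> b] @ vs) \<ominus>\<^bsub>F\<^esub> (e (us @ [a] @ vs) \<oplus>\<^bsub>F\<^esub> e (us @ [b] @ vs))"
    "set us \<subseteq> carrier B" "set vs \<subseteq> carrier B" "a \<in> carrier B" "b \<in> carrier B"
  then show thesis by (intro that(1)[of us vs a b]) auto
next
  fix us vs c a
  assume "x = e (us @ [c \<odot>\<^bsub>B\<^esub> a] @ vs) \<ominus>\<^bsub>F\<^esub> c \<odot>\<^bsub>F\<^esub> e (us @ [a] @ vs)"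
    "set us \<subseteq> carrier B" "set vs \<subseteq> carrier B" "c \<in> carrier C" "a \<in> carrier B"
  then show thesis by (intro that(2)[of us vs a c]) auto
qed

lemma relations_closed: "multilinear_relations C B \<subseteq> carrier F"
proof
  fix x assume "x \<in> multilinear_relations C B"
  then show "x \<in> carrier F"
  proof (cases rule: relationsE)
    case (add us vs a b)
    then have "us @ (a \<oplus>\<^bsub>B\<^esub> b) # vs \<in> words B" "us @ a # vs \<in> words B" "us @ b # vs \<in> words B"
      by simp_all
    then show ?thesis unfolding add(5) by (intro F.M.minus_closed F.M.a_closed e_closed)
  next
    case (smult us vs a c)
    then have "us @ (c \<odot>\<^bsub>B\<^esub> a) # vs \<in> words B" "us @ a # vs \<in> words B"
      by simp_all
    then show ?thesis unfolding smult(5) by (intro F.M.minus_closed F.smult_closed smult(4) e_closed)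
  qed
qed

lemma ideal_submodule: "submodule I C F"
  unfolding tensor_ideal_def by (rule F.submodule_gen_submodule[OF relations_closed])

lemma ideal_submodule_algebra: "submodule I C (word_algebra C lam B)"
  by (rule submodule_transfer[OF ideal_submodule]) simp_all

text \<open>The universal property of the tensor powers: multilinear functions factor through the quotient by the
  relations.\<close>
lemma lin_ext_multilinear_ideal:
  assumes N: "module C N" and g: "g \<in> words B \<rightarrow> carrier N" and ml: "multilinear C B N g" and f: "f \<in> I"
  shows "lin_ext C N g f = \<zero>\<^bsub>N\<^esub>"
proof -
  interpret N: module C N by (rule N)
  note L = word_lin_ext[OF N g]
  note minus = linear_minus[OF word_module N L(1)]
  have gc: "g w \<in> carrier N" if "w \<in> words B" for w using g that by auto
  show ?thesis using f unfolding tensor_ideal_def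
  proof (induction rule: F.submodule_gen_induct[OF _ relations_closed, consumes 1])
    case (1 x)
    then show ?case
    proof (cases rule: relationsE)
      case (add us vs a b)
      have "g (us @ (a \<oplus>\<^bsub>B\<^esub> b) # vs) = g (us @ a # vs) \<oplus>\<^bsub>N\<^esub> g (us @ b # vs)"
        using multilinearD[OF ml add(1-4) R.one_closed] add gc by simp
      then have "lin_ext C N g x = lin_ext C N g (e (us @ (a \<oplus>\<^bsub>B\<^esub> b) # vs))
          \<ominus>\<^bsub>N\<^esub> lin_ext C N g (e (us @ (a \<oplus>\<^bsub>B\<^esub> b) # vs))"
        using add by (simp add: minus linear_add[OF L(1)] L(2) e_closed)
      also have "\<dots> = \<zero>\<^bsub>N\<^esub>" using add gc by (simp add: L(2) N.M.r_neg a_minus_def)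
      finally show ?thesis .
    next
      case (smult us vs a c)
      \<comment> \<open>Homogeneity is the case \<open>b = 0\<close> of the law for \<open>c a + b\<close>, once \<open>g\<close> is known to vanish at a word with a letter \<open>0\<close>.\<close>
      have "g (us @ \<zero>\<^bsub>B\<^esub> # vs) \<oplus>\<^bsub>N\<^esub> g (us @ \<zero>\<^bsub>B\<^esub> # vs) = g (us @ \<zero>\<^bsub>B\<^esub> # vs)"
        using multilinearD[OF ml smult(1,2) M.zero_closed M.zero_closed R.one_closed] smult gc by simp
      then have "g (us @ \<zero>\<^bsub>B\<^esub> # vs) = \<zero>\<^bsub>N\<^esub>"
        using gc[of "us @ \<zero>\<^bsub>B\<^esub> # vs"] smult by simp
      then have "g (us @ (c \<odot>\<^bsub>B\<^esub> a) # vs) = c \<odot>\<^bsub>N\<^esub> g (us @ a # vs)"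
        using multilinearD[OF ml smult(1-3) M.zero_closed smult(4)] smult gc by simp
      then have "lin_ext C N g x = lin_ext C N g (e (us @ (c \<odot>\<^bsub>B\<^esub> a) # vs))
          \<ominus>\<^bsub>N\<^esub> lin_ext C N g (e (us @ (c \<odot>\<^bsub>B\<^esub> a) # vs))"
        using smult by (simp add: minus linear_smult[OF L(1)] L(2) e_closed)
      also have "\<dots> = \<zero>\<^bsub>N\<^esub>" using smult gc by (simp add: L(2) N.M.r_neg a_minus_def)
      finally show ?thesis .
    qed
  next
    case 2
    show ?case by (rule linear_zero[OF word_module N L(1)])
  next
    case (3 c x y)
    then show ?case by (simp add: linear_add[OF L(1)] linear_smult[OF L(1)])
  qed
qed

lemma quotient: "quotient_module C (word_algebra C lam B) I"
proof (rule quotient_module.intro)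
  show "module C (word_algebra C lam B)"
    by (rule module_transfer[OF word_module]) simp_all
qed (simp add: quotient_module_axioms_def ideal_submodule_algebra)

interpretation Q: quotient_module C "word_algebra C lam B" I by (rule quotient)

lemma coset_word_algebra:
  "a_r_coset (word_algebra C lam B) = a_r_coset F"
  by (simp add: a_r_coset_def fun_eq_iff r_coset_def)

lemma Sh_eq: "ShB = coset_algebra (word_algebra C lam B) I"
  by (simp add: Sh_def coset_algebra_def Let_def)

lemma tensor_eq: "tensor w = Q.coset (e w)"
  by (simp add: pure_tensor_def coset_word_algebra)

lemma Sh_module: "module C ShB"
  unfolding Sh_eq by (rule Q.quotient_is_module)

lemma coset_linear: "Q.coset \<in> linear_maps C F ShB"
  using Q.coset_linear by (simp add: Sh_eq)

lemma tensor_closed: "w \<in> words B \<Longrightarrow> tensor w \<in> carrier ShB"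
  unfolding tensor_eq by (intro linear_closed[OF coset_linear] e_closed)

lemma tensor_multilinear: "multilinear C B ShB tensor"
  unfolding multilinear_def
proof (intro ballI)
  interpret S: module C ShB by (rule Sh_module)
  fix us vs a b c
  assume A: "us \<in> letters" "vs \<in> letters" "a \<in> carrier B" "b \<in> carrier B" "c \<in> carrier C"
  note W = A[unfolded in_lists_conv_set]
  have rel: "Q.coset f = Q.coset g" if "f \<ominus>\<^bsub>F\<^esub> g \<in> multilinear_relations C B" "f \<in> carrier F" "g \<in> carrier F" for f g
  proof -
    have "f \<ominus>\<^bsub>F\<^esub> g \<in> I" unfolding tensor_ideal_def by (rule submodule_gen_incl[OF that(1)])
    moreover have "f \<ominus>\<^bsub>word_algebra C lam B\<^esub> g = f \<ominus>\<^bsub>F\<^esub> g"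
      by (simp add: a_minus_def a_inv_def m_inv_def)
    ultimately show ?thesis using that by (simp add: Q.coset_eq_iff)
  qed
  have ca: "c \<odot>\<^bsub>B\<^esub> a \<in> carrier B" using A by simp
  have "tensor (us @ (c \<odot>\<^bsub>B\<^esub> a \<oplus>\<^bsub>B\<^esub> b) # vs) = Q.coset (e (us @ (c \<odot>\<^bsub>B\<^esub> a) # vs) \<oplus>\<^bsub>F\<^esub> e (us @ b # vs))"
    unfolding tensor_eq
  proof (rule rel)
    show "e (us @ (c \<odot>\<^bsub>B\<^esub> a \<oplus>\<^bsub>B\<^esub> b) # vs) \<ominus>\<^bsub>F\<^esub> (e (us @ (c \<odot>\<^bsub>B\<^esub> a) # vs) \<oplus>\<^bsub>F\<^esub> e (us @ b # vs))
        \<in> multilinear_relations C B"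
      unfolding multilinear_relations_def
      by (rule UnI1, rule CollectI, intro exI[of _ us] exI[of _ vs] exI[of _ "c \<odot>\<^bsub>B\<^esub> a"] exI[of _ b])
        (use A ca in auto)
  qed (use A in \<open>simp_all add: e_closed\<close>)
  also have "\<dots> = tensor (us @ (c \<odot>\<^bsub>B\<^esub> a) # vs) \<oplus>\<^bsub>ShB\<^esub> tensor (us @ b # vs)"
    unfolding tensor_eq using A by (intro linear_add[OF coset_linear] e_closed) simp_all
  also have "tensor (us @ (c \<odot>\<^bsub>B\<^esub> a) # vs) = Q.coset (c \<odot>\<^bsub>F\<^esub> e (us @ a # vs))"
    unfolding tensor_eq
  proof (rule rel)
    show "e (us @ (c \<odot>\<^bsub>B\<^esub> a) # vs) \<ominus>\<^bsub>F\<^esub> c \<odot>\<^bsub>F\<^esub> e (us @ a # vs) \<in> multilinear_relations C B"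
      unfolding multilinear_relations_def
      by (rule UnI2, rule CollectI, intro exI[of _ us] exI[of _ vs] exI[of _ c] exI[of _ a])
        (use A in auto)
  qed (use A in \<open>simp_all add: e_closed\<close>)
  also have "\<dots> = c \<odot>\<^bsub>ShB\<^esub> tensor (us @ a # vs)"
    unfolding tensor_eq using A by (intro linear_smult[OF coset_linear] e_closed) simp_all
  finally show "tensor (us @ (c \<odot>\<^bsub>B\<^esub> a \<oplus>\<^bsub>B\<^esub> b) # vs)
      = c \<odot>\<^bsub>ShB\<^esub> tensor (us @ a # vs) \<oplus>\<^bsub>ShB\<^esub> tensor (us @ b # vs)" .
qed

lemma a_inv_word_algebra [simp]: "a_inv (word_algebra C lam B) = a_inv F"
  by (simp add: a_inv_def m_inv_def fun_eq_iff)

lemma coset_zero_iff: "f \<in> carrier F \<Longrightarrow> Q.coset f = \<zero>\<^bsub>ShB\<^esub> \<longleftrightarrow> f \<in> I"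
  using Q.coset_eq_iff[of f "\<zero>\<^bsub>F\<^esub>"]
  by (simp add: Sh_eq Q.coset_zero a_minus_def F.M.minus_equality[of "\<zero>\<^bsub>F\<^esub>" "\<zero>\<^bsub>F\<^esub>"])

text \<open>For a fixed word \<open>w\<close>, the class of the product of \<open>v\<close> and \<open>w\<close> is multilinear in \<open>v\<close>, since
  classes of words are multilinear and the recursion preserves multilinearity.  Hence it vanishes on the relations.\<close>
lemma ideal_absorbs_basis:
  assumes h: "h \<in> I" and w: "w \<in> words B"
  shows "h \<star> e w \<in> I"
proof -
  interpret S: module C ShB by (rule Sh_module)
  obtain b y where wy: "w = b # y" "b \<in> carrier B" "y \<in> letters" using w by (elim wordsE)
  define D where "D v = mixsum lam B ShB (\<lambda>u. tensor ((hd v \<cdot> b) # u)) (tl v) y" for v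
  have tf: "(\<lambda>u. tensor (a # u)) \<in> letters \<rightarrow> carrier ShB" if "a \<in> carrier B" for a
    using that by (auto intro!: tensor_closed Cons_words)
  have hF: "h \<in> carrier F" using h F.submoduleE(1)[OF ideal_submodule] by auto
  have lin: "Q.coset \<circ> (\<lambda>f. f \<star> e w) \<in> linear_maps C F ShB"
    by (rule linear_compose[OF word_mult_linear_left[OF e_closed[OF w]] coset_linear])
  have Dw: "D v \<in> carrier ShB" "Q.coset (e v \<star> e w) = D v" if v: "v \<in> words B" for v
  proof -
    obtain a x where vx: "v = a # x" "a \<in> carrier B" "x \<in> letters" using v by (elim wordsE)
    have ab: "a \<cdot> b \<in> carrier B" using vx wy by (simp add: mult_closed)
    show "D v \<in> carrier ShB" unfolding D_def using vx wy ab
      by (intro mixsum_closed[OF Sh_module] tf) simp_all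
    show "Q.coset (e v \<star> e w) = D v"
      unfolding word_mult_basis[OF v w] unfolding vx(1) wy(1)
      unfolding linear_diamond[OF Sh_module coset_linear vx(2) wy(2) vx(3) wy(3)]
      by (simp add: D_def tensor_eq)
  qed
  have Df: "D \<in> words B \<rightarrow> carrier ShB" using Dw(1) by auto
  \<comment> \<open>For the first letter of \<open>v\<close> this uses that \<open>a \<mapsto> a b\<close> is linear, for a letter of its tail the multilinearity of the recursion.\<close>
  have "multilinear C B ShB D"
    unfolding multilinear_def
  proof (intro ballI)
    fix us vs a a' c
    assume A: "us \<in> letters" "vs \<in> letters" "a \<in> carrier B" "a' \<in> carrier B" "c \<in> carrier C"
    show "D (us @ (c \<odot>\<^bsub>B\<^esub> a \<oplus>\<^bsub>B\<^esub> a') # vs) = c \<odot>\<^bsub>ShB\<^esub> D (us @ a # vs) \<oplus>\<^bsub>ShB\<^esub> D (us @ a' # vs)"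
    proof (cases us)
      case Nil
      have ab: "a \<cdot> b \<in> carrier B" "a' \<cdot> b \<in> carrier B" using A wy by (simp_all add: mult_closed)
      have "D ((c \<odot>\<^bsub>B\<^esub> a \<oplus>\<^bsub>B\<^esub> a') # vs) = mixsum lam B ShB (\<lambda>u. c \<odot>\<^bsub>ShB\<^esub> tensor ((a \<cdot> b) # u)
          \<oplus>\<^bsub>ShB\<^esub> tensor ((a' \<cdot> b) # u)) vs y"
        unfolding D_def list.sel mult_lincomb_left[OF A(5,3,4) wy(2)]
        using multilinearD[OF tensor_multilinear lists.Nil _ ab A(5)]
        by (intro mixsum_cong[OF Sh_module A(2) wy(3)]) simp
      also have "\<dots> = c \<odot>\<^bsub>ShB\<^esub> D (a # vs) \<oplus>\<^bsub>ShB\<^esub> D (a' # vs)"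
        unfolding D_def list.sel by (rule mixsum_lincomb[OF Sh_module A(2) wy(3) A(5) tf[OF ab(1)] tf[OF ab(2)]])
      finally show ?thesis using Nil by simp
    next
      case (Cons d us')
      then have d: "d \<cdot> b \<in> carrier B" "us' \<in> letters" using A wy by (auto simp: mult_closed)
      show ?thesis unfolding Cons D_def append_Cons list.sel
        by (rule multilinearD[OF mixsum_multilinear[OF Sh_module wy(3) tf[OF d(1)]
            multilinear_Cons[OF tensor_multilinear d(1)]] d(2) A(2-5)])
    qed
  qed
  note kill = lin_ext_multilinear_ideal[OF Sh_module Df this h]
  have "Q.coset (h \<star> e w) = lin_ext C ShB D h"
    using word_linear_eq[OF Sh_module lin word_lin_ext(1)[OF Sh_module Df] _ hF] Dw(2)
      word_lin_ext(2)[OF Sh_module Df] by simp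
  then show ?thesis
    using kill coset_zero_iff[of "h \<star> e w"] hF w by (simp add: word_mult_closed e_closed)
qed

lemma ideal_absorbs:
  assumes h: "h \<in> I" and g: "g \<in> carrier F"
  shows "h \<star> g \<in> I"
  using g
proof (induction rule: word_induct)
  case (basis w)
  then show ?case by (rule ideal_absorbs_basis[OF h])
next
  have hF: "h \<in> carrier F" using h F.submoduleE(1)[OF ideal_submodule] by auto
  note L = word_mult_linear_right[OF hF]
  {
    case zero
    show ?case using linear_zero[OF word_module word_module L]
        subgroup.one_closed[OF submodule.axioms(1)[OF ideal_submodule]] by simp
  next
    case (lincomb c f g)
    then show ?case
      by (simp add: linear_add[OF L] linear_smult[OF L] F.submoduleE(4,5)[OF ideal_submodule])
  }
qed

lemma tensor_mult:
  assumes "v \<in> words B" "w \<in> words B"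
  shows "tensor v \<otimes>\<^bsub>ShB\<^esub> tensor w = Q.coset (diamond C lam B v w)"
  unfolding tensor_eq Sh_eq word_mult_basis[OF assms, symmetric]
  by (rule Q.coset_mult[OF word_algebra_comm_algebra]) (use assms in \<open>simp_all add: ideal_absorbs e_closed\<close>)

lemma linear_tensor_mult:
  assumes N: "module C N" and k: "k \<in> linear_maps C ShB N"
    and ab: "a \<in> carrier B" "b \<in> carrier B" "x \<in> letters" "y \<in> letters"
  shows "k (tensor (a # x) \<otimes>\<^bsub>ShB\<^esub> tensor (b # y))
    = mixsum lam B N (\<lambda>u. k (tensor ((a \<cdot> b) # u))) x y"
  using linear_diamond[OF N linear_compose[OF coset_linear k] ab]
  unfolding tensor_mult[OF Cons_words[OF ab(1,3)] Cons_words[OF ab(2,4)]]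
  by (simp add: tensor_eq)

lemma tensor_mult_mixsum:
  assumes ab: "a \<in> carrier B" "b \<in> carrier B" "x \<in> letters" "y \<in> letters"
  shows "tensor (a # x) \<otimes>\<^bsub>ShB\<^esub> tensor (b # y) = mixsum lam B ShB (\<lambda>u. tensor ((a \<cdot> b) # u)) x y"
  using linear_diamond[OF Sh_module coset_linear ab]
  unfolding tensor_mult[OF Cons_words[OF ab(1,3)] Cons_words[OF ab(2,4)]]
  by (simp add: tensor_eq)

lemma tensor_extension:
  assumes N: "module C N" and g: "g \<in> words B \<rightarrow> carrier N" and ml: "multilinear C B N g"
  obtains k where "k \<in> linear_maps C ShB N" "\<And>w. w \<in> words B \<Longrightarrow> k (tensor w) = g w"
proof -
  obtain k where k: "k \<in> linear_maps C ShB N" "\<And>f. f \<in> carrier F \<Longrightarrow> k (Q.coset f) = lin_ext C N g f"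
    using Q.linear_descends[OF N, of "lin_ext C N g"] word_lin_ext(1)[OF N g]
      lin_ext_multilinear_ideal[OF N g ml] unfolding Sh_eq by auto
  then show ?thesis
    using that[OF k(1)] word_lin_ext(2)[OF N g] by (simp add: tensor_eq e_closed)
qed

end

context unital_weighted_algebra
begin

interpretation F: module C F by (rule word_module)
interpretation Q: quotient_module C "word_algebra C lam B" I by (rule quotient)

lemma op_ideal:
  assumes h: "h \<in> I"
  shows "op h \<in> I"
proof -
  have hF: "h \<in> carrier F" using h F.submoduleE(1)[OF ideal_submodule] by auto
  have tf: "(\<lambda>u. tensor (\<one>\<^bsub>B\<^esub> # u)) \<in> words B \<rightarrow> carrier ShB"
    using one_closed by (auto intro!: tensor_closed simp: words_iff)
  have "Q.coset (op h) = lin_ext C ShB (\<lambda>u. tensor (\<one>\<^bsub>B\<^esub> # u)) h"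
    using word_linear_eq[OF Sh_module linear_compose[OF op_linear coset_linear]
        word_lin_ext(1)[OF Sh_module tf] _ hF] word_lin_ext(2)[OF Sh_module tf]
    by (simp add: op_basis tensor_eq)
  also have "\<dots> = \<zero>\<^bsub>ShB\<^esub>"
    by (rule lin_ext_multilinear_ideal[OF Sh_module tf multilinear_Cons[OF tensor_multilinear one_closed] h])
  finally show ?thesis using coset_zero_iff[OF op_closed[OF hF]] by simp
qed

lemma Sh_P_eq: "Sh_P C B = coset_map (word_algebra C lam B) I op"
  by (rule ext) (simp add: Sh_P_def coset_map_def word_op_def lin_ext_def coset_word_algebra Let_def)

lemma Sh_baxter: "baxter_algebra0 C lam ShB (Sh_P C B)"
  unfolding Sh_eq Sh_P_eq
  by (rule Q.quotient_baxter[OF word_algebra_baxter]) (simp_all add: ideal_absorbs op_ideal)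

lemma Sh_P_tensor:
  assumes "w \<in> words B"
  shows "Sh_P C B (tensor w) = tensor (\<one>\<^bsub>B\<^esub> # w)"
  using Q.coset_map_coset[of op "e w"] assms unfolding Sh_P_eq tensor_eq op_basis[OF assms, symmetric]
  by (simp add: op_linear op_ideal e_closed)

end

section \<open>Adjoining an identity\<close>

lemma unitization_simps [simp]:
  "carrier (unitization C A) = carrier C \<times> carrier A"
  "(c, a) \<otimes>\<^bsub>unitization C A\<^esub> (d, b)
    = (c \<otimes>\<^bsub>C\<^esub> d, c \<odot>\<^bsub>A\<^esub> b \<oplus>\<^bsub>A\<^esub> d \<odot>\<^bsub>A\<^esub> a \<oplus>\<^bsub>A\<^esub> a \<otimes>\<^bsub>A\<^esub> b)"
  "\<one>\<^bsub>unitization C A\<^esub> = (\<one>\<^bsub>C\<^esub>, \<zero>\<^bsub>A\<^esub>)"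
  "\<zero>\<^bsub>unitization C A\<^esub> = (\<zero>\<^bsub>C\<^esub>, \<zero>\<^bsub>A\<^esub>)"
  "(c, a) \<oplus>\<^bsub>unitization C A\<^esub> (d, b) = (c \<oplus>\<^bsub>C\<^esub> d, a \<oplus>\<^bsub>A\<^esub> b)"
  "r \<odot>\<^bsub>unitization C A\<^esub> (c, a) = (r \<otimes>\<^bsub>C\<^esub> c, r \<odot>\<^bsub>A\<^esub> a)"
  by (simp_all add: unitization_def)

context comm_algebra0
begin

lemma mult_distr_right:
  "\<lbrakk>x \<in> carrier A; y \<in> carrier A; z \<in> carrier A\<rbrakk> \<Longrightarrow> x \<otimes>\<^bsub>A\<^esub> (y \<oplus>\<^bsub>A\<^esub> z) = x \<otimes>\<^bsub>A\<^esub> y \<oplus>\<^bsub>A\<^esub> x \<otimes>\<^bsub>A\<^esub> z"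
  by (simp add: mult_comm[of x] mult_distr)

lemma smult_mult_right:
  "\<lbrakk>c \<in> carrier C; x \<in> carrier A; y \<in> carrier A\<rbrakk> \<Longrightarrow> x \<otimes>\<^bsub>A\<^esub> (c \<odot>\<^bsub>A\<^esub> y) = c \<odot>\<^bsub>A\<^esub> (x \<otimes>\<^bsub>A\<^esub> y)"
  by (simp add: mult_comm[of x] smult_mult)

lemma mult_zero_left [simp]: "x \<in> carrier A \<Longrightarrow> \<zero>\<^bsub>A\<^esub> \<otimes>\<^bsub>A\<^esub> x = \<zero>\<^bsub>A\<^esub>"
  using smult_mult[of "\<zero>\<^bsub>C\<^esub>" "\<zero>\<^bsub>A\<^esub>" x] by (simp add: mult_closed)

lemma mult_zero_right [simp]: "x \<in> carrier A \<Longrightarrow> x \<otimes>\<^bsub>A\<^esub> \<zero>\<^bsub>A\<^esub> = \<zero>\<^bsub>A\<^esub>"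
  by (simp add: mult_comm[of x])

lemma mult_interchange:
  assumes "a \<in> carrier A" "b \<in> carrier A" "x \<in> carrier A" "y \<in> carrier A"
  shows "(a \<otimes>\<^bsub>A\<^esub> x) \<otimes>\<^bsub>A\<^esub> (b \<otimes>\<^bsub>A\<^esub> y) = (a \<otimes>\<^bsub>A\<^esub> b) \<otimes>\<^bsub>A\<^esub> (x \<otimes>\<^bsub>A\<^esub> y)"
proof -
  have "(a \<otimes>\<^bsub>A\<^esub> x) \<otimes>\<^bsub>A\<^esub> (b \<otimes>\<^bsub>A\<^esub> y) = a \<otimes>\<^bsub>A\<^esub> ((x \<otimes>\<^bsub>A\<^esub> b) \<otimes>\<^bsub>A\<^esub> y)"
    using assms by (simp add: mult_assoc mult_closed)
  also have "x \<otimes>\<^bsub>A\<^esub> b = b \<otimes>\<^bsub>A\<^esub> x" by (rule mult_comm[OF assms(3,2)])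
  finally show ?thesis using assms by (simp add: mult_assoc mult_closed)
qed

lemma mult_linear_right: "x \<in> carrier A \<Longrightarrow> (\<lambda>y. x \<otimes>\<^bsub>A\<^esub> y) \<in> linear_maps C A A"
  by (rule linear_mapsI) (simp_all add: mult_closed mult_distr_right smult_mult_right)

abbreviation adjoin ("A\<^sup>+") where "A\<^sup>+ \<equiv> unitization C A"

lemma unitization_module: "module C (A\<^sup>+)"
proof (rule moduleI)
  show "abelian_group (A\<^sup>+)"
  proof (rule abelian_groupI)
    fix x assume "x \<in> carrier (A\<^sup>+)"
    then obtain c a where "x = (c, a)" "c \<in> carrier C" "a \<in> carrier A" by auto
    then show "\<exists>y\<in>carrier (A\<^sup>+). y \<oplus>\<^bsub>A\<^sup>+\<^esub> x = \<zero>\<^bsub>A\<^sup>+\<^esub>"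
      by (intro bexI[of _ "(\<ominus>\<^bsub>C\<^esub> c, \<ominus>\<^bsub>A\<^esub> a)"]) (simp_all add: R.l_neg M.l_neg)
  qed (auto simp: R.a_ac M.a_ac)
qed (auto simp: R.is_cring R.l_distr R.r_distr smult_l_distr smult_r_distr R.m_assoc smult_assoc1)

lemma unitization_comm_algebra: "comm_algebra0 C (A\<^sup>+)"
proof (intro comm_algebra0.intro unitization_module comm_algebra0_axioms.intro)
  fix x y z
  assume "x \<in> carrier (A\<^sup>+)" "y \<in> carrier (A\<^sup>+)" "z \<in> carrier (A\<^sup>+)"
  then obtain c a d b f g where x: "x = (c, a)" "c \<in> carrier C" "a \<in> carrier A"
    and y: "y = (d, b)" "d \<in> carrier C" "b \<in> carrier A"
    and z: "z = (f, g)" "f \<in> carrier C" "g \<in> carrier A" by auto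
  show "x \<otimes>\<^bsub>A\<^sup>+\<^esub> y \<otimes>\<^bsub>A\<^sup>+\<^esub> z = x \<otimes>\<^bsub>A\<^sup>+\<^esub> (y \<otimes>\<^bsub>A\<^sup>+\<^esub> z)"
    using x y z
    by (simp add: R.m_assoc smult_r_distr smult_assoc1 mult_distr mult_distr_right
        smult_mult smult_mult_right mult_closed mult_assoc smult_lcomm[of f] M.a_ac)
  show "(x \<oplus>\<^bsub>A\<^sup>+\<^esub> y) \<otimes>\<^bsub>A\<^sup>+\<^esub> z
      = x \<otimes>\<^bsub>A\<^sup>+\<^esub> z \<oplus>\<^bsub>A\<^sup>+\<^esub> y \<otimes>\<^bsub>A\<^sup>+\<^esub> z"
    using x y z
    by (simp add: R.l_distr smult_l_distr smult_r_distr mult_distr mult_closed M.a_ac)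
next
  fix x y assume "x \<in> carrier (A\<^sup>+)" "y \<in> carrier (A\<^sup>+)"
  then obtain c a d b where x: "x = (c, a)" "c \<in> carrier C" "a \<in> carrier A"
    and y: "y = (d, b)" "d \<in> carrier C" "b \<in> carrier A" by auto
  show "x \<otimes>\<^bsub>A\<^sup>+\<^esub> y \<in> carrier (A\<^sup>+)"
    using x y by (simp add: mult_closed)
  show "x \<otimes>\<^bsub>A\<^sup>+\<^esub> y = y \<otimes>\<^bsub>A\<^sup>+\<^esub> x"
    using x y by (simp add: R.m_comm mult_comm mult_closed M.a_comm)
next
  fix r x y assume "r \<in> carrier C" "x \<in> carrier (A\<^sup>+)" "y \<in> carrier (A\<^sup>+)"
  then obtain c a d b where "r \<in> carrier C" and x: "x = (c, a)" "c \<in> carrier C" "a \<in> carrier A"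
    and y: "y = (d, b)" "d \<in> carrier C" "b \<in> carrier A" by auto
  then show "(r \<odot>\<^bsub>A\<^sup>+\<^esub> x) \<otimes>\<^bsub>A\<^sup>+\<^esub> y
      = r \<odot>\<^bsub>A\<^sup>+\<^esub> (x \<otimes>\<^bsub>A\<^sup>+\<^esub> y)"
    by (simp add: R.m_assoc smult_r_distr smult_assoc1 smult_mult mult_closed smult_lcomm[of d])
qed

lemma unitization_unital:
  assumes "lam \<in> carrier C"
  shows "unital_weighted_algebra C lam (A\<^sup>+)"
  by (intro unital_weighted_algebra.intro weighted_algebra.intro unitization_comm_algebra
      weighted_algebra_axioms.intro unital_weighted_algebra_axioms.intro assms)
    auto

end

section \<open>Evaluation of words by iterated application of the operator\<close>

text \<open>The value \<open>p (f b\<^sub>1 \<cdot> p (f b\<^sub>2 \<cdot> \<dots> p (f b\<^sub>n)))\<close> of a word \<open>b\<^sub>1 \<dots> b\<^sub>n\<close>, with \<open>1\<close> for the empty word.\<close>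
fun nested :: "('v, 'n) monoid_scheme \<Rightarrow> ('v \<Rightarrow> 'v) \<Rightarrow> ('b \<Rightarrow> 'v) \<Rightarrow> 'b list \<Rightarrow> 'v" where
  "nested V p f [] = \<one>\<^bsub>V\<^esub>"
| "nested V p f (b # w) = p (f b \<otimes>\<^bsub>V\<^esub> nested V p f w)"

text \<open>Here the operator is not applied to the outermost letter: this is the value required of a pure
  tensor.  On the empty word, which is no tensor, the definition depends on \<open>hd []\<close>.\<close>
definition eval_word :: "('v, 'n) monoid_scheme \<Rightarrow> ('v \<Rightarrow> 'v) \<Rightarrow> ('b \<Rightarrow> 'v) \<Rightarrow> 'b list \<Rightarrow> 'v" where
  "eval_word V p f w = f (hd w) \<otimes>\<^bsub>V\<^esub> nested V p f (tl w)"

lemma eval_word_Cons [simp]: "eval_word V p f (b # w) = f b \<otimes>\<^bsub>V\<^esub> nested V p f w"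
  by (simp add: eval_word_def)

lemma nested_eval_word: "w \<noteq> [] \<Longrightarrow> nested V p f w = p (eval_word V p f w)"
  by (cases w) simp_all

locale word_evaluation = B: comm_algebra0 C B + V: unital_weighted_algebra C lam V
  for C (structure) and lam and B (structure) and V (structure) +
  fixes p f
  assumes p: "p \<in> linear_maps C V V" and f: "f \<in> linear_maps C B V"
begin

abbreviation "letters \<equiv> lists (carrier B)"

lemma nested_closed: "w \<in> letters \<Longrightarrow> nested V p f w \<in> carrier V"
  by (induction w) (auto simp: V.one_closed intro!: linear_closed[OF p] V.mult_closed linear_closed[OF f])

lemma eval_word_closed: "w \<in> words B \<Longrightarrow> eval_word V p f w \<in> carrier V"
  by (elim wordsE) (auto intro!: V.mult_closed linear_closed[OF f] nested_closed)

lemma eval_word_Cons_lincomb: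
  assumes "c \<in> carrier C" "a \<in> carrier B" "b \<in> carrier B" "w \<in> letters"
  shows "eval_word V p f ((c \<odot>\<^bsub>B\<^esub> a \<oplus>\<^bsub>B\<^esub> b) # w)
    = c \<odot>\<^bsub>V\<^esub> eval_word V p f (a # w) \<oplus>\<^bsub>V\<^esub> eval_word V p f (b # w)"
  using assms
  by (simp add: linear_add[OF f] linear_smult[OF f] linear_closed[OF f] V.mult_lincomb_left nested_closed)

lemma nested_multilinear: "multilinear C B V (nested V p f)"
  unfolding multilinear_def
proof (intro ballI)
  fix us vs a b c
  assume us: "us \<in> letters" and A: "vs \<in> letters" "a \<in> carrier B" "b \<in> carrier B" "c \<in> carrier C"
  show "nested V p f (us @ (c \<odot>\<^bsub>B\<^esub> a \<oplus>\<^bsub>B\<^esub> b) # vs)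
      = c \<odot>\<^bsub>V\<^esub> nested V p f (us @ a # vs) \<oplus>\<^bsub>V\<^esub> nested V p f (us @ b # vs)"
    using us
  proof (induction us)
    case Nil
    show ?case
      using A eval_word_Cons_lincomb[OF A(4,2,3,1)]
      by (simp add: linear_add[OF p] linear_smult[OF p] linear_closed[OF f] V.mult_closed nested_closed)
  next
    case (Cons d us)
    have mem: "nested V p f (us @ a # vs) \<in> carrier V" "nested V p f (us @ b # vs) \<in> carrier V"
      "f d \<in> carrier V"
      using A Cons.hyps Cons.prems by (auto intro!: nested_closed linear_closed[OF f])
    then show ?case
      using A Cons by (simp add: V.mult_lincomb_right linear_add[OF p] linear_smult[OF p] V.mult_closed)
  qed
qed

lemma eval_word_multilinear: "multilinear C B V (eval_word V p f)"
  unfolding multilinear_def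
proof (intro ballI)
  fix us vs a b c
  assume A: "us \<in> letters" "vs \<in> letters" "a \<in> carrier B" "b \<in> carrier B" "c \<in> carrier C"
  show "eval_word V p f (us @ (c \<odot>\<^bsub>B\<^esub> a \<oplus>\<^bsub>B\<^esub> b) # vs)
      = c \<odot>\<^bsub>V\<^esub> eval_word V p f (us @ a # vs) \<oplus>\<^bsub>V\<^esub> eval_word V p f (us @ b # vs)"
  proof (cases us)
    case Nil
    then show ?thesis using eval_word_Cons_lincomb A by simp
  next
    case (Cons d us')
    then have mem: "nested V p f (us' @ a # vs) \<in> carrier V" "nested V p f (us' @ b # vs) \<in> carrier V"
      "f d \<in> carrier V"
      using A by (auto intro!: nested_closed linear_closed[OF f])
    then show ?thesis
      using A Cons multilinearD[OF nested_multilinear, of us' vs a b c] by (simp add: V.mult_lincomb_right)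
  qed
qed

end

section \<open>Words ending in an ideal\<close>

text \<open>The empty word is admitted because it occurs as a tail of the words in question.\<close>
definition ends_in :: "'b set \<Rightarrow> 'b list \<Rightarrow> bool" where
  "ends_in J w \<longleftrightarrow> w = [] \<or> last w \<in> J"

lemma ends_in_Cons: "ends_in J (a # w) \<Longrightarrow> ends_in J w"
  by (auto simp: ends_in_def split: if_splits)

text \<open>The last letter of a mixable shuffle is the last letter of one of the two words or the product of both.
  Only if both words are empty is the result empty.\<close>
lemma (in weighted_algebra) mixsum_ends_in:
  assumes N: "module C N" and H: "submodule H C N" and J: "\<And>a b. a \<in> J \<Longrightarrow> b \<in> carrier B \<Longrightarrow> a \<cdot> b \<in> J"
    and xy: "x \<in> letters" "y \<in> letters" "ends_in J x" "ends_in J y"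
    and g: "\<And>w. \<lbrakk>w \<in> letters; w \<noteq> []; ends_in J w\<rbrakk> \<Longrightarrow> g w \<in> H"
    and empty: "\<lbrakk>x = []; y = []\<rbrakk> \<Longrightarrow> g [] \<in> H"
  shows "mixsum lam B N g x y \<in> H"
  using xy g empty
proof (induction x y arbitrary: g rule: list_pair_induct)
  case (Nil1 y)
  then show ?case by (cases "y = []") simp_all
next
  case (Nil2 x)
  then show ?case by (cases "x = []") simp_all
next
  case (Cons a x b y)
  interpret N: module C N by (rule N)
  note sub = N.submoduleE(4,5)[OF H]
  have ab: "a \<cdot> b \<in> carrier B" using Cons.hyps by (simp add: mult_closed)
  have tails: "ends_in J x" "ends_in J y" using Cons.prems(1,2) by (auto dest: ends_in_Cons)
  have g: "g (c # w) \<in> H" if "c \<in> carrier B" "w \<in> letters" "w \<noteq> []" "ends_in J w" for c w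
    using that by (intro Cons.prems(3)) (auto simp: ends_in_def)
  have "mixsum lam B N (\<lambda>w. g (a # w)) x (b # y) \<in> H"
    by (rule Cons.IH(1)) (use tails Cons.prems(2) Cons.hyps g in auto)
  moreover have "mixsum lam B N (\<lambda>w. g (b # w)) (a # x) y \<in> H"
    by (rule Cons.IH(2)) (use tails Cons.prems(1) Cons.hyps g in auto)
  moreover have "mixsum lam B N (\<lambda>w. g ((a \<cdot> b) # w)) x y \<in> H"
  proof (rule Cons.IH(3)[OF tails])
    show "g ((a \<cdot> b) # w) \<in> H" if "w \<in> letters" "w \<noteq> []" "ends_in J w" for w
      using that ab g by blast
    assume "x = []" "y = []"
    then show "g [a \<cdot> b] \<in> H"
      using Cons.prems(1,2) Cons.hyps ab J by (intro Cons.prems(3)) (auto simp: ends_in_def)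
  qed
  ultimately show ?case using weight_closed by (simp add: sub)
qed

section \<open>The free Baxter algebra on an algebra without identity\<close>

locale shuffle_algebra0 = comm_algebra0 C A for C (structure) and lam and A (structure) +
  assumes weight_closed: "lam \<in> carrier C"

sublocale shuffle_algebra0 \<subseteq> U: unital_weighted_algebra C lam "unitization C A"
  by (rule unitization_unital[OF weight_closed])

context shuffle_algebra0
begin

abbreviation "U \<equiv> unitization C A"
abbreviation "J \<equiv> {\<zero>\<^bsub>C\<^esub>} \<times> carrier A"
abbreviation "ShU \<equiv> Sh C lam U"
abbreviation mult_Sh (infixl "\<diamondop>" 70) where "X \<diamondop> Y \<equiv> X \<otimes>\<^bsub>ShU\<^esub> Y"
abbreviation "tensor \<equiv> pure_tensor C U"
abbreviation "S0 \<equiv> Sh0 C lam A"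
abbreviation "j \<equiv> Sh0_j C A"

definition good_words :: "('a \<times> 'c) list set" where
  "good_words = {w \<in> words U. ends_in J w}"

definition generators where "generators = tensor ` good_words"

interpretation S: baxter_algebra0 C lam ShU "Sh_P C U" by (rule U.Sh_baxter)

lemma J_absorbs: "a \<in> J \<Longrightarrow> b \<in> carrier U \<Longrightarrow> a \<otimes>\<^bsub>U\<^esub> b \<in> J"
  by (auto simp: mult_closed)

lemma generators_closed: "generators \<subseteq> carrier ShU"
  by (auto simp: generators_def good_words_def intro: U.tensor_closed)

lemma Sh0_carrier: "carrier S0 = submodule_gen C ShU generators"
proof -
  have "{tensor w | w. w \<in> words U \<and> last w \<in> J} = generators"
    by (auto simp: generators_def good_words_def ends_in_def words_def)
  then show ?thesis by (simp add: Sh0_def)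
qed

lemma Sh0_submodule: "submodule (carrier S0) C ShU"
  unfolding Sh0_carrier by (rule S.submodule_gen_submodule[OF generators_closed])

lemma Sh0_zero: "\<zero>\<^bsub>ShU\<^esub> \<in> carrier S0"
  using subgroup.one_closed[OF submodule.axioms(1)[OF Sh0_submodule]] by simp

lemma Sh0_mem: "X \<in> carrier S0 \<Longrightarrow> X \<in> carrier ShU"
  using S.submoduleE(1)[OF Sh0_submodule] by auto

lemma Sh0_simps [simp]:
  "add S0 = add ShU" "smult S0 = smult ShU" "zero S0 = zero ShU" "monoid.mult S0 = monoid.mult ShU"
  by (simp_all add: Sh0_def)

lemma Sh0_record: "S0 = ShU\<lparr>carrier := carrier S0\<rparr>"
  by (simp add: Sh0_def)

lemma Sh0_induct [consumes 1, case_names tensor zero lincomb]: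
  assumes "X \<in> carrier S0" "\<And>w. w \<in> good_words \<Longrightarrow> Q (tensor w)" "Q \<zero>\<^bsub>ShU\<^esub>"
    and "\<And>c X Y. \<lbrakk>c \<in> carrier C; X \<in> carrier S0; Y \<in> carrier S0; Q X; Q Y\<rbrakk> \<Longrightarrow> Q (c \<odot>\<^bsub>ShU\<^esub> X \<oplus>\<^bsub>ShU\<^esub> Y)"
  shows "Q X"
  using assms(1) unfolding Sh0_carrier
  by (induction rule: S.submodule_gen_induct[OF _ generators_closed, consumes 1])
    (use assms(2-) in \<open>auto simp: generators_def Sh0_carrier\<close>)

lemma tensor_in_Sh0: "w \<in> good_words \<Longrightarrow> tensor w \<in> carrier S0"
  unfolding Sh0_carrier by (rule submodule_gen_incl) (simp add: generators_def)

lemma good_wordsE: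
  assumes "w \<in> good_words"
  obtains a x where "w = a # x" "a \<in> carrier U" "x \<in> U.letters" "ends_in J x" "ends_in J (a # x)"
    "x \<noteq> [] \<Longrightarrow> x \<in> good_words"
proof -
  obtain a x where w: "w = a # x" "a \<in> carrier U" "x \<in> U.letters"
    using assms unfolding good_words_def by (blast elim: wordsE)
  have e: "ends_in J (a # x)" "ends_in J x" using assms w ends_in_Cons by (auto simp: good_words_def)
  then show ?thesis using w by (intro that[of a x]) (auto simp: good_words_def words_def)
qed

lemma Cons_good:
  assumes "a \<in> carrier U" "x \<in> U.letters" "ends_in J x" "x = [] \<Longrightarrow> a \<in> J"
  shows "a # x \<in> good_words"
  using assms by (auto simp: good_words_def words_def ends_in_def)

lemma one_U: "\<one>\<^bsub>U\<^esub> \<in> carrier U" by (rule U.one_closed)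

lemma Sh0_P_tensor:
  assumes "w \<in> good_words"
  shows "Sh_P C U (tensor w) = tensor (\<one>\<^bsub>U\<^esub> # w)" "\<one>\<^bsub>U\<^esub> # w \<in> good_words"
proof -
  have w: "w \<in> words U" "ends_in J w" using assms by (simp_all add: good_words_def)
  show "Sh_P C U (tensor w) = tensor (\<one>\<^bsub>U\<^esub> # w)" using w by (rule_tac U.Sh_P_tensor)
  show "\<one>\<^bsub>U\<^esub> # w \<in> good_words" using w one_U by (intro Cons_good) (auto simp: words_def)
qed

lemma Sh0_P_closed:
  assumes "X \<in> carrier S0"
  shows "Sh_P C U X \<in> carrier S0"
  using assms
proof (induction rule: Sh0_induct)
  case (tensor w)
  then show ?case by (simp only: Sh0_P_tensor tensor_in_Sh0)
next
  case zero
  show ?case using linear_zero[OF S.module_axioms S.module_axioms S.operator_linear] Sh0_zero by simp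
next
  case (lincomb c X Y)
  then show ?case
    by (simp add: linear_add[OF S.operator_linear] linear_smult[OF S.operator_linear] Sh0_mem
        S.submoduleE(4,5)[OF Sh0_submodule])
qed

lemma tensor_mult_closed:
  assumes "v \<in> good_words" "w \<in> good_words"
  shows "tensor v \<diamondop> tensor w \<in> carrier S0"
proof -
  obtain a x where v: "v = a # x" "a \<in> carrier U" "x \<in> U.letters" "ends_in J x" "ends_in J (a # x)"
    using assms(1) by (rule good_wordsE)
  obtain b y where w: "w = b # y" "b \<in> carrier U" "y \<in> U.letters" "ends_in J y" "ends_in J (b # y)"
    using assms(2) by (rule good_wordsE)
  have ab: "a \<otimes>\<^bsub>U\<^esub> b \<in> carrier U" using v w by (intro U.mult_closed)
  show ?thesis
    unfolding v(1) w(1) U.tensor_mult_mixsum[OF v(2) w(2) v(3) w(3)]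
  proof (rule U.mixsum_ends_in[OF U.Sh_module Sh0_submodule J_absorbs v(3) w(3) v(4) w(4)])
    show "tensor ((a \<otimes>\<^bsub>U\<^esub> b) # u) \<in> carrier S0"
      if "u \<in> U.letters" "u \<noteq> []" "ends_in J u" for u
      using that ab by (intro tensor_in_Sh0 Cons_good) auto
    assume "x = []" "y = []"
    then have "a \<in> J" using v(5) by (simp add: ends_in_def)
    then show "tensor [a \<otimes>\<^bsub>U\<^esub> b] \<in> carrier S0"
      using J_absorbs[OF _ w(2)] ab by (intro tensor_in_Sh0 Cons_good) (auto simp: ends_in_def)
  qed
qed

lemma Sh0_mult_closed:
  assumes X: "X \<in> carrier S0" and Y: "Y \<in> carrier S0"
  shows "X \<diamondop> Y \<in> carrier S0"
proof -
  note sub = S.submoduleE(4,5)[OF Sh0_submodule]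
  have gen: "tensor v \<diamondop> Y \<in> carrier S0" if v: "v \<in> good_words" for v
    using Y
  proof (induction rule: Sh0_induct)
    case (tensor w)
    then show ?case by (rule tensor_mult_closed[OF v])
  next
    case zero
    then show ?case using tensor_in_Sh0[OF v] Sh0_zero Sh0_mem by simp
  next
    case (lincomb c X Y)
    then show ?case using Sh0_mem tensor_in_Sh0[OF v]
      by (simp add: S.mult_distr_right S.smult_mult_right sub)
  qed
  show ?thesis using X
  proof (induction rule: Sh0_induct)
    case (lincomb c X X')
    then show ?case using Sh0_mem Y by (simp add: S.mult_distr S.smult_mult sub)
  qed (use gen Sh0_mem[OF Y] Sh0_zero in simp_all)
qed

lemma Sh0_baxter: "baxter_algebra0 C lam S0 (Sh0_P C lam A)"
  using S.subalgebra_baxter[OF Sh0_submodule Sh0_mult_closed Sh0_P_closed]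
  by (simp add: Sh0_P_def flip: Sh0_record)

lemma singleton_good: "a \<in> carrier A \<Longrightarrow> [(\<zero>\<^bsub>C\<^esub>, a)] \<in> good_words"
  by (rule Cons_good) (auto simp: ends_in_def)

lemma j_closed: "a \<in> carrier A \<Longrightarrow> j a \<in> carrier S0"
  unfolding Sh0_j_def by (intro tensor_in_Sh0 singleton_good)

lemma j_hom: "j \<in> algebra0_hom C A S0"
proof -
  note ml = multilinearD[OF U.tensor_multilinear lists.Nil lists.Nil, unfolded append_Nil]
  have lc: "tensor [(\<zero>\<^bsub>C\<^esub>, c \<odot>\<^bsub>A\<^esub> a \<oplus>\<^bsub>A\<^esub> b)]
      = c \<odot>\<^bsub>ShU\<^esub> tensor [(\<zero>\<^bsub>C\<^esub>, a)] \<oplus>\<^bsub>ShU\<^esub> tensor [(\<zero>\<^bsub>C\<^esub>, b)]"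
    if "c \<in> carrier C" "a \<in> carrier A" "b \<in> carrier A" for c a b
    using that ml[of "(\<zero>\<^bsub>C\<^esub>, a)" "(\<zero>\<^bsub>C\<^esub>, b)" c] by simp
  have jc: "j a \<in> carrier ShU" if "a \<in> carrier A" for a using that by (intro Sh0_mem j_closed)
  have add: "j (a \<oplus>\<^bsub>A\<^esub> b) = j a \<oplus>\<^bsub>ShU\<^esub> j b" if "a \<in> carrier A" "b \<in> carrier A" for a b
    using lc[of "\<one>\<^bsub>C\<^esub>" a b] that jc[of a] by (simp add: Sh0_j_def)
  have z: "j \<zero>\<^bsub>A\<^esub> = \<zero>\<^bsub>ShU\<^esub>" using add[of "\<zero>\<^bsub>A\<^esub>" "\<zero>\<^bsub>A\<^esub>"] jc[of "\<zero>\<^bsub>A\<^esub>"] by simp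
  have "j \<in> linear_maps C A S0"
  proof (rule linear_mapsI)
    show "j (c \<odot>\<^bsub>A\<^esub> a) = c \<odot>\<^bsub>S0\<^esub> j a" if "c \<in> carrier C" "a \<in> carrier A" for c a
      using lc[of c a "\<zero>\<^bsub>A\<^esub>"] that jc[of a] z by (simp add: Sh0_j_def)
  qed (use add j_closed in simp_all)
  moreover have "j \<in> hom A S0"
  proof (rule homI)
    show "j (a \<otimes>\<^bsub>A\<^esub> b) = j a \<otimes>\<^bsub>S0\<^esub> j b" if "a \<in> carrier A" "b \<in> carrier A" for a b
      using that U.tensor_mult_mixsum[of "(\<zero>\<^bsub>C\<^esub>, a)" "(\<zero>\<^bsub>C\<^esub>, b)" "[]" "[]"]
      by (simp add: Sh0_j_def mult_closed)
  qed (rule j_closed)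
  ultimately show ?thesis by (simp add: algebra0_hom_def)
qed

text \<open>Split the first letter as \<open>(c, a) = c 1 + (0, a)\<close>; and \<open>(0, a) \<otimes> w\<close> is the product of \<open>(0, a)\<close> and
  \<open>1 \<otimes> w\<close>.\<close>
lemma tensor_Cons_good:
  assumes w: "w \<in> good_words" and ca: "c \<in> carrier C" "a \<in> carrier A"
  shows "tensor ((c, a) # w) = c \<odot>\<^bsub>ShU\<^esub> Sh_P C U (tensor w) \<oplus>\<^bsub>ShU\<^esub> j a \<diamondop> Sh_P C U (tensor w)"
proof -
  have wl: "w \<in> U.letters" using w by (auto simp: good_words_def words_def)
  have a: "(\<zero>\<^bsub>C\<^esub>, a) \<in> carrier U" using ca by simp
  have "tensor ((c, a) # w) = c \<odot>\<^bsub>ShU\<^esub> tensor (\<one>\<^bsub>U\<^esub> # w) \<oplus>\<^bsub>ShU\<^esub> tensor ((\<zero>\<^bsub>C\<^esub>, a) # w)"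
    using multilinearD[OF U.tensor_multilinear lists.Nil wl one_U a ca(1)] ca by simp
  moreover have "j a \<diamondop> tensor (\<one>\<^bsub>U\<^esub> # w) = tensor ((\<zero>\<^bsub>C\<^esub>, a) # w)"
    unfolding Sh0_j_def U.tensor_mult_mixsum[OF a one_U lists.Nil wl]
    using U.mult_one[OF a] by simp
  ultimately show ?thesis by (simp only: Sh0_P_tensor[OF w])
qed

text \<open>By \<open>tensor_Cons_good\<close>, the value of a Baxter morphism on a tensor is expressed by its values on \<open>A\<close> and on a
  shorter tensor.\<close>
lemma hom_determined:
  assumes R: "baxter_algebra0 C lam R P"
    and k: "k \<in> baxter0_hom C S0 (Sh0_P C lam A) R P" and l: "l \<in> baxter0_hom C S0 (Sh0_P C lam A) R P"
    and eq: "\<And>a. a \<in> carrier A \<Longrightarrow> k (j a) = l (j a)" and X: "X \<in> carrier S0"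
  shows "k X = l X"
proof -
  interpret R: baxter_algebra0 C lam R P by (rule R)
  interpret S0: baxter_algebra0 C lam S0 "Sh0_P C lam A" by (rule Sh0_baxter)
  have word: "h (tensor ((c, a) # w)) = c \<odot>\<^bsub>R\<^esub> P (h (tensor w)) \<oplus>\<^bsub>R\<^esub> h (j a) \<otimes>\<^bsub>R\<^esub> P (h (tensor w))"
    if h: "h \<in> baxter0_hom C S0 (Sh0_P C lam A) R P" and w: "w \<in> good_words"
      and ca: "c \<in> carrier C" "a \<in> carrier A" for h w c a
  proof -
    have hl: "h \<in> linear_maps C S0 R" and hm: "h \<in> hom S0 R"
      and hP: "\<And>X. X \<in> carrier S0 \<Longrightarrow> h (Sh_P C U X) = P (h X)"
      using h by (auto simp: baxter0_hom_def algebra0_hom_def Sh0_P_def)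
    let ?T = "Sh_P C U (tensor w)"
    have T: "?T \<in> carrier S0" "tensor w \<in> carrier S0" using w by (auto intro: Sh0_P_closed tensor_in_Sh0)
    have ja: "j a \<in> carrier S0" using ca by (intro j_closed)
    have "h (tensor ((c, a) # w)) = h (c \<odot>\<^bsub>S0\<^esub> ?T \<oplus>\<^bsub>S0\<^esub> j a \<otimes>\<^bsub>S0\<^esub> ?T)"
      by (simp add: tensor_Cons_good[OF w ca])
    also have "\<dots> = c \<odot>\<^bsub>R\<^esub> h ?T \<oplus>\<^bsub>R\<^esub> h (j a \<otimes>\<^bsub>S0\<^esub> ?T)"
      using T ja ca S0.smult_closed[OF ca(1) T(1)] S0.mult_closed[OF ja T(1)]
      by (simp only: linear_add[OF hl] linear_smult[OF hl])
    also have "h (j a \<otimes>\<^bsub>S0\<^esub> ?T) = h (j a) \<otimes>\<^bsub>R\<^esub> h ?T" by (rule hom_mult[OF hm ja T(1)])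
    finally show ?thesis using hP[OF T(2)] by simp
  qed
  have gen: "k (tensor w) = l (tensor w)" if "w \<in> good_words" for w
    using that
  proof (induction w)
    case Nil
    then show ?case by (auto simp: good_words_def words_def)
  next
    case (Cons b w)
    obtain c a where b: "b = (c, a)" by (cases b)
    from Cons.prems obtain "(c, a) \<in> carrier U" "ends_in J (b # w)" "w \<noteq> [] \<Longrightarrow> w \<in> good_words"
      unfolding b by (rule good_wordsE) auto
    then have ca: "c \<in> carrier C" "a \<in> carrier A" and e: "ends_in J (b # w)"
      and tl: "w \<noteq> [] \<Longrightarrow> w \<in> good_words" by auto
    show ?case
    proof (cases "w = []")
      case True
      then have "tensor (b # w) = j a" using e b by (simp add: ends_in_def Sh0_j_def)
      then show ?thesis using eq[OF ca(2)] by simp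
    next
      case False
      then show ?thesis
        using Cons.IH tl word[OF k tl ca] word[OF l tl ca] eq[OF ca(2)] b by simp
    qed
  qed
  have kl: "k \<in> linear_maps C S0 R" and ll: "l \<in> linear_maps C S0 R"
    using k l by (auto simp: baxter0_hom_def algebra0_hom_def)
  show ?thesis using X
  proof (induction rule: Sh0_induct)
    case zero
    show ?case
      using linear_zero[OF S0.module_axioms R.module_axioms kl] linear_zero[OF S0.module_axioms R.module_axioms ll]
      by simp
  next
    case (lincomb c X Y)
    then show ?case
      using linear_add[OF kl, of "c \<odot>\<^bsub>S0\<^esub> X" Y] linear_add[OF ll, of "c \<odot>\<^bsub>S0\<^esub> X" Y]
        linear_smult[OF kl, of c X] linear_smult[OF ll, of c X] S0.smult_closed[of c X] by simp
  qed (rule gen)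
qed

section \<open>The universal property\<close>

context
  fixes R :: "('a, 'r, 'k) module_scheme" and P \<phi>
  assumes R: "baxter_algebra0 C lam R P" and \<phi>: "\<phi> \<in> algebra0_hom C A R"
begin

interpretation R: baxter_algebra0 C lam R P by (rule R)

abbreviation "V \<equiv> unitization C R"
abbreviation mult_V (infixl "\<bullet>" 70) where "v \<bullet> w \<equiv> v \<otimes>\<^bsub>V\<^esub> w"
text \<open>The operator of \<open>R\<close> extended to \<open>R\<^sup>+\<close> by \<open>0\<close> on the adjoined scalars.  It is linear, but in general it satisfies
  the Baxter identity only on \<open>R\<close>: it sends \<open>1\<close> to \<open>0\<close>, whereas the right-hand side of the identity for \<open>1\<close> and
  \<open>v\<close> is \<open>P (P v) + lam P v\<close>.  This is the reason for restricting to words that end in \<open>A\<close>, whose values lie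
  in \<open>R\<close>.\<close>
definition lift_op where "lift_op v = (\<zero>\<^bsub>C\<^esub>, P (snd v))" for v :: "'a \<times> 'r"
definition lift_hom where "lift_hom b = (fst b, \<phi> (snd b))" for b :: "'a \<times> 'c"

lemma \<phi>_linear: "\<phi> \<in> linear_maps C A R" and \<phi>_hom: "\<phi> \<in> hom A R"
  using \<phi> by (simp_all add: algebra0_hom_def)

lemma lift_op_linear: "lift_op \<in> linear_maps C V V"
  by (rule linear_mapsI)
    (auto simp: lift_op_def linear_closed[OF R.operator_linear] linear_add[OF R.operator_linear]
      linear_smult[OF R.operator_linear])

lemma lift_hom_linear: "lift_hom \<in> linear_maps C U V"
  by (rule linear_mapsI)
    (auto simp: lift_hom_def linear_closed[OF \<phi>_linear] linear_add[OF \<phi>_linear] linear_smult[OF \<phi>_linear])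

lemma lift_hom_mult:
  assumes "a \<in> carrier U" "b \<in> carrier U"
  shows "lift_hom (a \<otimes>\<^bsub>U\<^esub> b) = lift_hom a \<bullet> lift_hom b"
  using assms
  by (auto simp: lift_hom_def linear_closed[OF \<phi>_linear] linear_add[OF \<phi>_linear]
      linear_smult[OF \<phi>_linear] hom_mult[OF \<phi>_hom] mult_closed)

lemma lift_hom_one: "lift_hom \<one>\<^bsub>U\<^esub> = \<one>\<^bsub>V\<^esub>"
  using linear_zero[OF module_axioms R.module_axioms \<phi>_linear] by (simp add: lift_hom_def)

abbreviation "nest \<equiv> nested V lift_op lift_hom"
abbreviation "ev \<equiv> eval_word V lift_op lift_hom"
abbreviation "K \<equiv> {\<zero>\<^bsub>C\<^esub>} \<times> carrier R"

lemma word_evaluation: "word_evaluation C lam U V lift_op lift_hom"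
  by (intro word_evaluation.intro unitization_comm_algebra R.unitization_unital weight_closed
      word_evaluation_axioms.intro lift_op_linear lift_hom_linear)

interpretation E: word_evaluation C lam U V lift_op lift_hom by (rule word_evaluation)

lemma lift_op_K: "v \<in> carrier V \<Longrightarrow> lift_op v \<in> K"
  by (auto simp: lift_op_def linear_closed[OF R.operator_linear])

lemma K_absorbs: "v \<in> carrier V \<Longrightarrow> w \<in> K \<Longrightarrow> v \<bullet> w \<in> K"
  by (auto simp: R.mult_closed)

lemma K_carrier: "v \<in> K \<Longrightarrow> v \<in> carrier V" by auto

lemma lift_op_baxter:
  assumes "v \<in> K" "w \<in> K"
  shows "lift_op v \<bullet> lift_op w = lift_op (v \<bullet> lift_op w) \<oplus>\<^bsub>V\<^esub> lift_op (w \<bullet> lift_op v)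
    \<oplus>\<^bsub>V\<^esub> lam \<odot>\<^bsub>V\<^esub> lift_op (v \<bullet> w)"
  using assms weight_closed
  by (auto simp: lift_op_def linear_closed[OF R.operator_linear] R.mult_closed R.baxter)

lemma ev_ends_in:
  assumes "a \<in> carrier U" "x \<in> U.letters" "ends_in J (a # x)"
  shows "ev (a # x) \<in> K"
proof (cases x)
  case Nil
  then have "lift_hom a \<in> K" using assms linear_closed[OF \<phi>_linear] by (auto simp: ends_in_def lift_hom_def)
  then show ?thesis using Nil E.V.mult_one[OF K_carrier] by simp
next
  case (Cons b y)
  have "nest x \<in> K"
    unfolding Cons nested.simps using assms Cons
    by (intro lift_op_K E.V.mult_closed linear_closed[OF lift_hom_linear] E.nested_closed) auto
  then show ?thesis
    using assms by (simp only: eval_word_Cons) (intro K_absorbs linear_closed[OF lift_hom_linear])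
qed

text \<open>Put \<open>u = a p(x)\<close> and \<open>v = b p(y)\<close>, so that \<open>p(a x) p(b y) = P(u) P(v)\<close>.  Here \<open>u P(v) = a p(x) p(b y)\<close>, which
  is \<open>a p(x * b y)\<close> by induction, and similarly for \<open>v P(u)\<close> and \<open>u v\<close>; applying \<open>P\<close> to them gives the three
  summands of the recursion.\<close>
lemma nest_mult:
  assumes "x \<in> U.letters" "y \<in> U.letters" "ends_in J x" "ends_in J y"
  shows "nest x \<bullet> nest y = mixsum lam U V nest x y"
  using assms
proof (induction x y rule: list_pair_induct)
  case (Nil1 y)
  then show ?case using E.V.one_mult[OF E.nested_closed] by simp
next
  case (Nil2 x)
  then show ?case using E.V.mult_one[OF E.nested_closed] by simp
next
  case (Cons a x b y)
  let ?Q = "mixsum lam U V" and ?a = "lift_hom a" and ?b = "lift_hom b"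
  have tails: "ends_in J x" "ends_in J y" using Cons.prems by (auto dest: ends_in_Cons)
  have lets: "a # x \<in> U.letters" "b # y \<in> U.letters" using Cons.hyps by auto
  have ab: "a \<otimes>\<^bsub>U\<^esub> b \<in> carrier U" by (rule U.mult_closed[OF Cons.hyps(1,3)])
  note fc = linear_closed[OF lift_hom_linear] and nc = E.nested_closed
  have f: "?a \<in> carrier V" "?b \<in> carrier V" using Cons.hyps by (simp_all only: fc)
  have n: "nest x \<in> carrier V" "nest y \<in> carrier V" "nest (a # x) \<in> carrier V" "nest (b # y) \<in> carrier V"
    using Cons.hyps lets by (simp_all only: nc)
  note ma = E.V.mult_assoc
  have pull: "lift_op (lift_hom c \<bullet> ?Q nest u v) = ?Q (\<lambda>w. nest (c # w)) u v"
    if "c \<in> carrier U" "u \<in> U.letters" "v \<in> U.letters" for c u v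
    using U.mixsum_linear[OF E.V.module_axioms E.V.module_axioms
        linear_compose[OF E.V.mult_linear_right[OF fc[OF that(1)]] lift_op_linear] that(2,3), of nest] nc
    by simp
  have "nest (a # x) \<bullet> nest (b # y) = lift_op (ev (a # x)) \<bullet> lift_op (ev (b # y))"
    by simp
  also have "\<dots> = lift_op (ev (a # x) \<bullet> lift_op (ev (b # y)))
      \<oplus>\<^bsub>V\<^esub> lift_op (ev (b # y) \<bullet> lift_op (ev (a # x)))
      \<oplus>\<^bsub>V\<^esub> lam \<odot>\<^bsub>V\<^esub> lift_op (ev (a # x) \<bullet> ev (b # y))"
    using Cons.hyps Cons.prems by (intro lift_op_baxter ev_ends_in)
  also have "ev (a # x) \<bullet> lift_op (ev (b # y)) = ?a \<bullet> (nest x \<bullet> nest (b # y))"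
    using ma[OF f(1) n(1,4)] by simp
  also have "\<dots> = ?a \<bullet> ?Q nest x (b # y)"
    by (simp only: Cons.IH(1)[OF tails(1) Cons.prems(2)])
  also have "lift_op \<dots> = ?Q (\<lambda>w. nest (a # w)) x (b # y)"
    by (rule pull[OF Cons.hyps(1,2) lets(2)])
  also have "ev (b # y) \<bullet> lift_op (ev (a # x)) = ?b \<bullet> (nest (a # x) \<bullet> nest y)"
    using ma[OF f(2) n(2,3)] E.V.mult_comm[OF n(2,3)] by simp
  also have "\<dots> = ?b \<bullet> ?Q nest (a # x) y"
    by (simp only: Cons.IH(2)[OF Cons.prems(1) tails(2)])
  also have "lift_op \<dots> = ?Q (\<lambda>w. nest (b # w)) (a # x) y"
    by (rule pull[OF Cons.hyps(3) lets(1) Cons.hyps(4)])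
  also have "ev (a # x) \<bullet> ev (b # y) = (?a \<bullet> ?b) \<bullet> (nest x \<bullet> nest y)"
    unfolding eval_word_Cons by (rule E.V.mult_interchange[OF f n(1,2)])
  also have "\<dots> = lift_hom (a \<otimes>\<^bsub>U\<^esub> b) \<bullet> ?Q nest x y"
    by (simp only: lift_hom_mult[OF Cons.hyps(1,3)] Cons.IH(3)[OF tails])
  also have "lift_op \<dots> = ?Q (\<lambda>w. nest ((a \<otimes>\<^bsub>U\<^esub> b) # w)) x y"
    by (rule pull[OF ab Cons.hyps(2,4)])
  finally show ?case by (simp only: mixsum.simps)
qed

lemma universal_map:
  obtains k where "k \<in> linear_maps C ShU V" "\<And>w. w \<in> words U \<Longrightarrow> k (tensor w) = ev w"
  using U.tensor_extension[OF E.V.module_axioms _ E.eval_word_multilinear] E.eval_word_closed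
  by blast

text \<open>Since the value of a word is multilinear, it defines a linear map from the shuffle algebra to \<open>R\<^sup>+\<close>.
  On the subalgebra its values lie in \<open>R\<close>, and it is a Baxter morphism there because it is one on tensors.\<close>
lemma hom_exists:
  "\<exists>h\<in>extensional (carrier S0) \<inter> baxter0_hom C S0 (Sh0_P C lam A) R P. \<forall>a\<in>carrier A. h (j a) = \<phi> a"
proof -
  interpret S: baxter_algebra0 C lam ShU "Sh_P C U" by (rule U.Sh_baxter)
  obtain k where k: "k \<in> linear_maps C ShU V" and kt: "\<And>w. w \<in> words U \<Longrightarrow> k (tensor w) = ev w"
    using universal_map by blast
  have kg: "k (tensor w) = ev w" if "w \<in> good_words" for w
    using that kt by (simp add: good_words_def)
  have kz: "k \<zero>\<^bsub>ShU\<^esub> = \<zero>\<^bsub>V\<^esub>" by (rule linear_zero[OF S.module_axioms E.V.module_axioms k])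
  have klc: "k (c \<odot>\<^bsub>ShU\<^esub> X \<oplus>\<^bsub>ShU\<^esub> Y) = c \<odot>\<^bsub>V\<^esub> k X \<oplus>\<^bsub>V\<^esub> k Y"
    if "c \<in> carrier C" "X \<in> carrier S0" "Y \<in> carrier S0" for c X Y
    using that Sh0_mem by (simp add: linear_add[OF k] linear_smult[OF k])
  have kc: "k X \<in> carrier V" if "X \<in> carrier S0" for X
    using Sh0_mem[OF that] by (rule linear_closed[OF k])
  have kK: "k X \<in> K" if "X \<in> carrier S0" for X
    using that
  proof (induction rule: Sh0_induct)
    case (tensor w)
    then obtain a x where "w = a # x" "a \<in> carrier U" "x \<in> U.letters" "ends_in J (a # x)"
      by (rule good_wordsE)
    then show ?case using kg[OF tensor] ev_ends_in by simp
  next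
    case zero
    then show ?case by (simp add: kz)
  next
    case (lincomb c X Y)
    then show ?case by (auto simp: klc)
  qed
  have mult_gen: "k (tensor v \<diamondop> tensor w) = ev v \<bullet> ev w"
    if vw: "v \<in> good_words" "w \<in> good_words" for v w
  proof -
    obtain a x where v: "v = a # x" "a \<in> carrier U" "x \<in> U.letters" "ends_in J x"
      using vw(1) by (rule good_wordsE)
    obtain b y where w: "w = b # y" "b \<in> carrier U" "y \<in> U.letters" "ends_in J y"
      using vw(2) by (rule good_wordsE)
    have ab: "a \<otimes>\<^bsub>U\<^esub> b \<in> carrier U" by (rule U.mult_closed[OF v(2) w(2)])
    note fc = linear_closed[OF lift_hom_linear] and nc = E.nested_closed
    note f = fc[OF v(2)] fc[OF w(2)] and n = nc[OF v(3)] nc[OF w(3)]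
    have "k (tensor v \<diamondop> tensor w) = mixsum lam U V (\<lambda>u. k (tensor ((a \<otimes>\<^bsub>U\<^esub> b) # u))) x y"
      unfolding v(1) w(1) by (rule U.linear_tensor_mult[OF E.V.module_axioms k v(2) w(2) v(3) w(3)])
    also have "\<dots> = mixsum lam U V (\<lambda>u. lift_hom (a \<otimes>\<^bsub>U\<^esub> b) \<bullet> nest u) x y"
      by (rule U.mixsum_cong[OF E.V.module_axioms v(3) w(3)]) (use ab in \<open>simp only: kt Cons_words eval_word_Cons\<close>)
    also have "\<dots> = lift_hom (a \<otimes>\<^bsub>U\<^esub> b) \<bullet> mixsum lam U V nest x y"
      using nc by (intro U.mixsum_linear[OF E.V.module_axioms E.V.module_axioms
          E.V.mult_linear_right[OF fc[OF ab]] v(3) w(3), symmetric] funcsetI)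
    also have "\<dots> = (lift_hom a \<bullet> lift_hom b) \<bullet> (nest x \<bullet> nest y)"
      by (simp only: nest_mult[OF v(3) w(3) v(4) w(4)] lift_hom_mult[OF v(2) w(2)])
    also have "\<dots> = ev v \<bullet> ev w"
      unfolding v(1) w(1) eval_word_Cons by (rule E.V.mult_interchange[OF f n, symmetric])
    finally show ?thesis .
  qed
  have mult_left: "k (tensor v \<diamondop> Y) = k (tensor v) \<bullet> k Y"
    if v: "v \<in> good_words" and Y: "Y \<in> carrier S0" for v Y
    using Y
  proof (induction rule: Sh0_induct)
    case (tensor w)
    then show ?case using mult_gen[OF v tensor] by (simp only: kg v)
  next
    case zero
    then show ?case using tensor_in_Sh0[OF v] Sh0_mem kc by (simp add: kz del: unitization_simps)
  next
    case (lincomb c X Y)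
    note tv = tensor_in_Sh0[OF v]
    have "k (tensor v \<diamondop> (c \<odot>\<^bsub>ShU\<^esub> X \<oplus>\<^bsub>ShU\<^esub> Y))
        = k (c \<odot>\<^bsub>ShU\<^esub> (tensor v \<diamondop> X) \<oplus>\<^bsub>ShU\<^esub> tensor v \<diamondop> Y)"
      using lincomb tv Sh0_mem by (simp add: S.mult_distr_right S.smult_mult_right)
    then show ?case
      using lincomb tv klc kc Sh0_mult_closed
      by (simp add: E.V.mult_lincomb_right del: unitization_simps)
  qed
  have mult: "k (X \<diamondop> Y) = k X \<bullet> k Y" if X: "X \<in> carrier S0" and Y: "Y \<in> carrier S0" for X Y
    using X
  proof (induction rule: Sh0_induct)
    case (tensor v)
    then show ?case by (rule mult_left[OF _ Y])
  next
    case zero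
    then show ?case using Sh0_mem[OF Y] kc[OF Y] by (simp add: kz del: unitization_simps)
  next
    case (lincomb c X X')
    have "k ((c \<odot>\<^bsub>ShU\<^esub> X \<oplus>\<^bsub>ShU\<^esub> X') \<diamondop> Y)
        = k (c \<odot>\<^bsub>ShU\<^esub> (X \<diamondop> Y) \<oplus>\<^bsub>ShU\<^esub> X' \<diamondop> Y)"
      using lincomb Y Sh0_mem by (simp add: S.mult_distr S.smult_mult)
    then show ?case
      using lincomb Y klc kc Sh0_mult_closed
      by (simp add: E.V.mult_lincomb_left del: unitization_simps)
  qed
  have op: "k (Sh_P C U X) = lift_op (k X)" if X: "X \<in> carrier S0" for X
    using X
  proof (induction rule: Sh0_induct)
    case (tensor w)
    have w: "w \<in> words U" "w \<noteq> []" "w \<in> U.letters" using tensor by (auto simp: good_words_def words_def)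
    have "k (Sh_P C U (tensor w)) = lift_hom \<one>\<^bsub>U\<^esub> \<bullet> nest w"
      by (simp only: Sh0_P_tensor[OF tensor] kg eval_word_Cons)
    also have "\<dots> = nest w"
      unfolding lift_hom_one by (rule E.V.one_mult[OF E.nested_closed[OF w(3)]])
    also have "\<dots> = lift_op (k (tensor w))" by (simp only: nested_eval_word[OF w(2)] kg[OF tensor])
    finally show ?case .
  next
    case zero
    show ?case
      by (simp only: kz linear_zero[OF S.module_axioms S.module_axioms S.operator_linear]
          linear_zero[OF E.V.module_axioms E.V.module_axioms lift_op_linear])
  next
    case (lincomb c X Y)
    have "Sh_P C U (c \<odot>\<^bsub>ShU\<^esub> X \<oplus>\<^bsub>ShU\<^esub> Y) = c \<odot>\<^bsub>ShU\<^esub> Sh_P C U X \<oplus>\<^bsub>ShU\<^esub> Sh_P C U Y"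
      using lincomb Sh0_mem by (simp add: linear_add[OF S.operator_linear] linear_smult[OF S.operator_linear])
    moreover have "lift_op (c \<odot>\<^bsub>V\<^esub> k X \<oplus>\<^bsub>V\<^esub> k Y) = c \<odot>\<^bsub>V\<^esub> lift_op (k X) \<oplus>\<^bsub>V\<^esub> lift_op (k Y)"
      using lincomb kc by (simp add: linear_add[OF lift_op_linear] linear_smult[OF lift_op_linear] del: unitization_simps)
    ultimately show ?case using lincomb by (simp add: klc Sh0_P_closed)
  qed
  define h where "h = restrict (snd \<circ> k) (carrier S0)"
  note sub = S.submoduleE(4,5)[OF Sh0_submodule]
  have h: "k X = (\<zero>\<^bsub>C\<^esub>, h X)" "h X \<in> carrier R" if "X \<in> carrier S0" for X
    using kK[OF that] that by (auto simp: h_def)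
  have "h \<in> linear_maps C S0 R"
  proof (rule linear_mapsI)
    fix X Y assume X: "X \<in> carrier S0" "Y \<in> carrier S0"
    have "k (X \<oplus>\<^bsub>ShU\<^esub> Y) = k X \<oplus>\<^bsub>V\<^esub> k Y" using X Sh0_mem by (simp add: linear_add[OF k])
    then show "h (X \<oplus>\<^bsub>S0\<^esub> Y) = h X \<oplus>\<^bsub>R\<^esub> h Y" using X h sub by simp
  next
    fix c X assume X: "c \<in> carrier C" "X \<in> carrier S0"
    have "k (c \<odot>\<^bsub>ShU\<^esub> X) = c \<odot>\<^bsub>V\<^esub> k X" using X Sh0_mem by (simp add: linear_smult[OF k])
    then show "h (c \<odot>\<^bsub>S0\<^esub> X) = c \<odot>\<^bsub>R\<^esub> h X" using X h sub by simp
  qed (rule h)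
  moreover have "h \<in> hom S0 R"
  proof (rule homI)
    fix X Y assume X: "X \<in> carrier S0" "Y \<in> carrier S0"
    have "k (X \<diamondop> Y) = (\<zero>\<^bsub>C\<^esub>, h X) \<bullet> (\<zero>\<^bsub>C\<^esub>, h Y)" using mult X h by simp
    then show "h (X \<otimes>\<^bsub>S0\<^esub> Y) = h X \<otimes>\<^bsub>R\<^esub> h Y"
      using X h Sh0_mult_closed by (simp add: R.mult_closed)
  qed (rule h)
  moreover have "h (Sh0_P C lam A X) = P (h X)" if X: "X \<in> carrier S0" for X
  proof -
    have "k (Sh_P C U X) = lift_op (\<zero>\<^bsub>C\<^esub>, h X)" using op h X by simp
    then show ?thesis using h(1)[OF Sh0_P_closed[OF X]] X by (simp add: Sh0_P_def lift_op_def)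
  qed
  moreover have "h (j a) = \<phi> a" if a: "a \<in> carrier A" for a
  proof -
    have f: "lift_hom (\<zero>\<^bsub>C\<^esub>, a) \<in> carrier V" using a by (intro linear_closed[OF lift_hom_linear]) simp
    have "k (j a) = lift_hom (\<zero>\<^bsub>C\<^esub>, a) \<bullet> \<one>\<^bsub>V\<^esub>"
      using kg[OF singleton_good[OF a]] by (simp only: Sh0_j_def eval_word_Cons nested.simps)
    also have "\<dots> = lift_hom (\<zero>\<^bsub>C\<^esub>, a)" by (rule E.V.mult_one[OF f])
    finally show ?thesis using h(1)[OF j_closed[OF a]] by (simp add: lift_hom_def)
  qed
  ultimately show ?thesis
    by (intro bexI[of _ h]) (auto simp: baxter0_hom_def algebra0_hom_def h_def)
qed

end

lemma universal_property:
  assumes R: "baxter_algebra0 C lam R P" and \<phi>: "\<phi> \<in> algebra0_hom C A R"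
  shows "\<exists>!h. h \<in> extensional (carrier S0) \<and> h \<in> baxter0_hom C S0 (Sh0_P C lam A) R P
    \<and> (\<forall>a\<in>carrier A. h (j a) = \<phi> a)"
proof (rule ex_ex1I)
  show "\<exists>h. h \<in> extensional (carrier S0) \<and> h \<in> baxter0_hom C S0 (Sh0_P C lam A) R P
      \<and> (\<forall>a\<in>carrier A. h (j a) = \<phi> a)"
    using hom_exists[OF R \<phi>] by blast
  fix h k
  assume h: "h \<in> extensional (carrier S0) \<and> h \<in> baxter0_hom C S0 (Sh0_P C lam A) R P
      \<and> (\<forall>a\<in>carrier A. h (j a) = \<phi> a)"
    and k: "k \<in> extensional (carrier S0) \<and> k \<in> baxter0_hom C S0 (Sh0_P C lam A) R P
      \<and> (\<forall>a\<in>carrier A. k (j a) = \<phi> a)"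
  have "h X = k X" if "X \<in> carrier S0" for X
    by (rule hom_determined[OF R _ _ _ that]) (use h k in auto)
  then show "h = k" using h k by (intro extensionalityI[of h "carrier S0" k]) auto
qed

text \<open>The zero operator makes \<open>A\<close> a Baxter algebra, and a morphism to it that extends the identity of
  \<open>A\<close> is a left inverse of \<open>j\<close>.\<close>
lemma j_inj: "inj_on j (carrier A)"
proof -
  have "baxter_algebra0 C lam A (\<lambda>_. \<zero>\<^bsub>A\<^esub>)"
  proof (intro baxter_algebra0.intro comm_algebra0_axioms baxter_algebra0_axioms.intro weight_closed)
    show "(\<lambda>_. \<zero>\<^bsub>A\<^esub>) \<in> linear_maps C A A" by (rule linear_mapsI) simp_all
  qed (use weight_closed in simp_all)
  moreover have "(\<lambda>a. a) \<in> algebra0_hom C A A"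
    by (auto simp: algebra0_hom_def linear_maps_def hom_def)
  ultimately obtain h where "\<And>a. a \<in> carrier A \<Longrightarrow> h (j a) = a"
    using universal_property[of A "\<lambda>_. \<zero>\<^bsub>A\<^esub>" "\<lambda>a. a"] by blast
  then show ?thesis by (rule inj_on_inverseI)
qed

end

theorem proposition2p6:
  fixes C :: "('c, 'm) ring_scheme"
    and lam :: 'c
    and A :: "('c, 'a, 'n) module_scheme"
  assumes "cring C"
    and "lam \<in> carrier C"
    and "comm_algebra0 C A"
  shows "baxter_algebra0 C lam (Sh0 C lam A) (Sh0_P C lam A)
    \<and> Sh0_j C A \<in> algebra0_hom C A (Sh0 C lam A)
    \<and> inj_on (Sh0_j C A) (carrier A)
    \<and> (\<forall>(R :: ('c, 'r, 'k) module_scheme) P \<phi>.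
          baxter_algebra0 C lam R P \<longrightarrow> \<phi> \<in> algebra0_hom C A R \<longrightarrow>
          (\<exists>!\<psi>. \<psi> \<in> extensional (carrier (Sh0 C lam A))
             \<and> \<psi> \<in> baxter0_hom C (Sh0 C lam A) (Sh0_P C lam A) R P
             \<and> (\<forall>a\<in>carrier A. \<psi> (Sh0_j C A a) = \<phi> a)))"
proof -
  interpret shuffle_algebra0 C lam A
    by (intro shuffle_algebra0.intro shuffle_algebra0_axioms.intro assms(2,3))
  show ?thesis
    by (intro conjI allI impI Sh0_baxter j_hom j_inj universal_property)
qed

end
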